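(* Let $\tau,\lambda,\gamma\in(0,1]$ with $\lambda\gamma+\tau>1$. Let $W:\mathbb{R}\times\mathbb{R}^d\to\mathbb{R}^d$ be such that $\|W\|_{\tau,\lambda;a',b'}<\infty$ for all $a'<b'$, and let $\varphi:\mathbb{R}\to\mathbb{R}^d$ be such that $\|\varphi\|_{\gamma;a',b'}<\infty$ for all $a'<b'$. Let $-\infty<a<b<\infty$. Then for every $\alpha\in(1-\tau,\lambda\gamma)$ the quantity $$(-1)^{\alpha}\int_{a}^{b}D_{a+}^{\alpha,t'}D_{b-}^{1-\alpha,t}W_{b-}(t,\varphi_{t'})\big|_{t'=t}\,dt$$ is finite, and its value does not depend on the choice of $\alpha\in(1-\tau,\lambda\gamma)$. Consequently the nonlinear integral $\int_a^b W(dt,\varphi_t)$, defined to be this common value, is well defined, and for every $\alpha\in(1-\tau,\lambda\gamma)$ $$\begin{aligned}\int_{a}^{b}W(dt,\varphi_{t})=-\frac{1}{\Gamma(\alpha)\Gamma(1-\alpha)}\Big\{&\int_{a}^{b}\frac{W_{b-}(t,\varphi_{t})}{(b-t)^{1-\alpha}(t-a)^{\alpha}}dt+\alpha\int_{a}^{b}\int_{a}^{t}\frac{W_{b-}(t,\varphi_{t})-W_{b-}(t,\varphi_{r})}{(b-t)^{1-\alpha}(t-r)^{\alpha+1}}dr\,dt\\&+(1-\alpha)\int_{a}^{b}\int_{t}^{b}\frac{W(t,\varphi_{t})-W(s,\varphi_{t})}{(s-t)^{2-\alpha}(t-a)^{\alpha}}ds\,dt\\&+\alpha(1-\alpha)\int_{a}^{b}\int_{a}^{t}\int_{t}^{b}\frac{W(t,\varphi_{t})-W(s,\varphi_{t})-W(t,\varphi_{r})+W(s,\varphi_{r})}{(s-t)^{2-\alpha}(t-r)^{\alpha+1}}ds\,dr\,dt\Big\}.\end{aligned}$$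 Moreover, there is a constant $\kappa$ depending only on $\tau,\lambda,\alpha$ (and not on $W,\varphi,a,b$) such that $$\Big|\int_{a}^{b}W(dt,\varphi_{t})\Big|\le\kappa\|W\|_{\tau,\lambda;a,b}(b-a)^{\tau}+\kappa\|W\|_{\tau,\lambda;a,b}\|\varphi\|_{\gamma;a,b}^{\lambda}(b-a)^{\tau+\lambda\gamma}.$$
   Context: Seminorms: for $a<b$, $$\|W\|_{\tau,\lambda;a,b}=\sup_{a\le s<t\le b,\ x\ne y}\frac{|W(s,x)-W(t,x)-W(s,y)+W(t,y)|}{|t-s|^\tau|x-y|^\lambda}+\sup_{a\le s<t\le b,\ x}\frac{|W(s,x)-W(t,x)|}{|t-s|^\tau}+\sup_{a\le t\le b,\ x\neq y}\frac{|W(t,y)-W(t,x)|}{|x-y|^\lambda},$$ where $x,y$ range over $\mathbb{R}^d$, and $\|\varphi\|_{\gamma;a,b}=\sup_{a\le s<t\le b}\frac{|\varphi(t)-\varphi(s)|}{|t-s|^\gamma}$. We write $\varphi_t=\varphi(t)$ and $W_{b-}(t,x)=W(t,x)-W(b,x)$. Fractional (Weyl) derivatives: for $0<\alpha<1$, $$D_{a+}^{\alpha}f(t)=\frac{1}{\Gamma(1-\alpha)}\Big(\frac{f(t)}{(t-a)^\alpha}+\alpha\int_a^t\frac{f(t)-f(s)}{(t-s)^{\alpha+1}}ds\Big),\qquad D_{b-}^{\alpha}f(t)=\frac{(-1)^\alpha}{\Gamma(1-\alpha)}\Big(\frac{f(t)}{(b-t)^\alpha}+\alpha\int_t^b\frac{f(t)-f(s)}{(s-t)^{\alpha+1}}ds\Big),$$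 with $(-1)^\alpha=e^{i\pi\alpha}$. The superscript variable in $D_{a+}^{\alpha,t'}$, $D_{b-}^{1-\alpha,t}$ indicates the variable in which the derivative is taken (the other being held fixed); $|_{t'=t}$ means evaluation at $t'=t$ afterwards. *)

theory Defs
  imports "HOL-Analysis.Analysis"
begin

text \<open>
  The space \<open>\<real>\<^sup>d\<close> is \<open>topspace (Euclidean_space d)\<close>, the set of all \<open>x :: nat \<Rightarrow> real\<close> with
  \<open>x i = 0\<close> for \<open>i \<ge> d\<close>, with Euclidean norm \<open>L2_set x {..<d}\<close>. An index type for the coordinates
  would not do: the constant in the final estimate must not depend on \<open>d\<close>, so the dimension has
  to be quantified inside a formula. Derivatives and integrals of vector-valued functions are
  taken coordinatewise.
\<close>

abbreviation R_space :: "nat \<Rightarrow> (nat \<Rightarrow> real) set"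
  where "R_space d \<equiv> topspace (Euclidean_space d)"

abbreviation vnorm :: "nat \<Rightarrow> (nat \<Rightarrow> real) \<Rightarrow> real"
  where "vnorm d x \<equiv> L2_set x {..<d}"

abbreviation cvnorm :: "nat \<Rightarrow> (nat \<Rightarrow> complex) \<Rightarrow> real"
  where "cvnorm d z \<equiv> L2_set (\<lambda>i. cmod (z i)) {..<d}"

definition W_seminorm ::
  "nat \<Rightarrow> real \<Rightarrow> real \<Rightarrow> real \<Rightarrow> real \<Rightarrow> (real \<Rightarrow> (nat \<Rightarrow> real) \<Rightarrow> nat \<Rightarrow> real) \<Rightarrow> ennreal"
  where "W_seminorm d \<tau> lam a b W =
    (SUP (s, t, x, y) \<in> {(s, t, x, y). a \<le> s \<and> s < t \<and> t \<le> b \<and>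
                            x \<in> R_space d \<and> y \<in> R_space d \<and> x \<noteq> y}.
       ennreal (vnorm d (\<lambda>i. W s x i - W t x i - W s y i + W t y i) /
                (\<bar>t - s\<bar> powr \<tau> * vnorm d (\<lambda>i. x i - y i) powr lam)))
  + (SUP (s, t, x) \<in> {(s, t, x). a \<le> s \<and> s < t \<and> t \<le> b \<and> x \<in> R_space d}.
       ennreal (vnorm d (\<lambda>i. W s x i - W t x i) / \<bar>t - s\<bar> powr \<tau>))
  + (SUP (t, x, y) \<in> {(t, x, y). a \<le> t \<and> t \<le> b \<and>
                            x \<in> R_space d \<and> y \<in> R_space d \<and> x \<noteq> y}.
       ennreal (vnorm d (\<lambda>i. W t y i - W t x i) / vnorm d (\<lambda>i. x i - y i) powr lam))"

definition holder_seminorm :: "nat \<Rightarrow> real \<Rightarrow> real \<Rightarrow> real \<Rightarrow> (real \<Rightarrow> nat \<Rightarrow> real) \<Rightarrow> ennreal"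
  where "holder_seminorm d \<gamma> a b \<phi> =
    (SUP (s, t) \<in> {(s, t). a \<le> s \<and> s < t \<and> t \<le> b}.
       ennreal (vnorm d (\<lambda>i. \<phi> t i - \<phi> s i) / \<bar>t - s\<bar> powr \<gamma>))"

definition left_weyl :: "real \<Rightarrow> real \<Rightarrow> (real \<Rightarrow> complex) \<Rightarrow> real \<Rightarrow> complex"
  where "left_weyl \<alpha> a f t =
    1 / of_real (Gamma (1 - \<alpha>)) *
    (f t / of_real ((t - a) powr \<alpha>) +
     of_real \<alpha> * (LBINT s:{a..t}. (f t - f s) / of_real ((t - s) powr (\<alpha> + 1))))"

text \<open>Here \<open>cis (pi * \<alpha>)\<close> is \<open>(-1)\<^sup>\<alpha> = e\<^sup>i\<^sup>\<pi>\<^sup>\<alpha>\<close>.\<close>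

definition right_weyl :: "real \<Rightarrow> real \<Rightarrow> (real \<Rightarrow> complex) \<Rightarrow> real \<Rightarrow> complex"
  where "right_weyl \<alpha> b f t =
    cis (pi * \<alpha>) / of_real (Gamma (1 - \<alpha>)) *
    (f t / of_real ((b - t) powr \<alpha>) +
     of_real \<alpha> * (LBINT s:{t..b}. (f t - f s) / of_real ((s - t) powr (\<alpha> + 1))))"

text \<open>
  Lebesgue integrals of non-integrable functions are \<open>0\<close> in HOL, so the existence of the integrals
  involved has to be expressed separately.
\<close>

definition left_weyl_exists :: "real \<Rightarrow> real \<Rightarrow> (real \<Rightarrow> complex) \<Rightarrow> real \<Rightarrow> bool"
  where "left_weyl_exists \<alpha> a f t \<longleftrightarrow>
    set_integrable lborel {a..t} (\<lambda>s. (f t - f s) / of_real ((t - s) powr (\<alpha> + 1)))"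

definition right_weyl_exists :: "real \<Rightarrow> real \<Rightarrow> (real \<Rightarrow> complex) \<Rightarrow> real \<Rightarrow> bool"
  where "right_weyl_exists \<alpha> b f t \<longleftrightarrow>
    set_integrable lborel {t..b} (\<lambda>s. (f t - f s) / of_real ((s - t) powr (\<alpha> + 1)))"

definition W_minus ::
  "real \<Rightarrow> (real \<Rightarrow> (nat \<Rightarrow> real) \<Rightarrow> nat \<Rightarrow> real) \<Rightarrow> real \<Rightarrow> (nat \<Rightarrow> real) \<Rightarrow> nat \<Rightarrow> real"
  where "W_minus b W t x i = W t x i - W b x i"

text \<open>
  The \<open>i\<close>-th coordinate of \<open>D\<^sub>b\<^sub>-\<close> of order \<open>1 - \<alpha>\<close>, in the variable \<open>t\<close> with \<open>t'\<close> held fixed, of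
  \<open>W\<^sub>b\<^sub>-(t, \<phi>(t'))\<close>, as a function of \<open>t\<close> and \<open>t'\<close>.
\<close>

definition right_weyl_W ::
  "real \<Rightarrow> (real \<Rightarrow> (nat \<Rightarrow> real) \<Rightarrow> nat \<Rightarrow> real) \<Rightarrow> (real \<Rightarrow> nat \<Rightarrow> real)
    \<Rightarrow> real \<Rightarrow> nat \<Rightarrow> real \<Rightarrow> real \<Rightarrow> complex"
  where "right_weyl_W \<alpha> W \<phi> b i t t' =
    right_weyl (1 - \<alpha>) b (\<lambda>u. of_real (W_minus b W u (\<phi> t') i)) t"

definition weyl_quantity ::
  "real \<Rightarrow> (real \<Rightarrow> (nat \<Rightarrow> real) \<Rightarrow> nat \<Rightarrow> real) \<Rightarrow> (real \<Rightarrow> nat \<Rightarrow> real) \<Rightarrow> real \<Rightarrow> real \<Rightarrow> nat \<Rightarrow> complex"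
  where "weyl_quantity \<alpha> W \<phi> a b = (\<lambda>i.
    cis (pi * \<alpha>) * (LBINT t:{a..b}. left_weyl \<alpha> a (\<lambda>t'. right_weyl_W \<alpha> W \<phi> b i t t') t))"

definition weyl_quantity_finite ::
  "real \<Rightarrow> (real \<Rightarrow> (nat \<Rightarrow> real) \<Rightarrow> nat \<Rightarrow> real) \<Rightarrow> (real \<Rightarrow> nat \<Rightarrow> real) \<Rightarrow> real \<Rightarrow> real \<Rightarrow> bool"
  where "weyl_quantity_finite \<alpha> W \<phi> a b \<longleftrightarrow> (\<forall>i.
    (\<forall>t\<in>{a<..<b}. \<forall>t'\<in>{a..b}.
       right_weyl_exists (1 - \<alpha>) b (\<lambda>u. of_real (W_minus b W u (\<phi> t') i)) t) \<and>
    (\<forall>t\<in>{a<..<b}. left_weyl_exists \<alpha> a (\<lambda>t'. right_weyl_W \<alpha> W \<phi> b i t t') t) \<and>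
    set_integrable lborel {a..b} (\<lambda>t. left_weyl \<alpha> a (\<lambda>t'. right_weyl_W \<alpha> W \<phi> b i t t') t))"

text \<open>
  The common value over all admissible \<open>\<alpha>\<close>, as an element of complex \<open>d\<close>-space
  because of the factors \<open>(-1)\<^sup>\<alpha>\<close>; coordinates \<open>i \<ge> d\<close> vanish with those of \<open>W\<close>.
\<close>

definition nonlinear_integral ::
  "real \<Rightarrow> real \<Rightarrow> real \<Rightarrow> (real \<Rightarrow> (nat \<Rightarrow> real) \<Rightarrow> nat \<Rightarrow> real) \<Rightarrow> (real \<Rightarrow> nat \<Rightarrow> real)
    \<Rightarrow> real \<Rightarrow> real \<Rightarrow> nat \<Rightarrow> complex"
  where "nonlinear_integral \<tau> lam \<gamma> W \<phi> a b =
    (THE I. \<forall>\<alpha>\<in>{1 - \<tau><..<lam * \<gamma>}. weyl_quantity \<alpha> W \<phi> a b = I)"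

text \<open>Existence of every (inner and outer) integral in the expanded formula for the integral.\<close>

definition expansion_integrals_exist ::
  "real \<Rightarrow> (real \<Rightarrow> (nat \<Rightarrow> real) \<Rightarrow> nat \<Rightarrow> real) \<Rightarrow> (real \<Rightarrow> nat \<Rightarrow> real) \<Rightarrow> real \<Rightarrow> real \<Rightarrow> bool"
  where "expansion_integrals_exist \<alpha> W \<phi> a b \<longleftrightarrow> (\<forall>i.
    (let f1 = (\<lambda>t. W_minus b W t (\<phi> t) i / ((b - t) powr (1 - \<alpha>) * (t - a) powr \<alpha>));
         f2 = (\<lambda>t r. (W_minus b W t (\<phi> t) i - W_minus b W t (\<phi> r) i) /
                      ((b - t) powr (1 - \<alpha>) * (t - r) powr (\<alpha> + 1)));
         f3 = (\<lambda>t s. (W t (\<phi> t) i - W s (\<phi> t) i) /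
                      ((s - t) powr (2 - \<alpha>) * (t - a) powr \<alpha>));
         f4 = (\<lambda>t r s. (W t (\<phi> t) i - W s (\<phi> t) i - W t (\<phi> r) i + W s (\<phi> r) i) /
                      ((s - t) powr (2 - \<alpha>) * (t - r) powr (\<alpha> + 1)))
     in set_integrable lborel {a..b} f1 \<and>
        (\<forall>t\<in>{a<..<b}. set_integrable lborel {a..t} (f2 t)) \<and>
        set_integrable lborel {a..b} (\<lambda>t. LBINT r:{a..t}. f2 t r) \<and>
        (\<forall>t\<in>{a<..<b}. set_integrable lborel {t..b} (f3 t)) \<and>
        set_integrable lborel {a..b} (\<lambda>t. LBINT s:{t..b}. f3 t s) \<and>
        (\<forall>t\<in>{a<..<b}. \<forall>r\<in>{a..<t}. set_integrable lborel {t..b} (f4 t r)) \<and>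
        (\<forall>t\<in>{a<..<b}. set_integrable lborel {a..t} (\<lambda>r. LBINT s:{t..b}. f4 t r s)) \<and>
        set_integrable lborel {a..b} (\<lambda>t. LBINT r:{a..t}. LBINT s:{t..b}. f4 t r s)))"

end

theory Submission
  imports Defs
begin

text \<open>
  For a direction \<open>v\<close> put \<open>G(s, r) = v \<bullet> W(s, \<phi>(r))\<close>. This scalar function is \<open>\<tau>\<close>-Hoelder in \<open>s\<close>, and its mixed
  increments are of order \<open>\<tau>\<close> in \<open>s\<close> and \<open>\<lambda>\<gamma>\<close> in \<open>r\<close>. These two bounds dominate all integrands, so the
  iterated fractional derivative is integrable, and its integral is continuous under pointwise
  convergence with uniform bounds. If \<open>G\<close> is smooth, Fubini's theorem and the Beta integral show
  that the integral is \<open>- \<Gamma>(\<alpha>) \<Gamma>(1 - \<alpha>) \<integral> (\<partial>\<^sub>s G)(s, s) ds\<close>. Averaging \<open>G\<close> over small squares preserves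
  both bounds, so approximation by these averages shows that after division by
  \<open>\<Gamma>(\<alpha>) \<Gamma>(1 - \<alpha>)\<close> the integral does not depend on \<open>\<alpha>\<close>.
\<close>

section \<open>One-sided fractional derivatives\<close>

text \<open>The limit is the delicate point: averages of a Hoelder function need not converge to it
  in the same Hoelder seminorm. Dominated convergence avoids this, since common Hoelder constants
  already dominate the singular kernels and only pointwise convergence is left to check.

  In the smooth case the right derivative of order 1 - \<alpha> is minus a fractional integral of
  order \<alpha> of the s-derivative, while the left derivative of order \<alpha> acts on the other
  variable. After an interchange of integrals the two meet on the triangle t \<le> s, where the
  fractional integral undoes the derivative. Hence only the diagonal value survives, and \<alpha>
  remains only in the Gamma factors.

  All this is done with real, unnormalised derivatives. The complex factors multiply to exp(i pi) =
  -1, which cancels the minus sign of the smooth formula; the value is then the integral of the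
  s-derivative of G on the diagonal, as the notation W(dt, phi_t) suggests.

  General directions are needed besides the coordinate ones because adding up coordinatewise bounds
  would bring the dimension into the constant.\<close>

lemma set_integrable_dominated:
  fixes f k :: "real \<Rightarrow> real"
  assumes "set_integrable lborel S k" "f \<in> borel_measurable borel" "S \<in> sets borel"
    and "\<And>x. x \<in> S \<Longrightarrow> \<bar>f x\<bar> \<le> k x"
  shows "set_integrable lborel S f" and "\<bar>LBINT x:S. f x\<bar> \<le> (LBINT x:S. k x)"
proof -
  show f: "set_integrable lborel S f"
  proof (rule set_integrable_bound[OF assms(1)])
    show "set_borel_measurable lborel S f"
      using assms(2,3) by (simp add: set_borel_measurable_def)
    show "AE x in lborel. x \<in> S \<longrightarrow> norm (f x) \<le> norm (k x)"
      using assms(4) by (intro AE_I2) force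
  qed
  have "norm (LBINT x:S. f x) \<le> (LBINT x:S. norm (f x))"
    by (rule set_integral_norm_bound[OF f])
  also have "\<dots> \<le> (LBINT x:S. k x)"
    using assms(4) by (intro set_integral_mono set_integrable_norm f assms(1)) auto
  finally show "\<bar>LBINT x:S. f x\<bar> \<le> (LBINT x:S. k x)" by simp
qed

lemma set_integral_dominated_convergence:
  fixes f :: "nat \<Rightarrow> real \<Rightarrow> real"
  assumes "set_integrable lborel S k" "\<And>n. f n \<in> borel_measurable borel"
    "f' \<in> borel_measurable borel" "S \<in> sets borel"
    and "\<And>n x. x \<in> S \<Longrightarrow> \<bar>f n x\<bar> \<le> k x" "\<And>x. x \<in> S \<Longrightarrow> (\<lambda>n. f n x) \<longlonglongrightarrow> f' x"
  shows "(\<lambda>n. LBINT x:S. f n x) \<longlonglongrightarrow> (LBINT x:S. f' x)"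
  unfolding set_lebesgue_integral_def
proof (rule integral_dominated_convergence[where w="\<lambda>x. indicator S x *\<^sub>R k x"])
  show "integrable lborel (\<lambda>x. indicator S x *\<^sub>R k x)"
    using assms(1) by (simp add: set_integrable_def)
qed (use assms in \<open>auto split: split_indicator\<close>)

text \<open>Carries closed formulas for the gauge integral over to Lebesgue integrals: nonnegativity
  makes gauge integrability absolute, and Borel measurability permits the descent from
  \<open>lebesgue\<close> to \<open>lborel\<close>.\<close>

lemma has_integral_imp_set_integral_lborel:
  fixes f :: "real \<Rightarrow> real"
  assumes "(f has_integral I) S" "f \<in> borel_measurable borel" "S \<in> sets borel"
    and "\<And>x. x \<in> S \<Longrightarrow> 0 \<le> f x"
  shows "set_integrable lborel S f" and "(LBINT x:S. f x) = I"
proof -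
  have "set_integrable lebesgue S f"
    using assms by (intro nonnegative_absolutely_integrable_1) auto
  then show *: "set_integrable lborel S f"
    using assms(2,3) by (subst (asm) set_integrable_def, subst (asm) integrable_completion)
      (auto simp: set_integrable_def)
  show "(LBINT x:S. f x) = I"
    using set_borel_integral_eq_integral[OF *] assms(1) by (simp add: integral_unique)
qed

section \<open>Integrals of powers over an interval\<close>

lemma set_integral_powr:
  fixes p :: real
  assumes "p > -1" "a \<le> b"
  shows "set_integrable lborel {a..b} (\<lambda>x. (x - a) powr p)"
    and "(LBINT x:{a..b}. (x - a) powr p) = (b - a) powr (p + 1) / (p + 1)"
    and "set_integrable lborel {a..b} (\<lambda>x. (b - x) powr p)"
    and "(LBINT x:{a..b}. (b - x) powr p) = (b - a) powr (p + 1) / (p + 1)"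
proof -
  have *: "((\<lambda>x. x powr p) has_integral ((b - a) powr (p+1) / (p+1))) {0..b-a}"
    using has_integral_powr_from_0[of p "b - a"] assms by simp
  have 1: "set_integrable lborel {0..b-a} (\<lambda>x. x powr p)"
    and 2: "(LBINT x:{0..b-a}. x powr p) = (b - a) powr (p+1) / (p+1)"
    using has_integral_imp_set_integral_lborel[OF *] by auto
  \<comment> \<open>The formula on \<open>{0..b-a}\<close> is moved by a translation or a
    reflection; the indicator has to be substituted along with the power.\<close>
  have i1: "indicator {0..b-a} (- a + 1 * x) = (indicator {a..b} x :: real)" for x
    by (auto split: split_indicator)
  have i2: "indicator {0..b-a} (b + (-1) * x) = (indicator {a..b} x :: real)" for x
    by (auto split: split_indicator)
  show "set_integrable lborel {a..b} (\<lambda>x. (x - a) powr p)"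
    using lborel_integrable_real_affine[OF 1[unfolded set_integrable_def], of 1 "-a"]
    unfolding i1 by (simp add: set_integrable_def)
  show "set_integrable lborel {a..b} (\<lambda>x. (b - x) powr p)"
    using lborel_integrable_real_affine[OF 1[unfolded set_integrable_def], of "-1" "b"]
    unfolding i2 by (simp add: set_integrable_def)
  show "(LBINT x:{a..b}. (x - a) powr p) = (b - a) powr (p + 1) / (p + 1)"
    using lborel_integral_real_affine[of 1 "\<lambda>x. indicator {0..b-a} x *\<^sub>R x powr p" "-a"] 2
    unfolding i1 by (simp add: set_lebesgue_integral_def)
  show "(LBINT x:{a..b}. (b - x) powr p) = (b - a) powr (p + 1) / (p + 1)"
    using lborel_integral_real_affine[of "-1" "\<lambda>x. indicator {0..b-a} x *\<^sub>R x powr p" "b"] 2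
    unfolding i2 by (simp add: set_lebesgue_integral_def)
qed

text \<open>At the end point itself both derivatives are \<open>0\<close>: the integral is over a single point, and
  \<open>x / 0 = 0\<close>. Hence the estimates below need no exception there.\<close>

definition right_deriv :: "real \<Rightarrow> real \<Rightarrow> (real \<Rightarrow> real) \<Rightarrow> real \<Rightarrow> real" where
  "right_deriv \<beta> b f t =
    (f t - f b) / (b - t) powr \<beta> + \<beta> * (LBINT s:{t..b}. (f t - f s) / (s - t) powr (\<beta> + 1))"

text \<open>The asymmetry with \<open>right_deriv\<close> is intended. Subtracting
  \<open>f b\<close> there absorbs the passage from W to \<open>W_minus\<close>, so that W itself
  can be inserted; here nothing is subtracted. Both omit the Gamma factor and the power of
  -1.\<close>

definition left_deriv :: "real \<Rightarrow> real \<Rightarrow> (real \<Rightarrow> real) \<Rightarrow> real \<Rightarrow> real" where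
  "left_deriv \<alpha> a f t =
    f t / (t - a) powr \<alpha> + \<alpha> * (LBINT r:{a..t}. (f t - f r) / (t - r) powr (\<alpha> + 1))"

text \<open>At \<open>x = 0\<close> both sides are 0, because \<open>0 powr p = 0\<close> and
  division by 0 gives 0. Kernels can therefore be dominated on closed intervals, singular point
  included. With \<beta> lowered by 1 the same bound serves for boundary terms.\<close>

lemma singular_quotient_le:
  fixes x y :: real
  assumes "0 \<le> x" "\<bar>y\<bar> \<le> C * x powr \<tau>"
  shows "\<bar>y / x powr (\<beta> + 1)\<bar> \<le> C * x powr (\<tau> - \<beta> - 1)"
proof (cases "x = 0")
  case False
  then have x: "x > 0" using assms by simp
  have "\<bar>y / x powr (\<beta> + 1)\<bar> \<le> C * x powr \<tau> / x powr (\<beta> + 1)"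
    using assms by (simp add: divide_right_mono)
  also have "\<dots> = C * x powr (\<tau> - \<beta> - 1)"
    using powr_diff[of x \<tau> "\<beta> + 1"] x by (simp add: algebra_simps diff_diff_eq)
  finally show ?thesis .
qed auto

text \<open>A regularity \<tau> above the order \<beta> leaves a majorant with exponent \<tau> -
  \<beta> - 1 > -1.\<close>

lemma right_kernel_integrable:
  fixes f :: "real \<Rightarrow> real"
  assumes "f \<in> borel_measurable borel" "\<beta> < \<tau>" "t \<le> b"
    and "\<And>s. s \<in> {t..b} \<Longrightarrow> \<bar>f t - f s\<bar> \<le> C * (s - t) powr \<tau>"
  shows "set_integrable lborel {t..b} (\<lambda>s. (f t - f s) / (s - t) powr (\<beta> + 1))"
    and "\<bar>LBINT s:{t..b}. (f t - f s) / (s - t) powr (\<beta> + 1)\<bar> \<le> C * ((b - t) powr (\<tau> - \<beta>) / (\<tau> - \<beta>))"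
proof -
  have k: "set_integrable lborel {t..b} (\<lambda>s. C * (s - t) powr (\<tau> - \<beta> - 1))"
    using assms by (intro set_integrable_mult_right set_integral_powr(1)) auto
  have b: "\<bar>(f t - f s) / (s - t) powr (\<beta> + 1)\<bar> \<le> C * (s - t) powr (\<tau> - \<beta> - 1)" if "s \<in> {t..b}" for s
    using that assms(4)[OF that] by (intro singular_quotient_le) auto
  have m: "(\<lambda>s. (f t - f s) / (s - t) powr (\<beta> + 1)) \<in> borel_measurable borel"
    using assms(1) by measurable
  show "set_integrable lborel {t..b} (\<lambda>s. (f t - f s) / (s - t) powr (\<beta> + 1))"
    by (rule set_integrable_dominated(1)[OF k m _ b]) auto
  have "\<bar>LBINT s:{t..b}. (f t - f s) / (s - t) powr (\<beta> + 1)\<bar> \<le> (LBINT s:{t..b}. C * (s - t) powr (\<tau> - \<beta> - 1))"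
    by (rule set_integrable_dominated(2)[OF k m _ b]) auto
  then show "\<bar>LBINT s:{t..b}. (f t - f s) / (s - t) powr (\<beta> + 1)\<bar> \<le> C * ((b - t) powr (\<tau> - \<beta>) / (\<tau> - \<beta>))"
    using set_integral_powr(2)[of "\<tau> - \<beta> - 1" t b] assms by simp
qed

lemma left_kernel_integrable:
  fixes f :: "real \<Rightarrow> real"
  assumes "f \<in> borel_measurable borel" "\<alpha> < \<mu>" "a \<le> t"
    and "\<And>r. r \<in> {a..t} \<Longrightarrow> \<bar>f t - f r\<bar> \<le> C * (t - r) powr \<mu>"
  shows "set_integrable lborel {a..t} (\<lambda>r. (f t - f r) / (t - r) powr (\<alpha> + 1))"
    and "\<bar>LBINT r:{a..t}. (f t - f r) / (t - r) powr (\<alpha> + 1)\<bar> \<le> C * ((t - a) powr (\<mu> - \<alpha>) / (\<mu> - \<alpha>))"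
proof -
  have k: "set_integrable lborel {a..t} (\<lambda>r. C * (t - r) powr (\<mu> - \<alpha> - 1))"
    using assms by (intro set_integrable_mult_right set_integral_powr(3)) auto
  have b: "\<bar>(f t - f r) / (t - r) powr (\<alpha> + 1)\<bar> \<le> C * (t - r) powr (\<mu> - \<alpha> - 1)" if "r \<in> {a..t}" for r
    using that assms(4)[OF that] by (intro singular_quotient_le) auto
  have m: "(\<lambda>r. (f t - f r) / (t - r) powr (\<alpha> + 1)) \<in> borel_measurable borel"
    using assms(1) by measurable
  show "set_integrable lborel {a..t} (\<lambda>r. (f t - f r) / (t - r) powr (\<alpha> + 1))"
    by (rule set_integrable_dominated(1)[OF k m _ b]) auto
  have "\<bar>LBINT r:{a..t}. (f t - f r) / (t - r) powr (\<alpha> + 1)\<bar> \<le> (LBINT r:{a..t}. C * (t - r) powr (\<mu> - \<alpha> - 1))"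
    by (rule set_integrable_dominated(2)[OF k m _ b]) auto
  then show "\<bar>LBINT r:{a..t}. (f t - f r) / (t - r) powr (\<alpha> + 1)\<bar> \<le> C * ((t - a) powr (\<mu> - \<alpha>) / (\<mu> - \<alpha>))"
    using set_integral_powr(4)[of "\<mu> - \<alpha> - 1" a t] assms by simp
qed

text \<open>The 1 comes from the boundary term and \<open>\<beta> / (\<tau> - \<beta>)\<close> from
  integrating the majorant of the kernel; both come with the same power of
  \<open>b - t\<close>.\<close>

lemma right_deriv_bound:
  fixes f :: "real \<Rightarrow> real"
  assumes "f \<in> borel_measurable borel" "0 \<le> \<beta>" "\<beta> < \<tau>" "t \<le> b"
    and "\<And>s. s \<in> {t..b} \<Longrightarrow> \<bar>f t - f s\<bar> \<le> C * (s - t) powr \<tau>"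
  shows "\<bar>right_deriv \<beta> b f t\<bar> \<le> C * (1 + \<beta> / (\<tau> - \<beta>)) * (b - t) powr (\<tau> - \<beta>)"
proof -
  have 1: "\<bar>(f t - f b) / (b - t) powr \<beta>\<bar> \<le> C * (b - t) powr (\<tau> - \<beta>)"
    using singular_quotient_le[of "b - t" "f t - f b" C \<tau> "\<beta> - 1"] assms(4) assms(5)[of b] by auto
  have 2: "\<bar>\<beta> * (LBINT s:{t..b}. (f t - f s) / (s - t) powr (\<beta> + 1))\<bar>
      \<le> \<beta> * (C * ((b - t) powr (\<tau> - \<beta>) / (\<tau> - \<beta>)))"
    using mult_left_mono[OF right_kernel_integrable(2)[OF assms(1,3-5)] assms(2)] assms(2)
    by (simp add: abs_mult)
  show ?thesis
    unfolding right_deriv_def using order_trans[OF abs_triangle_ineq add_mono[OF 1 2]]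
    by (simp add: algebra_simps)
qed

lemma left_deriv_bound:
  fixes f :: "real \<Rightarrow> real"
  assumes "f \<in> borel_measurable borel" "0 \<le> \<alpha>" "\<alpha> < \<mu>" "a \<le> t"
    and "\<And>r. r \<in> {a..t} \<Longrightarrow> \<bar>f t - f r\<bar> \<le> C * (t - r) powr \<mu>" "\<bar>f t\<bar> \<le> D"
  shows "\<bar>left_deriv \<alpha> a f t\<bar> \<le> D * (t - a) powr (- \<alpha>) + C * \<alpha> / (\<mu> - \<alpha>) * (t - a) powr (\<mu> - \<alpha>)"
proof -
  have 1: "\<bar>f t / (t - a) powr \<alpha>\<bar> \<le> D * (t - a) powr (- \<alpha>)"
    using assms(6) by (simp add: powr_minus divide_inverse abs_mult mult_right_mono)
  have 2: "\<bar>\<alpha> * (LBINT r:{a..t}. (f t - f r) / (t - r) powr (\<alpha> + 1))\<bar>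
      \<le> \<alpha> * (C * ((t - a) powr (\<mu> - \<alpha>) / (\<mu> - \<alpha>)))"
    using mult_left_mono[OF left_kernel_integrable(2)[OF assms(1,3-5)] assms(2)] assms(2)
    by (simp add: abs_mult)
  show ?thesis
    unfolding left_deriv_def using order_trans[OF abs_triangle_ineq add_mono[OF 1 2]]
    by (simp add: algebra_simps)
qed

text \<open>The common constant C supplies the dominating function, so pointwise convergence of the
  functions is enough.\<close>

lemma right_deriv_tendsto:
  fixes f :: "nat \<Rightarrow> real \<Rightarrow> real"
  assumes "\<And>n. f n \<in> borel_measurable borel" "f' \<in> borel_measurable borel" "\<beta> < \<tau>" "t \<le> b"
    and "\<And>n s. s \<in> {t..b} \<Longrightarrow> \<bar>f n t - f n s\<bar> \<le> C * (s - t) powr \<tau>"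
    and "\<And>s. s \<in> {t..b} \<Longrightarrow> (\<lambda>n. f n s) \<longlonglongrightarrow> f' s"
  shows "(\<lambda>n. right_deriv \<beta> b (f n) t) \<longlonglongrightarrow> right_deriv \<beta> b f' t"
proof -
  have "(\<lambda>n. LBINT s:{t..b}. (f n t - f n s) / (s - t) powr (\<beta> + 1))
     \<longlonglongrightarrow> (LBINT s:{t..b}. (f' t - f' s) / (s - t) powr (\<beta> + 1))"
  proof (rule set_integral_dominated_convergence[where k="\<lambda>s. C * (s - t) powr (\<tau> - \<beta> - 1)"])
    show "set_integrable lborel {t..b} (\<lambda>s. C * (s - t) powr (\<tau> - \<beta> - 1))"
      using assms by (intro set_integrable_mult_right set_integral_powr(1)) auto
    show "\<bar>(f n t - f n s) / (s - t) powr (\<beta> + 1)\<bar> \<le> C * (s - t) powr (\<tau> - \<beta> - 1)" if "s \<in> {t..b}" for n s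
      using that assms(5)[OF that] by (intro singular_quotient_le) auto
    show "(\<lambda>n. (f n t - f n s) / (s - t) powr (\<beta> + 1)) \<longlonglongrightarrow> (f' t - f' s) / (s - t) powr (\<beta> + 1)"
      if "s \<in> {t..b}" for s
    proof (cases "s = t")
      case False
      then show ?thesis
        using assms(6)[OF that] assms(6)[of t] that by (intro tendsto_intros) auto
    qed simp
    show "(\<lambda>s. (f n t - f n s) / (s - t) powr (\<beta> + 1)) \<in> borel_measurable borel" for n
      using assms(1)[of n] by measurable
    show "(\<lambda>s. (f' t - f' s) / (s - t) powr (\<beta> + 1)) \<in> borel_measurable borel"
      using assms(2) by measurable
  qed auto
  moreover have "(\<lambda>n. (f n t - f n b) / (b - t) powr \<beta>) \<longlonglongrightarrow> (f' t - f' b) / (b - t) powr \<beta>"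
    using assms(4) by (cases "b = t") (auto intro!: tendsto_intros assms(6))
  ultimately show ?thesis
    unfolding right_deriv_def by (intro tendsto_add tendsto_mult tendsto_const)
qed

lemma left_deriv_tendsto:
  fixes f :: "nat \<Rightarrow> real \<Rightarrow> real"
  assumes "\<And>n. f n \<in> borel_measurable borel" "f' \<in> borel_measurable borel" "\<alpha> < \<mu>" "a \<le> t"
    and "\<And>n r. r \<in> {a..t} \<Longrightarrow> \<bar>f n t - f n r\<bar> \<le> C * (t - r) powr \<mu>"
    and "\<And>r. r \<in> {a..t} \<Longrightarrow> (\<lambda>n. f n r) \<longlonglongrightarrow> f' r"
  shows "(\<lambda>n. left_deriv \<alpha> a (f n) t) \<longlonglongrightarrow> left_deriv \<alpha> a f' t"
proof -
  have "(\<lambda>n. LBINT r:{a..t}. (f n t - f n r) / (t - r) powr (\<alpha> + 1))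
     \<longlonglongrightarrow> (LBINT r:{a..t}. (f' t - f' r) / (t - r) powr (\<alpha> + 1))"
  proof (rule set_integral_dominated_convergence[where k="\<lambda>r. C * (t - r) powr (\<mu> - \<alpha> - 1)"])
    show "set_integrable lborel {a..t} (\<lambda>r. C * (t - r) powr (\<mu> - \<alpha> - 1))"
      using assms by (intro set_integrable_mult_right set_integral_powr(3)) auto
    show "\<bar>(f n t - f n r) / (t - r) powr (\<alpha> + 1)\<bar> \<le> C * (t - r) powr (\<mu> - \<alpha> - 1)" if "r \<in> {a..t}" for n r
      using that assms(5)[OF that] by (intro singular_quotient_le) auto
    show "(\<lambda>n. (f n t - f n r) / (t - r) powr (\<alpha> + 1)) \<longlonglongrightarrow> (f' t - f' r) / (t - r) powr (\<alpha> + 1)"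
      if "r \<in> {a..t}" for r
    proof (cases "r = t")
      case False
      then show ?thesis
        using assms(6)[OF that] assms(6)[of t] that by (intro tendsto_intros) auto
    qed simp
    show "(\<lambda>r. (f n t - f n r) / (t - r) powr (\<alpha> + 1)) \<in> borel_measurable borel" for n
      using assms(1)[of n] by measurable
    show "(\<lambda>r. (f' t - f' r) / (t - r) powr (\<alpha> + 1)) \<in> borel_measurable borel"
      using assms(2) by measurable
  qed auto
  moreover have "(\<lambda>n. f n t / (t - a) powr \<alpha>) \<longlonglongrightarrow> f' t / (t - a) powr \<alpha>"
    using assms(4) by (cases "t = a") (auto intro!: tendsto_intros assms(6))
  ultimately show ?thesis
    unfolding left_deriv_def by (intro tendsto_add tendsto_mult tendsto_const)
qed

section \<open>The iterated fractional derivative of a function of two variables\<close>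

definition inner_deriv :: "real \<Rightarrow> real \<Rightarrow> (real \<Rightarrow> real \<Rightarrow> real) \<Rightarrow> real \<Rightarrow> real \<Rightarrow> real" where
  "inner_deriv \<alpha> b G t r = right_deriv (1 - \<alpha>) b (\<lambda>s. G s r) t"

definition weyl_int :: "real \<Rightarrow> real \<Rightarrow> real \<Rightarrow> (real \<Rightarrow> real \<Rightarrow> real) \<Rightarrow> real" where
  "weyl_int \<alpha> a b G = (LBINT t:{a..b}. left_deriv \<alpha> a (inner_deriv \<alpha> b G t) t)"

text \<open>The constants A and B are arguments rather than existentially bound, because a whole
  approximating sequence must share them. In the application \<mu> is
  \<open>lam * \<gamma>\<close>.\<close>

definition mixed_holder ::
  "real \<Rightarrow> real \<Rightarrow> real \<Rightarrow> real \<Rightarrow> real \<Rightarrow> real \<Rightarrow> (real \<Rightarrow> real \<Rightarrow> real) \<Rightarrow> bool" where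
  "mixed_holder \<tau> \<mu> a b A B G \<longleftrightarrow>
    (\<lambda>(s, r). G s r) \<in> borel_measurable (borel \<Otimes>\<^sub>M borel) \<and> 0 \<le> A \<and> 0 \<le> B \<and>
    (\<forall>s\<in>{a..b}. \<forall>t\<in>{a..b}. \<forall>r\<in>{a..b}. \<bar>G s r - G t r\<bar> \<le> A * \<bar>s - t\<bar> powr \<tau>) \<and>
    (\<forall>s\<in>{a..b}. \<forall>t\<in>{a..b}. \<forall>r\<in>{a..b}. \<forall>r'\<in>{a..b}.
      \<bar>G s r - G t r - G s r' + G t r'\<bar> \<le> B * \<bar>s - t\<bar> powr \<tau> * \<bar>r - r'\<bar> powr \<mu>)"

lemma mixed_holder_measurable:
  "mixed_holder \<tau> \<mu> a b A B G \<Longrightarrow> (\<lambda>(s, r). G s r) \<in> borel_measurable (borel \<Otimes>\<^sub>M borel)"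
  by (simp add: mixed_holder_def)

lemma measurable_section:
  assumes "(\<lambda>(s, r). G s r) \<in> borel_measurable (borel \<Otimes>\<^sub>M borel)"
  shows "(\<lambda>s. G s r) \<in> borel_measurable borel" and "(\<lambda>r. G s r) \<in> borel_measurable borel"
  using measurable_compose[of "\<lambda>s. (s, r)" borel "borel \<Otimes>\<^sub>M borel" "\<lambda>(s, r). G s r" borel]
    measurable_compose[of "\<lambda>r. (s, r)" borel "borel \<Otimes>\<^sub>M borel" "\<lambda>(s, r). G s r" borel] assms by auto

lemma mixed_holder_le:
  assumes "mixed_holder \<tau> \<mu> a b A B G" "t \<in> {a..b}" "s \<in> {t..b}"
  shows "r \<in> {a..b} \<Longrightarrow> \<bar>G t r - G s r\<bar> \<le> A * (s - t) powr \<tau>"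
    and "r \<in> {a..b} \<Longrightarrow> r' \<in> {a..b} \<Longrightarrow>
      \<bar>G t r - G s r - G t r' + G s r'\<bar> \<le> B * (s - t) powr \<tau> * \<bar>r - r'\<bar> powr \<mu>"
proof -
  have s: "s \<in> {a..b}" "\<bar>t - s\<bar> = s - t" using assms(2,3) by auto
  show "\<bar>G t r - G s r\<bar> \<le> A * (s - t) powr \<tau>" if "r \<in> {a..b}"
    using assms(1,2) s that unfolding mixed_holder_def by metis
  show "\<bar>G t r - G s r - G t r' + G s r'\<bar> \<le> B * (s - t) powr \<tau> * \<bar>r - r'\<bar> powr \<mu>"
    if "r \<in> {a..b}" "r' \<in> {a..b}"
    using assms(1,2) s that unfolding mixed_holder_def by metis
qed

section \<open>Joint measurability in the base point and a parameter\<close>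

lemma measurable_right_deriv:
  assumes [measurable]: "(\<lambda>(x, s). F x s) \<in> borel_measurable (N \<Otimes>\<^sub>M borel)" "T \<in> borel_measurable N"
  shows "(\<lambda>x. right_deriv \<beta> b (F x) (T x)) \<in> borel_measurable N"
proof -
  have F: "(\<lambda>y. F (u y) (v y)) \<in> borel_measurable M"
    if [measurable]: "u \<in> measurable M N" "v \<in> borel_measurable M" for u v and M :: "'z measure"
    using measurable_compose[of "\<lambda>y. (u y, v y)" M "N \<Otimes>\<^sub>M borel" "\<lambda>(x, s). F x s" borel] by simp
  have *: "(\<lambda>x. LBINT s:{T x..b}. (F x (T x) - F x s) / (s - T x) powr (\<beta> + 1)) \<in> borel_measurable N"
    unfolding set_lebesgue_integral_def
  proof (rule lborel.borel_measurable_lebesgue_integral)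
    \<comment> \<open>The domain of integration moves with the parameter; writing its indicator as a
      condition on the pair exhibits joint measurability.\<close>
    have "(\<lambda>q. (if T (fst q) \<le> snd q \<and> snd q \<le> b then 1 else 0) *\<^sub>R
       ((F (fst q) (T (fst q)) - F (fst q) (snd q)) / (snd q - T (fst q)) powr (\<beta> + 1)))
      \<in> borel_measurable (N \<Otimes>\<^sub>M lborel)"
      by (intro borel_measurable_scaleR borel_measurable_divide borel_measurable_diff F) measurable
    then show "(\<lambda>(x, s). indicat_real {T x..b} s *\<^sub>R ((F x (T x) - F x s) / (s - T x) powr (\<beta> + 1)))
      \<in> borel_measurable (N \<Otimes>\<^sub>M lborel)"
      by (rule measurable_cong[THEN iffD1, rotated]) (auto simp: indicator_def split: if_splits)
  qed
  show ?thesis unfolding right_deriv_def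
    by (intro borel_measurable_add borel_measurable_times borel_measurable_divide borel_measurable_diff F * ) measurable
qed

lemma measurable_left_deriv:
  assumes [measurable]: "(\<lambda>(x, r). F x r) \<in> borel_measurable (N \<Otimes>\<^sub>M borel)" "T \<in> borel_measurable N"
  shows "(\<lambda>x. left_deriv \<alpha> a (F x) (T x)) \<in> borel_measurable N"
proof -
  have F: "(\<lambda>y. F (u y) (v y)) \<in> borel_measurable M"
    if [measurable]: "u \<in> measurable M N" "v \<in> borel_measurable M" for u v and M :: "'z measure"
    using measurable_compose[of "\<lambda>y. (u y, v y)" M "N \<Otimes>\<^sub>M borel" "\<lambda>(x, s). F x s" borel] by simp
  have *: "(\<lambda>x. LBINT r:{a..T x}. (F x (T x) - F x r) / (T x - r) powr (\<alpha> + 1)) \<in> borel_measurable N"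
    unfolding set_lebesgue_integral_def
  proof (rule lborel.borel_measurable_lebesgue_integral)
    have "(\<lambda>q. (if a \<le> snd q \<and> snd q \<le> T (fst q) then 1 else 0) *\<^sub>R
       ((F (fst q) (T (fst q)) - F (fst q) (snd q)) / (T (fst q) - snd q) powr (\<alpha> + 1)))
      \<in> borel_measurable (N \<Otimes>\<^sub>M lborel)"
      by (intro borel_measurable_scaleR borel_measurable_divide borel_measurable_diff F) measurable
    then show "(\<lambda>(x, r). indicat_real {a..T x} r *\<^sub>R ((F x (T x) - F x r) / (T x - r) powr (\<alpha> + 1)))
      \<in> borel_measurable (N \<Otimes>\<^sub>M lborel)"
      by (rule measurable_cong[THEN iffD1, rotated]) (auto simp: indicator_def split: if_splits)
  qed
  show ?thesis unfolding left_deriv_def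
    by (intro borel_measurable_add borel_measurable_times borel_measurable_divide borel_measurable_diff F * ) measurable
qed

lemma measurable_inner_deriv:
  assumes "(\<lambda>(s, r). G s r) \<in> borel_measurable (borel \<Otimes>\<^sub>M borel)"
  shows "(\<lambda>(t, r). inner_deriv \<alpha> b G t r) \<in> borel_measurable (borel \<Otimes>\<^sub>M borel)"
proof -
  have "(\<lambda>(p :: real \<times> real, s). G s (snd p)) \<in> borel_measurable ((borel \<Otimes>\<^sub>M borel) \<Otimes>\<^sub>M borel)"
    using measurable_compose[of "\<lambda>q :: (real \<times> real) \<times> real. (snd q, snd (fst q))" "(borel \<Otimes>\<^sub>M borel) \<Otimes>\<^sub>M borel" "borel \<Otimes>\<^sub>M borel", OF _ assms]
    by (simp add: case_prod_beta')
  then have "(\<lambda>p. right_deriv (1 - \<alpha>) b (\<lambda>s. G s (snd p)) (fst p)) \<in> borel_measurable (borel \<Otimes>\<^sub>M borel)"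
    by (rule measurable_right_deriv) measurable
  then show ?thesis by (simp add: inner_deriv_def case_prod_beta')
qed

section \<open>Linearity in the differentiated function\<close>

lemma right_deriv_diff:
  assumes "set_integrable lborel {t..b} (\<lambda>s. (f t - f s) / (s - t) powr (\<beta> + 1))"
    and "set_integrable lborel {t..b} (\<lambda>s. (g t - g s) / (s - t) powr (\<beta> + 1))"
  shows "right_deriv \<beta> b (\<lambda>s. f s - g s) t = right_deriv \<beta> b f t - right_deriv \<beta> b g t"
proof -
  have "(LBINT s:{t..b}. (f t - g t - (f s - g s)) / (s - t) powr (\<beta> + 1)) =
    (LBINT s:{t..b}. (f t - f s) / (s - t) powr (\<beta> + 1) - (g t - g s) / (s - t) powr (\<beta> + 1))"
    by (rule arg_cong[where f="set_lebesgue_integral _ _"]) (auto simp: diff_divide_distrib)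
  also have "\<dots> = (LBINT s:{t..b}. (f t - f s) / (s - t) powr (\<beta> + 1)) -
      (LBINT s:{t..b}. (g t - g s) / (s - t) powr (\<beta> + 1))"
    using assms by (rule set_integral_diff(2))
  finally have *: "(LBINT s:{t..b}. (f t - g t - (f s - g s)) / (s - t) powr (\<beta> + 1)) = \<dots>" .
  have "(x - y - (z - w)) / p + \<beta> * (l - m) = ((x - z) / p + \<beta> * l) - ((y - w) / p + \<beta> * m)"
    for x y z w p l m :: real
    by (simp add: diff_divide_distrib add_divide_distrib algebra_simps)
  then show ?thesis unfolding right_deriv_def * .
qed

lemma set_integral_linear_combination:
  fixes f :: "'i \<Rightarrow> real \<Rightarrow> real"
  assumes "\<And>i. i \<in> I \<Longrightarrow> set_integrable lborel S (f i)"
  shows "(LBINT x:S. (\<Sum>i\<in>I. v i * f i x)) = (\<Sum>i\<in>I. v i * (LBINT x:S. f i x))"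
proof -
  have "(LBINT x:S. (\<Sum>i\<in>I. v i * f i x)) = (LINT x|lborel. (\<Sum>i\<in>I. v i * (indicator S x *\<^sub>R f i x)))"
    unfolding set_lebesgue_integral_def
    by (intro Bochner_Integration.integral_cong) (auto simp: sum_distrib_left mult_ac)
  also have "\<dots> = (\<Sum>i\<in>I. v i * (LBINT x:S. f i x))"
    using assms by (simp add: Bochner_Integration.integral_sum set_integrable_def set_lebesgue_integral_def)
  finally show ?thesis .
qed

lemma right_deriv_sum:
  assumes "\<And>i. i \<in> I \<Longrightarrow> set_integrable lborel {t..b} (\<lambda>s. (f i t - f i s) / (s - t) powr (\<beta> + 1))"
  shows "right_deriv \<beta> b (\<lambda>s. \<Sum>i\<in>I. v i * f i s) t = (\<Sum>i\<in>I. v i * right_deriv \<beta> b (f i) t)"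
proof -
  have "(LBINT s:{t..b}. ((\<Sum>i\<in>I. v i * f i t) - (\<Sum>i\<in>I. v i * f i s)) / (s - t) powr (\<beta> + 1)) =
    (LBINT s:{t..b}. (\<Sum>i\<in>I. v i * ((f i t - f i s) / (s - t) powr (\<beta> + 1))))"
    by (rule arg_cong[where f="set_lebesgue_integral _ _"])
      (auto simp: sum_subtractf[symmetric] sum_divide_distrib right_diff_distrib)
  also have "\<dots> = (\<Sum>i\<in>I. v i * (LBINT s:{t..b}. (f i t - f i s) / (s - t) powr (\<beta> + 1)))"
    by (rule set_integral_linear_combination[OF assms])
  finally show ?thesis
    by (simp add: right_deriv_def sum.distrib sum_distrib_left distrib_left sum_divide_distrib
        sum_subtractf[symmetric] right_diff_distrib mult_ac)
qed

lemma left_deriv_sum: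
  assumes "\<And>i. i \<in> I \<Longrightarrow> set_integrable lborel {a..t} (\<lambda>r. (f i t - f i r) / (t - r) powr (\<alpha> + 1))"
  shows "left_deriv \<alpha> a (\<lambda>r. \<Sum>i\<in>I. v i * f i r) t = (\<Sum>i\<in>I. v i * left_deriv \<alpha> a (f i) t)"
proof -
  have "(LBINT r:{a..t}. ((\<Sum>i\<in>I. v i * f i t) - (\<Sum>i\<in>I. v i * f i r)) / (t - r) powr (\<alpha> + 1)) =
    (LBINT r:{a..t}. (\<Sum>i\<in>I. v i * ((f i t - f i r) / (t - r) powr (\<alpha> + 1))))"
    by (rule arg_cong[where f="set_lebesgue_integral _ _"])
      (auto simp: sum_subtractf[symmetric] sum_divide_distrib right_diff_distrib)
  also have "\<dots> = (\<Sum>i\<in>I. v i * (LBINT r:{a..t}. (f i t - f i r) / (t - r) powr (\<alpha> + 1)))"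
    by (rule set_integral_linear_combination[OF assms])
  finally show ?thesis
    by (simp add: left_deriv_def sum.distrib sum_distrib_left distrib_left sum_divide_distrib mult_ac)
qed

text \<open>Both ends of the range of \<alpha> are regularity demands: the right derivative has
  order 1 - \<alpha>, which must stay below \<tau>, and the left one has order \<alpha>, which must
  stay below \<mu>.\<close>

locale weyl_exponents =
  fixes a b \<alpha> \<tau> \<mu> :: real
  assumes ab: "a < b" and alpha: "0 < \<alpha>" "\<alpha> < 1" "1 - \<tau> < \<alpha>" "\<alpha> < \<mu>"
begin

text \<open>The factor of \<open>right_deriv_bound\<close> for the order 1 - \<alpha>.\<close>

definition c1 :: real where "c1 = 1 + (1 - \<alpha>) / (\<tau> - (1 - \<alpha>))"

lemma c1_pos: "c1 > 0"
  using alpha by (simp add: c1_def add_pos_nonneg)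

lemma inner_kernel_integrable:
  assumes G: "mixed_holder \<tau> \<mu> a b A B G" and t: "t \<in> {a..b}" "r \<in> {a..b}"
  shows "set_integrable lborel {t..b} (\<lambda>s. (G t r - G s r) / (s - t) powr (1 - \<alpha> + 1))"
proof (rule right_kernel_integrable(1)[where C = A and \<tau> = \<tau>])
  show "(\<lambda>s. G s r) \<in> borel_measurable borel"
    using measurable_section(1)[OF mixed_holder_measurable[OF G]] .
  show "\<bar>G t r - G s r\<bar> \<le> A * (s - t) powr \<tau>" if "s \<in> {t..b}" for s
    using mixed_holder_le(1)[OF G t(1) that t(2)] .
qed (use alpha t in auto)

lemma inner_deriv_bound:
  assumes G: "mixed_holder \<tau> \<mu> a b A B G" and t: "t \<in> {a..b}" "r \<in> {a..b}"
  shows "\<bar>inner_deriv \<alpha> b G t r\<bar> \<le> A * c1 * (b - a) powr (\<tau> - (1 - \<alpha>))"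
proof -
  have "\<bar>inner_deriv \<alpha> b G t r\<bar> \<le> A * (1 + (1 - \<alpha>) / (\<tau> - (1 - \<alpha>))) * (b - t) powr (\<tau> - (1 - \<alpha>))"
    unfolding inner_deriv_def
  proof (rule right_deriv_bound)
    show "(\<lambda>s. G s r) \<in> borel_measurable borel"
      using measurable_section(1)[OF mixed_holder_measurable[OF G]] .
    show "\<bar>G t r - G s r\<bar> \<le> A * (s - t) powr \<tau>" if "s \<in> {t..b}" for s
      using mixed_holder_le(1)[OF G t(1) that t(2)] .
  qed (use alpha t in auto)
  also have "\<dots> \<le> A * c1 * (b - a) powr (\<tau> - (1 - \<alpha>))"
    unfolding c1_def[symmetric] using alpha t G c1_pos
    by (intro mult_left_mono powr_mono2) (auto simp: mixed_holder_def)
  finally show ?thesis .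
qed

text \<open>This is where mixed increments are indispensable: by linearity the difference is the
  right derivative of \<open>\<lambda>s. G s r - G s r'\<close>, and this function is \<tau>-Hoelder
  with the small constant \<open>B * \<bar>r - r'\<bar> powr \<mu>\<close>.\<close>

lemma inner_deriv_diff:
  assumes G: "mixed_holder \<tau> \<mu> a b A B G" and t: "t \<in> {a..b}" "r \<in> {a..b}" "r' \<in> {a..b}"
  shows "\<bar>inner_deriv \<alpha> b G t r - inner_deriv \<alpha> b G t r'\<bar>
    \<le> B * c1 * (b - a) powr (\<tau> - (1 - \<alpha>)) * \<bar>r - r'\<bar> powr \<mu>"
proof -
  have "inner_deriv \<alpha> b G t r - inner_deriv \<alpha> b G t r' = right_deriv (1 - \<alpha>) b (\<lambda>s. G s r - G s r') t"
    unfolding inner_deriv_def using inner_kernel_integrable[OF G] t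
    by (intro right_deriv_diff[symmetric]) auto
  also have "\<bar>\<dots>\<bar> \<le> B * \<bar>r - r'\<bar> powr \<mu> * (1 + (1 - \<alpha>) / (\<tau> - (1 - \<alpha>))) * (b - t) powr (\<tau> - (1 - \<alpha>))"
  proof (rule right_deriv_bound)
    show "(\<lambda>s. G s r - G s r') \<in> borel_measurable borel"
      using measurable_section(1)[OF mixed_holder_measurable[OF G]] by measurable
    show "\<bar>(G t r - G t r') - (G s r - G s r')\<bar> \<le> B * \<bar>r - r'\<bar> powr \<mu> * (s - t) powr \<tau>" if "s \<in> {t..b}" for s
      using mixed_holder_le(2)[OF G t(1) that t(2,3)] by (simp add: algebra_simps)
  qed (use alpha t in auto)
  also have "\<dots> \<le> B * \<bar>r - r'\<bar> powr \<mu> * c1 * (b - a) powr (\<tau> - (1 - \<alpha>))"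
    unfolding c1_def[symmetric] using alpha t G c1_pos
    by (intro mult_left_mono powr_mono2) (auto simp: mixed_holder_def)
  finally show ?thesis by (simp add: mult_ac)
qed

lemma measurable_inner_section:
  assumes "mixed_holder \<tau> \<mu> a b A B G"
  shows "inner_deriv \<alpha> b G t \<in> borel_measurable borel"
  using measurable_section(2)[OF measurable_inner_deriv[OF mixed_holder_measurable[OF assms]]] .

lemma outer_kernel_integrable:
  assumes G: "mixed_holder \<tau> \<mu> a b A B G" and t: "t \<in> {a..b}"
  shows "set_integrable lborel {a..t}
    (\<lambda>r. (inner_deriv \<alpha> b G t t - inner_deriv \<alpha> b G t r) / (t - r) powr (\<alpha> + 1))"
proof (rule left_kernel_integrable(1)[OF measurable_inner_section[OF G]])
  show "\<bar>inner_deriv \<alpha> b G t t - inner_deriv \<alpha> b G t r\<bar>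
      \<le> B * c1 * (b - a) powr (\<tau> - (1 - \<alpha>)) * (t - r) powr \<mu>" if "r \<in> {a..t}" for r
    using inner_deriv_diff[OF G, of t t r] t that by auto
qed (use t alpha in auto)

text \<open>The only singularity left is \<open>(t - a) powr (- \<alpha>)\<close> from the boundary
  term, integrable since \<alpha> < 1. The kernel integral is bounded because \<mu> > \<alpha>. The
  bound depends on G through A and B alone, so it also serves as a majorant for sequences.\<close>

lemma outer_deriv_bound:
  assumes G: "mixed_holder \<tau> \<mu> a b A B G" and t: "t \<in> {a..b}"
  shows "\<bar>left_deriv \<alpha> a (inner_deriv \<alpha> b G t) t\<bar> \<le>
    A * c1 * (b - a) powr (\<tau> - (1 - \<alpha>)) * (t - a) powr (- \<alpha>) +
    B * c1 * (b - a) powr (\<tau> - (1 - \<alpha>)) * \<alpha> / (\<mu> - \<alpha>) * (b - a) powr (\<mu> - \<alpha>)"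
proof -
  have "\<bar>left_deriv \<alpha> a (inner_deriv \<alpha> b G t) t\<bar> \<le>
    A * c1 * (b - a) powr (\<tau> - (1 - \<alpha>)) * (t - a) powr (- \<alpha>) +
    B * c1 * (b - a) powr (\<tau> - (1 - \<alpha>)) * \<alpha> / (\<mu> - \<alpha>) * (t - a) powr (\<mu> - \<alpha>)"
  proof (rule left_deriv_bound[OF measurable_inner_section[OF G]])
    show "\<bar>inner_deriv \<alpha> b G t t - inner_deriv \<alpha> b G t r\<bar>
        \<le> B * c1 * (b - a) powr (\<tau> - (1 - \<alpha>)) * (t - r) powr \<mu>" if "r \<in> {a..t}" for r
      using inner_deriv_diff[OF G, of t t r] t that by auto
    show "\<bar>inner_deriv \<alpha> b G t t\<bar> \<le> A * c1 * (b - a) powr (\<tau> - (1 - \<alpha>))"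
      using inner_deriv_bound[OF G] t by auto
  qed (use t alpha in auto)
  also have "\<dots> \<le> A * c1 * (b - a) powr (\<tau> - (1 - \<alpha>)) * (t - a) powr (- \<alpha>) +
    B * c1 * (b - a) powr (\<tau> - (1 - \<alpha>)) * \<alpha> / (\<mu> - \<alpha>) * (b - a) powr (\<mu> - \<alpha>)"
    using alpha t G c1_pos
    by (intro add_left_mono mult_left_mono powr_mono2) (auto simp: mixed_holder_def)
  finally show ?thesis .
qed

lemma outer_bound_integrable:
  "set_integrable lborel {a..b} (\<lambda>t. C * (t - a) powr (- \<alpha>) + D)"
  "(LBINT t:{a..b}. C * (t - a) powr (- \<alpha>) + D) = C * (b - a) powr (1 - \<alpha>) / (1 - \<alpha>) + D * (b - a)"
proof -
  have 1: "set_integrable lborel {a..b} (\<lambda>t. C * (t - a) powr (- \<alpha>))"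
    using alpha ab by (intro set_integrable_mult_right set_integral_powr) auto
  have 2: "set_integrable lborel {a..b} (\<lambda>t. D)"
    by (rule borel_integrable_atLeastAtMost') simp
  show "set_integrable lborel {a..b} (\<lambda>t. C * (t - a) powr (- \<alpha>) + D)"
    by (rule set_integral_add(1)[OF 1 2])
  show "(LBINT t:{a..b}. C * (t - a) powr (- \<alpha>) + D) = C * (b - a) powr (1 - \<alpha>) / (1 - \<alpha>) + D * (b - a)"
    using set_integral_powr(2)[of "-\<alpha>" a b] alpha ab
    by (subst set_integral_add(2)[OF 1 2]) (simp add: set_lebesgue_integral_def)
qed

lemma measurable_outer:
  assumes "mixed_holder \<tau> \<mu> a b A B G"
  shows "(\<lambda>t. left_deriv \<alpha> a (inner_deriv \<alpha> b G t) t) \<in> borel_measurable borel"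
  using assms by (intro measurable_left_deriv measurable_inner_deriv) (auto intro: mixed_holder_measurable)

lemma outer_deriv_integrable:
  assumes G: "mixed_holder \<tau> \<mu> a b A B G"
  shows "set_integrable lborel {a..b} (\<lambda>t. left_deriv \<alpha> a (inner_deriv \<alpha> b G t) t)"
  by (rule set_integrable_dominated(1)[OF outer_bound_integrable(1) measurable_outer[OF G] _ outer_deriv_bound[OF G]])
    auto

lemma weyl_int_bound:
  assumes G: "mixed_holder \<tau> \<mu> a b A B G"
  shows "\<bar>weyl_int \<alpha> a b G\<bar> \<le>
    c1 / (1 - \<alpha>) * A * (b - a) powr \<tau> + c1 * \<alpha> / (\<mu> - \<alpha>) * B * (b - a) powr (\<tau> + \<mu>)"
proof -
  \<comment> \<open>The inner derivative contributes the exponent \<tau> - (1 - \<alpha>).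
    Integrating the boundary term adds 1 - \<alpha>; the Hoelder term adds \<mu> - \<alpha> and,
    from the length of the interval, 1.\<close>
  have p: "(b - a) powr (\<tau> - (1 - \<alpha>)) * (b - a) powr (1 - \<alpha>) = (b - a) powr \<tau>"
    "(b - a) powr (\<tau> - (1 - \<alpha>)) * ((b - a) powr (\<mu> - \<alpha>) * (b - a)) = (b - a) powr (\<tau> + \<mu>)"
    using ab powr_add[of "b - a" "\<tau> + \<mu> - 1" 1] by (simp_all add: add_diff_eq flip: powr_add mult.assoc)
  have "\<bar>weyl_int \<alpha> a b G\<bar> \<le> (LBINT t:{a..b}.
    A * c1 * (b - a) powr (\<tau> - (1 - \<alpha>)) * (t - a) powr (- \<alpha>) +
    B * c1 * (b - a) powr (\<tau> - (1 - \<alpha>)) * \<alpha> / (\<mu> - \<alpha>) * (b - a) powr (\<mu> - \<alpha>))"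
    unfolding weyl_int_def
    by (rule set_integrable_dominated(2)[OF outer_bound_integrable(1) measurable_outer[OF G] _ outer_deriv_bound[OF G]])
      auto
  also have "\<dots> = c1 / (1 - \<alpha>) * A * ((b - a) powr (\<tau> - (1 - \<alpha>)) * (b - a) powr (1 - \<alpha>)) +
      c1 * \<alpha> / (\<mu> - \<alpha>) * B * ((b - a) powr (\<tau> - (1 - \<alpha>)) * ((b - a) powr (\<mu> - \<alpha>) * (b - a)))"
    by (subst outer_bound_integrable(2)) (simp add: mult_ac)
  finally show ?thesis unfolding p .
qed

text \<open>Dominated convergence is applied three times, in s, in r and in t, each time with a
  majorant made of A and B.\<close>

lemma weyl_int_tendsto:
  assumes Gn: "\<And>n. mixed_holder \<tau> \<mu> a b A B (Gn n)" and G: "mixed_holder \<tau> \<mu> a b A B G"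
    and lim: "\<And>s r. s \<in> {a..b} \<Longrightarrow> r \<in> {a..b} \<Longrightarrow> (\<lambda>n. Gn n s r) \<longlonglongrightarrow> G s r"
  shows "(\<lambda>n. weyl_int \<alpha> a b (Gn n)) \<longlonglongrightarrow> weyl_int \<alpha> a b G"
  unfolding weyl_int_def
proof (rule set_integral_dominated_convergence[OF outer_bound_integrable(1) measurable_outer[OF Gn]
      measurable_outer[OF G] _ outer_deriv_bound[OF Gn]])
  fix t assume t: "t \<in> {a..b}"
  have inner: "(\<lambda>n. inner_deriv \<alpha> b (Gn n) t r) \<longlonglongrightarrow> inner_deriv \<alpha> b G t r" if "r \<in> {a..t}" for r
    unfolding inner_deriv_def
  proof (rule right_deriv_tendsto[where C=A and \<tau>=\<tau>])
    show "(\<lambda>s. Gn n s r) \<in> borel_measurable borel" for n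
      using measurable_section(1)[OF mixed_holder_measurable[OF Gn]] .
    show "(\<lambda>s. G s r) \<in> borel_measurable borel"
      using measurable_section(1)[OF mixed_holder_measurable[OF G]] .
    show "\<bar>Gn n t r - Gn n s r\<bar> \<le> A * (s - t) powr \<tau>" if "s \<in> {t..b}" for n s
      using mixed_holder_le(1)[OF Gn t that] \<open>r \<in> {a..t}\<close> t by auto
  qed (use alpha t that lim in auto)
  show "(\<lambda>n. left_deriv \<alpha> a (inner_deriv \<alpha> b (Gn n) t) t) \<longlonglongrightarrow> left_deriv \<alpha> a (inner_deriv \<alpha> b G t) t"
  proof (rule left_deriv_tendsto[OF measurable_inner_section[OF Gn] measurable_inner_section[OF G]])
    show "\<bar>inner_deriv \<alpha> b (Gn n) t t - inner_deriv \<alpha> b (Gn n) t r\<bar>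
        \<le> B * c1 * (b - a) powr (\<tau> - (1 - \<alpha>)) * (t - r) powr \<mu>" if "r \<in> {a..t}" for n r
      using inner_deriv_diff[OF Gn, of t t r] t that by auto
  qed (use alpha t inner in auto)
qed auto

text \<open>Serves to exchange the pairing with a fixed vector and the integral, which turns a bound
  for scalar functions into one for the vector norm.\<close>

lemma weyl_int_sum:
  assumes G: "\<And>i. i \<in> I \<Longrightarrow> mixed_holder \<tau> \<mu> a b A B (G i)"
  shows "weyl_int \<alpha> a b (\<lambda>s r. \<Sum>i\<in>I. v i * G i s r) = (\<Sum>i\<in>I. v i * weyl_int \<alpha> a b (G i))"
proof -
  have inner: "inner_deriv \<alpha> b (\<lambda>s r. \<Sum>i\<in>I. v i * G i s r) t r = (\<Sum>i\<in>I. v i * inner_deriv \<alpha> b (G i) t r)"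
    if "t \<in> {a..b}" "r \<in> {a..b}" for t r
    unfolding inner_deriv_def using inner_kernel_integrable[OF G] that by (intro right_deriv_sum) auto
  have "weyl_int \<alpha> a b (\<lambda>s r. \<Sum>i\<in>I. v i * G i s r) =
      (LBINT t:{a..b}. (\<Sum>i\<in>I. v i * left_deriv \<alpha> a (inner_deriv \<alpha> b (G i) t) t))"
    unfolding weyl_int_def
  proof (rule set_lebesgue_integral_cong)
    show "\<forall>t. t \<in> {a..b} \<longrightarrow> left_deriv \<alpha> a (inner_deriv \<alpha> b (\<lambda>s r. \<Sum>i\<in>I. v i * G i s r) t) t =
      (\<Sum>i\<in>I. v i * left_deriv \<alpha> a (inner_deriv \<alpha> b (G i) t) t)"
    proof (intro allI impI)
      fix t assume t: "t \<in> {a..b}"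
      have "left_deriv \<alpha> a (inner_deriv \<alpha> b (\<lambda>s r. \<Sum>i\<in>I. v i * G i s r) t) t =
         left_deriv \<alpha> a (\<lambda>r. \<Sum>i\<in>I. v i * inner_deriv \<alpha> b (G i) t r) t"
        unfolding left_deriv_def using t
        by (intro arg_cong2[where f="(+)"] arg_cong2[where f="(*)"] arg_cong2[where f="(/)"] refl
          set_lebesgue_integral_cong) (auto simp: inner)
      also have "\<dots> = (\<Sum>i\<in>I. v i * left_deriv \<alpha> a (inner_deriv \<alpha> b (G i) t) t)"
        using outer_kernel_integrable[OF G t] by (rule left_deriv_sum)
      finally show "left_deriv \<alpha> a (inner_deriv \<alpha> b (\<lambda>s r. \<Sum>i\<in>I. v i * G i s r) t) t =
        (\<Sum>i\<in>I. v i * left_deriv \<alpha> a (inner_deriv \<alpha> b (G i) t) t)" .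
    qed
  qed auto
  also have "\<dots> = (\<Sum>i\<in>I. v i * weyl_int \<alpha> a b (G i))"
    unfolding weyl_int_def using outer_deriv_integrable[OF G] by (rule set_integral_linear_combination)
  finally show ?thesis .
qed

end

section \<open>Continuously differentiable functions\<close>

text \<open>Integration by parts: on smooth functions the derivative of order \<beta> is, up to sign
  and normalisation, the fractional integral of order 1 - \<beta> of \<open>f'\<close>.\<close>

lemma right_deriv_C1:
  fixes f f' :: "real \<Rightarrow> real"
  assumes f: "\<And>x. (f has_real_derivative f' x) (at x)" and f': "continuous_on UNIV f'"
    and "0 < \<beta>" "\<beta> < 1" "t \<le> b"
  shows "set_integrable lborel {t..b} (\<lambda>s. f' s * (s - t) powr (- \<beta>))"
    and "right_deriv \<beta> b f t = - (LBINT s:{t..b}. f' s * (s - t) powr (- \<beta>))"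
proof -
  have [measurable]: "f' \<in> borel_measurable borel"
    using f' by (rule borel_measurable_continuous_onI)
  have "continuous_on UNIV f"
    using f by (meson DERIV_continuous_on has_field_derivative_at_within)
  then have [measurable]: "f \<in> borel_measurable borel"
    by (rule borel_measurable_continuous_onI)
  have "compact (f' ` {t..b})"
    using f' by (intro compact_continuous_image) (auto intro: continuous_on_subset)
  then obtain C where C: "\<And>s. s \<in> {t..b} \<Longrightarrow> \<bar>f' s\<bar> \<le> C"
    by (metis bounded_iff compact_imp_bounded imageI real_norm_def)
  have lip: "\<bar>f t - f s\<bar> \<le> C * (s - t)" if "s \<in> {t..b}" for s
  proof (cases "s = t")
    case False
    then have "t < s" using that by auto
    from MVT2[OF this, of f f'] f obtain z where "t < z" "z < s" "f s - f t = (s - t) * f' z" by blast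
    then show ?thesis using C[of z] that
      by (subst abs_minus_commute) (simp add: abs_mult mult.commute mult_right_mono)
  qed simp
  show i1: "set_integrable lborel {t..b} (\<lambda>s. f' s * (s - t) powr (- \<beta>))"
  proof (rule set_integrable_dominated(1)[where k="\<lambda>s. C * (s - t) powr (- \<beta>)"])
    show "set_integrable lborel {t..b} (\<lambda>s. C * (s - t) powr (- \<beta>))"
      using assms by (intro set_integrable_mult_right set_integral_powr(1)) auto
  qed (use C in \<open>auto simp: abs_mult intro: mult_right_mono\<close>)
  have i2: "set_integrable lborel {t..b} (\<lambda>s. (f t - f s) / (s - t) powr (\<beta> + 1))"
    using assms lip by (intro right_kernel_integrable(1)[where \<tau>=1 and C=C]) auto
  \<comment> \<open>The product whose derivative contains both kernels. Its value at b is exactly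
    the boundary term of \<open>right_deriv\<close>.\<close>
  define \<Phi> where "\<Phi> s = (f t - f s) * (s - t) powr (- \<beta>)" for s
  let ?d = "\<lambda>s. - (f' s * (s - t) powr (- \<beta>)) - \<beta> * ((f t - f s) / (s - t) powr (\<beta> + 1))"
  have "(?d has_integral \<Phi> b - \<Phi> t) {t..b}"
  proof (rule fundamental_theorem_of_calculus_interior[OF \<open>t \<le> b\<close>])
    show "(\<Phi> has_vector_derivative ?d s) (at s)" if "s \<in> {t<..<b}" for s
    proof -
      have "(\<Phi> has_real_derivative
          - f' s * (s - t) powr (- \<beta>) + (f t - f s) * (- \<beta> * (s - t) powr (- \<beta> - 1))) (at s)"
        unfolding \<Phi>_def using that by (auto intro!: derivative_eq_intros f)
      moreover have "(s - t) powr (- \<beta> - 1) = 1 / (s - t) powr (\<beta> + 1)"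
        using powr_minus_divide[of "s - t" "\<beta> + 1"] by simp
      ultimately have "(\<Phi> has_real_derivative ?d s) (at s)" by (simp add: mult.commute)
      then show ?thesis by (simp add: has_real_derivative_iff_has_vector_derivative)
    qed
    have "continuous (at s within {t..b}) \<Phi>" if s: "s \<in> {t..b}" for s
    proof (cases "s = t")
      case False
      have "isCont f s" using f by (rule DERIV_isCont)
      then have "isCont \<Phi> s"
        using s False unfolding \<Phi>_def by (intro continuous_intros) auto
      then show ?thesis by (rule continuous_at_imp_continuous_at_within)
    next
      case True
      \<comment> \<open>At the singular end point the Lipschitz bound outweighs the kernel, as 1 -
        \<beta> > 0; and \<open>\<Phi> t = 0\<close> since its first factor vanishes. Thus t
        contributes no boundary term.\<close>
      have "(\<Phi> \<longlongrightarrow> 0) (at t within {t..b})"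
      proof (rule Lim_null_comparison)
        show "\<forall>\<^sub>F s in at t within {t..b}. norm (\<Phi> s) \<le> C * (s - t) powr (1 - \<beta>)"
          unfolding eventually_at_filter
        proof (intro always_eventually allI impI)
          fix s assume "s \<noteq> t" "s \<in> {t..b}"
          then have "\<bar>\<Phi> s\<bar> \<le> C * (s - t) * (s - t) powr (- \<beta>)"
            unfolding \<Phi>_def abs_mult using lip[of s] by (intro mult_mono) auto
          also have "\<dots> = C * (s - t) powr (1 - \<beta>)"
            using \<open>s \<noteq> t\<close> \<open>s \<in> {t..b}\<close> by (simp add: powr_diff powr_minus divide_inverse)
          finally show "norm (\<Phi> s) \<le> C * (s - t) powr (1 - \<beta>)" by simp
        qed
        have "((\<lambda>s. C * (s - t) powr (1 - \<beta>)) \<longlongrightarrow> C * (t - t) powr (1 - \<beta>)) (at t within {t..b})"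
          using assms by (intro tendsto_intros tendsto_powr') (auto simp: eventually_at_filter)
        then show "((\<lambda>s. C * (s - t) powr (1 - \<beta>)) \<longlongrightarrow> 0) (at t within {t..b})" by simp
      qed
      then show ?thesis using True by (simp add: continuous_within \<Phi>_def)
    qed
    then show "continuous_on {t..b} \<Phi>" by (simp add: continuous_on_eq_continuous_within)
  qed
  moreover have i1': "set_integrable lborel {t..b} (\<lambda>s. - (f' s * (s - t) powr (- \<beta>)))"
    using set_integrable_mult_right[of "-1", OF i1] by simp
  moreover have i2': "set_integrable lborel {t..b} (\<lambda>s. \<beta> * ((f t - f s) / (s - t) powr (\<beta> + 1)))"
    by (rule set_integrable_mult_right) (rule i2)
  moreover have "(LBINT s:{t..b}. ?d s) = integral {t..b} ?d"
    by (rule set_borel_integral_eq_integral(2)) (rule set_integral_diff(1)[OF i1' i2'])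
  moreover have "(LBINT s:{t..b}. - (f' s * (s - t) powr (- \<beta>))) = - (LBINT s:{t..b}. f' s * (s - t) powr (- \<beta>))"
    by (simp add: set_lebesgue_integral_def)
  then have "(LBINT s:{t..b}. ?d s) = - (LBINT s:{t..b}. f' s * (s - t) powr (- \<beta>))
       - \<beta> * (LBINT s:{t..b}. (f t - f s) / (s - t) powr (\<beta> + 1))"
    by (simp only: set_integral_diff(2)[OF i1' i2'] set_integral_mult_right)
  ultimately have "- (LBINT s:{t..b}. f' s * (s - t) powr (- \<beta>))
       - \<beta> * (LBINT s:{t..b}. (f t - f s) / (s - t) powr (\<beta> + 1)) = \<Phi> b"
    by (simp add: integral_unique \<Phi>_def)
  then show "right_deriv \<beta> b f t = - (LBINT s:{t..b}. f' s * (s - t) powr (- \<beta>))"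
    by (simp add: right_deriv_def \<Phi>_def powr_minus divide_inverse)
qed

text \<open>Follows from the right-hand version by the reflection x to -x. The extra term with
  \<open>f a\<close> appears because \<open>left_deriv\<close> does not subtract the boundary
  value.\<close>

lemma left_deriv_C1:
  fixes f f' :: "real \<Rightarrow> real"
  assumes f: "\<And>x. (f has_real_derivative f' x) (at x)" and f': "continuous_on UNIV f'"
    and "0 < \<alpha>" "\<alpha> < 1" "a \<le> t"
  shows "set_integrable lborel {a..t} (\<lambda>r. f' r * (t - r) powr (- \<alpha>))"
    and "left_deriv \<alpha> a f t = f a / (t - a) powr \<alpha> + (LBINT r:{a..t}. f' r * (t - r) powr (- \<alpha>))"
proof -
  have S: "{x. - x \<in> {-t..-a}} = {a..t}" by auto
  have d: "((\<lambda>x. f (- x)) has_real_derivative - f' (- x)) (at x)" for x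
  proof -
    have "(uminus has_real_derivative -1) (at x)" by (auto intro!: derivative_eq_intros)
    from DERIV_chain2[OF f this] show ?thesis by simp
  qed
  have c: "continuous_on UNIV (\<lambda>x. - f' (- x))"
    using f' by (intro continuous_intros continuous_on_compose2[OF f']) auto
  have "- t \<le> - a" using assms by simp
  note R = right_deriv_C1[OF d c assms(3,4) this]
  have i: "indicator {-t..-a} (0 + (-1) * x) = (indicator {a..t} x :: real)" for x
    by (auto split: split_indicator)
  show "set_integrable lborel {a..t} (\<lambda>r. f' r * (t - r) powr (- \<alpha>))"
    using lborel_integrable_real_affine[OF R(1)[unfolded set_integrable_def], of "-1" 0]
    unfolding i by (simp add: set_integrable_def)
  have "right_deriv \<alpha> (- a) (\<lambda>x. f (- x)) (- t) =
     (f t - f a) / (t - a) powr \<alpha> + \<alpha> * (LBINT r:{a..t}. (f t - f r) / (t - r) powr (\<alpha> + 1))"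
    unfolding right_deriv_def by (subst set_integral_reflect, unfold S) simp
  moreover have "(LBINT s:{-t..-a}. - f' (- s) * (s - - t) powr (- \<alpha>)) =
      - (LBINT r:{a..t}. f' r * (t - r) powr (- \<alpha>))"
    by (subst set_integral_reflect, unfold S) (simp add: set_lebesgue_integral_def)
  ultimately have "(f t - f a) / (t - a) powr \<alpha> + \<alpha> * (LBINT r:{a..t}. (f t - f r) / (t - r) powr (\<alpha> + 1))
      = (LBINT r:{a..t}. f' r * (t - r) powr (- \<alpha>))"
    using R(2) by simp
  then show "left_deriv \<alpha> a f t = f a / (t - a) powr \<alpha> + (LBINT r:{a..t}. f' r * (t - r) powr (- \<alpha>))"
    by (simp add: left_deriv_def diff_divide_distrib)
qed

text \<open>The exponents add up to -1, so the integral is invariant under affine maps of the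
  interval and equals the Beta integral on \<open>{0..1}\<close>. That it does not depend on r and s
  is what makes Abel inversion work.\<close>

lemma beta_kernel:
  fixes r s \<alpha> :: real
  assumes "r < s" "0 < \<alpha>" "\<alpha> < 1"
  shows "set_integrable lborel {r..s} (\<lambda>t. (s - t) powr (\<alpha> - 1) * (t - r) powr (- \<alpha>))"
    and "(LBINT t:{r..s}. (s - t) powr (\<alpha> - 1) * (t - r) powr (- \<alpha>)) = Gamma \<alpha> * Gamma (1 - \<alpha>)"
proof -
  let ?k = "\<lambda>t. t powr (- \<alpha>) * (1 - t) powr (\<alpha> - 1)"
  have *: "(?k has_integral Gamma \<alpha> * Gamma (1 - \<alpha>)) {0..1}"
    using has_integral_Beta_real[of "1 - \<alpha>" \<alpha>] assms by (simp add: Beta_def mult.commute)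
  have 1: "set_integrable lborel {0..1} ?k" and 2: "(LBINT t:{0..1}. ?k t) = Gamma \<alpha> * Gamma (1 - \<alpha>)"
    using has_integral_imp_set_integral_lborel[OF *] by auto
  \<comment> \<open>Under x to (x - r) / (s - r) the two powers release a factor s - r, which
    cancels the Jacobian.\<close>
  have k: "indicator {0..1} (- r / (s - r) + 1 / (s - r) * x) *\<^sub>R ?k (- r / (s - r) + 1 / (s - r) * x) =
      (s - r) * (indicator {r..s} x *\<^sub>R ((s - x) powr (\<alpha> - 1) * (x - r) powr (- \<alpha>)))" for x
  proof (cases "x \<in> {r..s}")
    case True
    have e: "- r / (s - r) + 1 / (s - r) * x = (x - r) / (s - r)"
      by (simp add: diff_divide_distrib)
    have e': "1 - (x - r) / (s - r) = (s - x) / (s - r)"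
      using assms by (auto simp: field_simps)
    have "(s - r) powr (- \<alpha>) * (s - r) powr (\<alpha> - 1) * (s - r) = 1"
      using assms by (simp add: powr_minus powr_diff field_simps)
    then have p: "1 / ((s - r) powr (- \<alpha>) * (s - r) powr (\<alpha> - 1)) = s - r"
      using assms by (simp add: field_simps)
    have "?k ((x - r) / (s - r)) =
        1 / ((s - r) powr (- \<alpha>) * (s - r) powr (\<alpha> - 1)) * ((s - x) powr (\<alpha> - 1) * (x - r) powr (- \<alpha>))"
      using True assms by (simp add: e' powr_divide)
    then show ?thesis
      using True assms unfolding e p by simp
  next
    case False
    have e: "- r / (s - r) + 1 / (s - r) * x = (x - r) / (s - r)" by (simp add: diff_divide_distrib)
    have "(x - r) / (s - r) \<notin> {0..1}"
      using False assms by (auto simp: field_simps)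
    then show ?thesis using False unfolding e by simp
  qed
  have "integrable lborel (\<lambda>x. (s - r) * (indicator {r..s} x *\<^sub>R ((s - x) powr (\<alpha> - 1) * (x - r) powr (- \<alpha>))))"
    using lborel_integrable_real_affine[OF 1[unfolded set_integrable_def], of "1 / (s - r)" "- r / (s - r)"] assms
    unfolding k by simp
  then show "set_integrable lborel {r..s} (\<lambda>t. (s - t) powr (\<alpha> - 1) * (t - r) powr (- \<alpha>))"
    using assms by (simp add: set_integrable_def)
  show "(LBINT t:{r..s}. (s - t) powr (\<alpha> - 1) * (t - r) powr (- \<alpha>)) = Gamma \<alpha> * Gamma (1 - \<alpha>)"
    using lborel_integral_real_affine[of "1 / (s - r)" "\<lambda>x. indicator {0..1} x *\<^sub>R ?k x" "- r / (s - r)"] 2 assms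
    unfolding k by (simp add: set_lebesgue_integral_def)
qed

text \<open>Fubini on a region given by its slices in either direction. Integrability of the partial
  integrals is part of the conclusion because later sums must be split into separate
  integrals.\<close>

lemma set_integral_swap:
  fixes F K :: "real \<Rightarrow> real \<Rightarrow> real"
  assumes F: "(\<lambda>(x, y). F x y) \<in> borel_measurable (borel \<Otimes>\<^sub>M borel)"
    and K: "integrable (lborel \<Otimes>\<^sub>M lborel) (\<lambda>(x, y). K x y)"
    and D: "{(x, y). x \<in> A \<and> y \<in> B x} \<in> sets (borel \<Otimes>\<^sub>M borel)"
    and eq: "\<And>x y. x \<in> A \<and> y \<in> B x \<longleftrightarrow> y \<in> C \<and> x \<in> E y"
    and le: "\<And>x y. x \<in> A \<Longrightarrow> y \<in> B x \<Longrightarrow> \<bar>F x y\<bar> \<le> K x y"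
  shows "(LBINT x:A. LBINT y:B x. F x y) = (LBINT y:C. LBINT x:E y. F x y)"
    and "set_integrable lborel A (\<lambda>x. LBINT y:B x. F x y)"
    and "set_integrable lborel C (\<lambda>y. LBINT x:E y. F x y)"
proof -
  let ?H = "\<lambda>x y. indicator {(x, y). x \<in> A \<and> y \<in> B x} (x, y) * F x y"
  have int: "integrable (lborel \<Otimes>\<^sub>M lborel) (\<lambda>(x, y). ?H x y)"
  proof (rule Bochner_Integration.integrable_bound[OF K])
    have s: "sets (lborel \<Otimes>\<^sub>M lborel) = sets (borel \<Otimes>\<^sub>M borel :: (real \<times> real) measure)"
      by (rule sets_pair_measure_cong) simp_all
    have "(\<lambda>p. indicator {(x, y). x \<in> A \<and> y \<in> B x} p * (\<lambda>(x, y). F x y) p) \<in> borel_measurable (borel \<Otimes>\<^sub>M borel)"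
      using D by (intro borel_measurable_times borel_measurable_indicator F)
    then show "(\<lambda>(x, y). ?H x y) \<in> borel_measurable (lborel \<Otimes>\<^sub>M lborel)"
      by (simp add: case_prod_beta' measurable_cong_sets[OF s refl])
    show "AE p in lborel \<Otimes>\<^sub>M lborel. norm (case p of (x, y) \<Rightarrow> ?H x y) \<le> norm (case p of (x, y) \<Rightarrow> K x y)"
      using le by (intro AE_I2) (fastforce split: split_indicator)
  qed
  have *: "(\<lambda>x. LBINT y. ?H x y) = (\<lambda>x. indicator A x *\<^sub>R (LBINT y:B x. F x y))"
    unfolding set_lebesgue_integral_def
    by (rule ext) (auto intro!: Bochner_Integration.integral_cong split: split_indicator)
  have **: "(\<lambda>y. LBINT x. ?H x y) = (\<lambda>y. indicator C y *\<^sub>R (LBINT x:E y. F x y))"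
    unfolding set_lebesgue_integral_def eq
    by (rule ext) (auto intro!: Bochner_Integration.integral_cong split: split_indicator)
  show "set_integrable lborel A (\<lambda>x. LBINT y:B x. F x y)"
    using lborel_pair.integrable_fst[OF int] unfolding set_integrable_def * .
  show "set_integrable lborel C (\<lambda>y. LBINT x:E y. F x y)"
    using lborel_pair.integrable_snd[OF int] unfolding set_integrable_def ** .
  show "(LBINT x:A. LBINT y:B x. F x y) = (LBINT y:C. LBINT x:E y. F x y)"
    using lborel_pair.Fubini_integral[OF int] by (simp only: * ** set_lebesgue_integral_def[of lborel A] set_lebesgue_integral_def[of lborel C])
qed

text \<open>Majorants for the interchanges: the plain product on rectangles, the convolution form on
  triangles, where a kernel is singular along the diagonal.\<close>

lemma integrable_product:
  fixes u w :: "real \<Rightarrow> real"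
  assumes u: "integrable lborel u" and w: "integrable lborel w"
  shows "integrable (lborel \<Otimes>\<^sub>M lborel) (\<lambda>(x, y). u x * w y)"
    and "integrable (lborel \<Otimes>\<^sub>M lborel) (\<lambda>(x, y). u x * w (y - x))"
proof -
  have [measurable]: "u \<in> borel_measurable borel" "w \<in> borel_measurable borel"
    using borel_measurable_integrable[OF u] borel_measurable_integrable[OF w] by auto
  show "integrable (lborel \<Otimes>\<^sub>M lborel) (\<lambda>(x, y). u x * w y)"
  proof (rule lborel_pair.Fubini_integrable)
    show "integrable lborel (\<lambda>x. LBINT y. norm (case (x, y) of (x, y) \<Rightarrow> u x * w y))"
      using u by (simp add: abs_mult)
  qed (use w in auto)
  have shift: "integrable lborel (\<lambda>y. w (y - x))" for x
    using lborel_integrable_real_affine[OF w, of 1 "-x"] by simp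
  have int: "(LBINT y. \<bar>w (y - x)\<bar>) = (LBINT y. \<bar>w y\<bar>)" for x
    using lborel_integral_real_affine[of 1 "\<lambda>y. \<bar>w y\<bar>" "-x"] by simp
  show "integrable (lborel \<Otimes>\<^sub>M lborel) (\<lambda>(x, y). u x * w (y - x))"
  proof (rule lborel_pair.Fubini_integrable)
    show "integrable lborel (\<lambda>x. LBINT y. norm (case (x, y) of (x, y) \<Rightarrow> u x * w (y - x)))"
      using u by (simp add: abs_mult int)
  qed (use shift in auto)
qed

lemma bounded_on_Icc:
  fixes f :: "real \<Rightarrow> real"
  assumes "continuous_on UNIV f"
  obtains C where "\<And>x. x \<in> {a..b} \<Longrightarrow> \<bar>f x\<bar> \<le> C"
proof -
  have "compact (f ` {a..b})"
    using assms by (intro compact_continuous_image) (auto intro: continuous_on_subset)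
  then show ?thesis
    using that by (metis bounded_iff compact_imp_bounded imageI real_norm_def)
qed

text \<open>In the representation of \<open>left_deriv_C1\<close> the integral is of order
  \<open>(t - a) powr (1 - \<alpha>)\<close>. Giving up one factor \<open>t - a \<le> b - a\<close>
  puts both terms under one singular power, as a majorant of product type requires.\<close>

lemma left_deriv_C1_bound:
  fixes f f' :: "real \<Rightarrow> real"
  assumes f: "\<And>x. (f has_real_derivative f' x) (at x)" and f': "continuous_on UNIV f'"
    and "0 < \<alpha>" "\<alpha> < 1" "t \<in> {a..b}"
    and "\<And>r. r \<in> {a..b} \<Longrightarrow> \<bar>f r\<bar> \<le> C" "\<And>r. r \<in> {a..b} \<Longrightarrow> \<bar>f' r\<bar> \<le> C'"
  shows "\<bar>left_deriv \<alpha> a f t\<bar> \<le> (C + C' * (b - a) / (1 - \<alpha>)) * (t - a) powr (- \<alpha>)"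
proof -
  have i: "set_integrable lborel {a..t} (\<lambda>r. C' * (t - r) powr (- \<alpha>))"
    using assms by (intro set_integrable_mult_right set_integral_powr(3)) auto
  have [measurable]: "f' \<in> borel_measurable borel"
    using f' by (rule borel_measurable_continuous_onI)
  have "\<bar>LBINT r:{a..t}. f' r * (t - r) powr (- \<alpha>)\<bar> \<le> (LBINT r:{a..t}. C' * (t - r) powr (- \<alpha>))"
    by (rule set_integrable_dominated(2)[OF i]) (use assms in \<open>auto simp: abs_mult intro: mult_right_mono\<close>)
  also have "\<dots> = C' * (t - a) powr (1 - \<alpha>) / (1 - \<alpha>)"
    using set_integral_powr(4)[of "-\<alpha>" a t] assms by simp
  also have "\<dots> = C' / (1 - \<alpha>) * ((t - a) * (t - a) powr (- \<alpha>))"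
    using assms by (cases "t = a") (auto simp: powr_diff powr_minus divide_inverse)
  also have "\<dots> \<le> C' / (1 - \<alpha>) * ((b - a) * (t - a) powr (- \<alpha>))"
    using assms(3-5) assms(7)[of t] by (intro mult_left_mono mult_right_mono) auto
  finally have "\<bar>LBINT r:{a..t}. f' r * (t - r) powr (- \<alpha>)\<bar> \<le> C' * (b - a) / (1 - \<alpha>) * (t - a) powr (- \<alpha>)"
    by simp
  moreover have "\<bar>f a / (t - a) powr \<alpha>\<bar> \<le> C * (t - a) powr (- \<alpha>)"
    using assms(5) assms(6)[of a] by (simp add: powr_minus divide_inverse abs_mult mult_right_mono)
  ultimately have "\<bar>f a / (t - a) powr \<alpha> + (LBINT r:{a..t}. f' r * (t - r) powr (- \<alpha>))\<bar>
      \<le> C * (t - a) powr (- \<alpha>) + C' * (b - a) / (1 - \<alpha>) * (t - a) powr (- \<alpha>)"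
    by linarith
  then show ?thesis
    using left_deriv_C1(2)[OF f f' assms(3,4), of a t] assms(5) by (simp add: distrib_right)
qed

text \<open>Fractional integration of order \<open>\<alpha>\<close> inverts the derivative of order \<open>\<alpha>\<close>, up to the missing
  normalising factors.\<close>

lemma abel_inversion:
  fixes f f' :: "real \<Rightarrow> real"
  assumes f: "\<And>x. (f has_real_derivative f' x) (at x)" and f': "continuous_on UNIV f'"
    and alpha: "0 < \<alpha>" "\<alpha> < 1" and "a < s"
  shows "(LBINT t:{a..s}. (s - t) powr (\<alpha> - 1) * left_deriv \<alpha> a f t) = Gamma \<alpha> * Gamma (1 - \<alpha>) * f s"
proof -
  let ?B = "Gamma \<alpha> * Gamma (1 - \<alpha>)"
  have [measurable]: "f' \<in> borel_measurable borel"
    using f' by (rule borel_measurable_continuous_onI)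
  obtain C where C: "\<And>x. x \<in> {a..s} \<Longrightarrow> \<bar>f' x\<bar> \<le> C"
    using bounded_on_Icc[OF f'] by blast
  \<comment> \<open>The majorant is a function of t times a kernel in r - t. The cut-off to
    \<open>{-(s - a)..0}\<close> makes the kernel integrable on the line and covers all differences
    that occur.\<close>
  let ?u = "\<lambda>t. indicator {a..s} t *\<^sub>R (C * (s - t) powr (\<alpha> - 1))"
  let ?w = "\<lambda>z. indicator {-(s - a)..0} z *\<^sub>R (0 - z) powr (- \<alpha>)"
  have "set_integrable lborel {a..s} (\<lambda>t. C * (s - t) powr (\<alpha> - 1))"
    using alpha assms(5) by (intro set_integrable_mult_right set_integral_powr(3)) auto
  then have u: "integrable lborel ?u" by (simp add: set_integrable_def)
  have w: "integrable lborel ?w"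
    using set_integral_powr(3)[of "-\<alpha>" "-(s - a)" 0] alpha assms(5) by (simp add: set_integrable_def)
  let ?F = "\<lambda>t r. f' r * (t - r) powr (- \<alpha>) * (s - t) powr (\<alpha> - 1)"
  let ?J = "\<lambda>t. LBINT r:{a..t}. f' r * (t - r) powr (- \<alpha>)"
  have D: "{(t, r). t \<in> {a..s} \<and> r \<in> {a..t}} \<in> sets (borel \<Otimes>\<^sub>M borel)"
  proof -
    have "{p \<in> space (borel \<Otimes>\<^sub>M borel). a \<le> fst p \<and> fst p \<le> s \<and> a \<le> snd p \<and> snd p \<le> fst p}
        \<in> sets (borel \<Otimes>\<^sub>M (borel :: real measure))"
      by measurable
    then show ?thesis by (simp add: space_pair_measure case_prod_beta' conj_assoc)
  qed
  have le: "\<bar>?F t r\<bar> \<le> ?u t * ?w (r - t)" if "t \<in> {a..s}" "r \<in> {a..t}" for t r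
  proof -
    have "r \<in> {a..s}" "r - t \<in> {-(s - a)..0}" using that by auto
    then show ?thesis
      using C[of r] that by (simp add: abs_mult mult_ac) (metis mult.commute mult_left_mono powr_ge_zero mult_nonneg_nonneg)
  qed
  have F: "(\<lambda>(t, r). ?F t r) \<in> borel_measurable (borel \<Otimes>\<^sub>M borel)" by measurable
  have eq: "t \<in> {a..s} \<and> r \<in> {a..t} \<longleftrightarrow> r \<in> {a..s} \<and> t \<in> {r..s}" for t r by auto
  note swap = set_integral_swap[OF F integrable_product(2)[OF u w] D eq le]
  have F': "(s - t) powr (\<alpha> - 1) * ?J t = (LBINT r:{a..t}. ?F t r)" for t
    by (simp add: mult.commute[of "(s - _) powr _"])
  have J_int: "set_integrable lborel {a..s} (\<lambda>t. (s - t) powr (\<alpha> - 1) * ?J t)"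
    unfolding F' by (rule swap(2))
  \<comment> \<open>By \<open>left_deriv_C1\<close> a boundary term splits off, which gives
    \<open>f a\<close> times the Beta value. The fractional integral of \<open>f'\<close> gives,
    after the swap, the Beta value times \<open>f s - f a\<close>.\<close>
  have "(LBINT t:{a..s}. (s - t) powr (\<alpha> - 1) * left_deriv \<alpha> a f t) =
      (LBINT t:{a..s}. f a * ((s - t) powr (\<alpha> - 1) * (t - a) powr (- \<alpha>)) + (s - t) powr (\<alpha> - 1) * ?J t)"
    using left_deriv_C1(2)[OF f f' alpha, of a]
    by (intro set_lebesgue_integral_cong) (auto simp: powr_minus divide_inverse algebra_simps)
  also have "\<dots> = f a * ?B + (LBINT t:{a..s}. (s - t) powr (\<alpha> - 1) * ?J t)"
    using set_integral_add(2)[OF set_integrable_mult_right[OF beta_kernel(1)[OF assms(5) alpha]] J_int]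
    by (simp add: beta_kernel(2)[OF assms(5) alpha])
  also have "(LBINT t:{a..s}. (s - t) powr (\<alpha> - 1) * ?J t) = (LBINT t:{a..s}. LBINT r:{a..t}. ?F t r)"
    unfolding F' ..
  also have "\<dots> = (LBINT r:{a..s}. LBINT t:{r..s}. ?F t r)"
    by (rule swap(1))
  also have "\<dots> = (LBINT r:{a..s}. ?B * f' r)"
  proof -
    \<comment> \<open>At \<open>r = s\<close> the inner interval is a point and its integral is 0,
      so the Beta value is available only almost everywhere.\<close>
    have "AE r\<in>{a..s} in lborel. (LBINT t:{r..s}. ?F t r) = ?B * f' r"
      using AE_lborel_singleton[of s]
    proof eventually_elim
      case (elim r)
      show ?case
      proof
        assume "r \<in> {a..s}"
        with elim have "r < s" by auto
        then show "(LBINT t:{r..s}. ?F t r) = ?B * f' r"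
          using beta_kernel(2)[OF _ alpha, of r s] by (simp add: mult_ac set_integral_mult_right)
      qed
    qed
    then show ?thesis
      unfolding set_lebesgue_integral_def[of lborel "{a..s}"]
      using borel_measurable_integrable[OF swap(3)[unfolded set_integrable_def]]
      by (intro integral_cong_AE) (auto split: split_indicator)
  qed
  also have "\<dots> = ?B * (f s - f a)"
  proof -
    have "(f' has_integral f s - f a) {a..s}"
      using f \<open>a < s\<close> by (intro fundamental_theorem_of_calculus)
        (auto simp: has_real_derivative_iff_has_vector_derivative[symmetric] intro: has_field_derivative_at_within)
    moreover have "set_integrable lborel {a..s} f'"
      using f' by (intro borel_integrable_atLeastAtMost') (auto intro: continuous_on_subset)
    ultimately show ?thesis
      by (simp add: set_borel_integral_eq_integral integral_unique)
  qed
  finally show ?thesis by (simp add: algebra_simps)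
qed

text \<open>The inner derivative becomes a fractional integral of g in s, the left derivative passes
  under it, and interchanging s and t on the triangle lets Abel inversion of \<open>g s\<close>
  return its value at s. Only the derivatives g in s and h of g in r are involved.\<close>

lemma weyl_int_C2:
  fixes G g h :: "real \<Rightarrow> real \<Rightarrow> real"
  assumes G: "\<And>s r. ((\<lambda>s. G s r) has_real_derivative g s r) (at s)"
    and g: "\<And>s r. (g s has_real_derivative h s r) (at r)"
    and cont: "continuous_on UNIV (\<lambda>(s, r). g s r)" "continuous_on UNIV (\<lambda>(s, r). h s r)"
    and alpha: "0 < \<alpha>" "\<alpha> < 1" and "a < b"
  shows "weyl_int \<alpha> a b G = - (Gamma \<alpha> * Gamma (1 - \<alpha>) * (LBINT s:{a..b}. g s s))"
proof -
  let ?B = "Gamma \<alpha> * Gamma (1 - \<alpha>)"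
  have bnd: "\<exists>C. \<forall>s\<in>{a..b}. \<forall>r\<in>{a..b}. \<bar>f s r\<bar> \<le> C" if f: "continuous_on UNIV (\<lambda>(s, r). f s r)"
    for f :: "real \<Rightarrow> real \<Rightarrow> real"
  proof -
    have "compact ((\<lambda>(s, r). f s r) ` ({a..b} \<times> {a..b}))"
      by (intro compact_continuous_image compact_Times continuous_on_subset[OF f]) auto
    then obtain C where "\<forall>y\<in>(\<lambda>(s, r). f s r) ` ({a..b} \<times> {a..b}). norm y \<le> C"
      by (meson bounded_iff compact_imp_bounded)
    then show ?thesis by (intro exI[of _ C]) force
  qed
  obtain Cg where Cg: "\<And>s r. s \<in> {a..b} \<Longrightarrow> r \<in> {a..b} \<Longrightarrow> \<bar>g s r\<bar> \<le> Cg"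
    using bnd[OF cont(1)] by blast
  obtain Ch where Ch: "\<And>s r. s \<in> {a..b} \<Longrightarrow> r \<in> {a..b} \<Longrightarrow> \<bar>h s r\<bar> \<le> Ch"
    using bnd[OF cont(2)] by blast
  have g_meas: "(\<lambda>(s, r). g s r) \<in> borel_measurable (borel \<Otimes>\<^sub>M borel)"
    using borel_measurable_continuous_onI[OF cont(1)] by (simp add: borel_prod)
  have g_cont: "continuous_on UNIV (\<lambda>s. g s r)" for r
  proof -
    have "continuous_on UNIV ((\<lambda>(s, r). g s r) \<circ> (\<lambda>s. (s, r)))"
      by (intro continuous_on_compose continuous_on_subset[OF cont(1)] continuous_intros) auto
    then show ?thesis by (simp add: o_def)
  qed
  have h_cont: "continuous_on UNIV (h s)" for s
  proof -
    have "continuous_on UNIV ((\<lambda>(s, r). h s r) \<circ> (\<lambda>r. (s, r)))"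
      by (intro continuous_on_compose continuous_on_subset[OF cont(2)] continuous_intros) auto
    then show ?thesis by (simp add: o_def)
  qed
  have lip: "\<bar>g s t - g s r\<bar> \<le> Ch * (t - r)" if "s \<in> {a..b}" "r \<in> {a..t}" "t \<in> {a..b}" for s r t
  proof (cases "r = t")
    case False
    then have "r < t" using that by auto
    from MVT2[OF this, of "g s" "h s"] g obtain z where "r < z" "z < t" "g s t - g s r = (t - r) * h s z" by blast
    then show ?thesis using Ch[of s z] that
      by (simp add: abs_mult mult.commute mult_right_mono)
  qed simp
  have inner: "inner_deriv \<alpha> b G t r = - (LBINT s:{t..b}. g s r * (s - t) powr (\<alpha> - 1))"
    and inner_int: "set_integrable lborel {t..b} (\<lambda>s. g s r * (s - t) powr (\<alpha> - 1))" if "t \<le> b" for t r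
    using right_deriv_C1[OF G g_cont, of "1 - \<alpha>" t b r] alpha that by (auto simp: inner_deriv_def)

  let ?L = "\<lambda>s t. left_deriv \<alpha> a (g s) t"
  \<comment> \<open>Differentiation in r commutes with the integral over s by Fubini on the
    rectangle \<open>{a..t} \<times> {t..b}\<close>: as g is Lipschitz in r, the difference kernel
    is of order \<open>(t - r) powr (- \<alpha>)\<close>.\<close>
  have outer: "left_deriv \<alpha> a (inner_deriv \<alpha> b G t) t = - (LBINT s:{t..b}. (s - t) powr (\<alpha> - 1) * ?L s t)"
    if t: "t \<in> {a..b}" for t
  proof -
    let ?F = "\<lambda>r s. (g s t - g s r) / (t - r) powr (\<alpha> + 1) * (s - t) powr (\<alpha> - 1)"
    let ?u = "\<lambda>r. indicator {a..t} r *\<^sub>R (Ch * (t - r) powr (- \<alpha>))"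
    let ?w = "\<lambda>s. indicator {t..b} s *\<^sub>R (s - t) powr (\<alpha> - 1)"
    have "set_integrable lborel {a..t} (\<lambda>r. Ch * (t - r) powr (- \<alpha>))"
      using t alpha by (intro set_integrable_mult_right set_integral_powr(3)) auto
    then have u: "integrable lborel ?u" by (simp add: set_integrable_def)
    have w: "integrable lborel ?w"
      using set_integral_powr(1)[of "\<alpha> - 1" t b] alpha t by (simp add: set_integrable_def)
    have F: "(\<lambda>(r, s). ?F r s) \<in> borel_measurable (borel \<Otimes>\<^sub>M borel)"
    proof -
      have [measurable]: "(\<lambda>s. g s t) \<in> borel_measurable borel"
        using g_cont by (rule borel_measurable_continuous_onI)
      have [measurable]: "(\<lambda>p. g (snd p) (fst p)) \<in> borel_measurable (borel \<Otimes>\<^sub>M borel)"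
        using measurable_compose[OF measurable_Pair[OF measurable_snd measurable_fst] g_meas] by simp
      show ?thesis by measurable
    qed
    have D: "{(r, s). r \<in> {a..t} \<and> s \<in> {t..b}} \<in> sets (borel \<Otimes>\<^sub>M borel)"
    proof -
      have "{(r, s). r \<in> {a..t} \<and> s \<in> {t..b}} = {a..t} \<times> {t..b}" by auto
      then show ?thesis by simp
    qed
    have le: "\<bar>?F r s\<bar> \<le> ?u r * ?w s" if "r \<in> {a..t}" "s \<in> {t..b}" for r s
    proof -
      have "\<bar>g s t - g s r\<bar> \<le> Ch * (t - r) powr 1"
        using lip[of s r t] that t by auto
      then have "\<bar>(g s t - g s r) / (t - r) powr (\<alpha> + 1)\<bar> \<le> Ch * (t - r) powr (1 - \<alpha> - 1)"
        using that by (intro singular_quotient_le) auto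
      then have "\<bar>(g s t - g s r) / (t - r) powr (\<alpha> + 1)\<bar> * (s - t) powr (\<alpha> - 1)
          \<le> Ch * (t - r) powr (- \<alpha>) * (s - t) powr (\<alpha> - 1)"
        by (intro mult_right_mono) auto
      then show ?thesis
        using that by (simp add: abs_mult)
    qed
    have eq: "r \<in> {a..t} \<and> s \<in> {t..b} \<longleftrightarrow> s \<in> {t..b} \<and> r \<in> {a..t}" for r s by auto
    note swap = set_integral_swap[OF F integrable_product(1)[OF u w] D eq le]
    have "(LBINT r:{a..t}. (inner_deriv \<alpha> b G t t - inner_deriv \<alpha> b G t r) / (t - r) powr (\<alpha> + 1)) =
        (LBINT r:{a..t}. - (LBINT s:{t..b}. ?F r s))"
    proof (rule set_lebesgue_integral_cong)
      have "(inner_deriv \<alpha> b G t t - inner_deriv \<alpha> b G t r) / (t - r) powr (\<alpha> + 1) = - (LBINT s:{t..b}. ?F r s)" for r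
      proof -
        have "(LBINT s:{t..b}. ?F r s) = (LBINT s:{t..b}. (1 / (t - r) powr (\<alpha> + 1)) *
            (g s t * (s - t) powr (\<alpha> - 1) - g s r * (s - t) powr (\<alpha> - 1)))"
          by (intro set_lebesgue_integral_cong) (auto simp: left_diff_distrib diff_divide_distrib)
        also have "\<dots> = (1 / (t - r) powr (\<alpha> + 1)) *
            ((LBINT s:{t..b}. g s t * (s - t) powr (\<alpha> - 1)) - (LBINT s:{t..b}. g s r * (s - t) powr (\<alpha> - 1)))"
          using inner_int[of t] t by (subst set_integral_mult_right, subst set_integral_diff(2)) auto
        finally have e: "(LBINT s:{t..b}. ?F r s) = \<dots>" .
        have i: "inner_deriv \<alpha> b G t r = - (LBINT s:{t..b}. g s r * (s - t) powr (\<alpha> - 1))" for r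
          using inner[of t] t by simp
        show ?thesis unfolding e i by (simp add: minus_divide_left)
      qed
      then show "\<forall>r. r \<in> {a..t} \<longrightarrow> (inner_deriv \<alpha> b G t t - inner_deriv \<alpha> b G t r) / (t - r) powr (\<alpha> + 1)
         = - (LBINT s:{t..b}. ?F r s)" by blast
    qed auto
    also have "\<dots> = - (LBINT r:{a..t}. LBINT s:{t..b}. ?F r s)"
      by (simp add: set_lebesgue_integral_def[of lborel "{a..t}"])
    also have "\<dots> = - (LBINT s:{t..b}. LBINT r:{a..t}. ?F r s)"
      using swap(1) by simp
    finally have outer_int: "(LBINT r:{a..t}. (inner_deriv \<alpha> b G t t - inner_deriv \<alpha> b G t r) / (t - r) powr (\<alpha> + 1)) =
      - (LBINT s:{t..b}. LBINT r:{a..t}. ?F r s)" .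
    have i1: "set_integrable lborel {t..b} (\<lambda>s. 1 / (t - a) powr \<alpha> * (g s t * (s - t) powr (\<alpha> - 1)))"
      using inner_int[of t] t by (intro set_integrable_mult_right) auto
    have i2: "set_integrable lborel {t..b} (\<lambda>s. \<alpha> * (LBINT r:{a..t}. ?F r s))"
      by (intro set_integrable_mult_right swap(3))
    have "(LBINT s:{t..b}. (s - t) powr (\<alpha> - 1) * ?L s t) =
      (LBINT s:{t..b}. 1 / (t - a) powr \<alpha> * (g s t * (s - t) powr (\<alpha> - 1)) + \<alpha> * (LBINT r:{a..t}. ?F r s))"
    proof (intro set_lebesgue_integral_cong allI impI)
      fix s
      have e: "(LBINT r:{a..t}. ?F r s) = (LBINT r:{a..t}. (g s t - g s r) / (t - r) powr (\<alpha> + 1)) * (s - t) powr (\<alpha> - 1)"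
        by (rule set_integral_mult_left)
      show "(s - t) powr (\<alpha> - 1) * ?L s t =
          1 / (t - a) powr \<alpha> * (g s t * (s - t) powr (\<alpha> - 1)) + \<alpha> * (LBINT r:{a..t}. ?F r s)"
        unfolding left_deriv_def e by (simp add: distrib_left mult_ac)
    qed simp
    also have "\<dots> = 1 / (t - a) powr \<alpha> * (LBINT s:{t..b}. g s t * (s - t) powr (\<alpha> - 1)) +
        \<alpha> * (LBINT s:{t..b}. LBINT r:{a..t}. ?F r s)"
      by (simp only: set_integral_add(2)[OF i1 i2] set_integral_mult_right)
    finally show ?thesis
      using inner[of t t] t outer_int by (simp add: left_deriv_def)
  qed

  \<comment> \<open>The constant of \<open>left_deriv_C1_bound\<close> for \<open>g s\<close>,
    uniform in s.\<close>
  define M where "M = Cg + Ch * (b - a) / (1 - \<alpha>)"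
  let ?F = "\<lambda>t s. (s - t) powr (\<alpha> - 1) * ?L s t"
  let ?u = "\<lambda>t. indicator {a..b} t *\<^sub>R (M * (t - a) powr (- \<alpha>))"
  let ?w = "\<lambda>z. indicator {0..b - a} z *\<^sub>R (z - 0) powr (\<alpha> - 1)"
  have "set_integrable lborel {a..b} (\<lambda>t. M * (t - a) powr (- \<alpha>))"
    using alpha \<open>a < b\<close> by (intro set_integrable_mult_right set_integral_powr(1)) auto
  then have u: "integrable lborel ?u" by (simp add: set_integrable_def)
  have w: "integrable lborel ?w"
    using set_integral_powr(1)[of "\<alpha> - 1" 0 "b - a"] alpha \<open>a < b\<close> by (simp add: set_integrable_def)
  have F: "(\<lambda>(t, s). ?F t s) \<in> borel_measurable (borel \<Otimes>\<^sub>M borel)"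
  proof -
    have "(\<lambda>(p :: real \<times> real, r). g (snd p) r) \<in> borel_measurable ((borel \<Otimes>\<^sub>M borel) \<Otimes>\<^sub>M borel)"
      using measurable_compose[of "\<lambda>q :: (real \<times> real) \<times> real. (snd (fst q), snd q)"
          "(borel \<Otimes>\<^sub>M borel) \<Otimes>\<^sub>M borel" "borel \<Otimes>\<^sub>M borel", OF _ g_meas]
      by (simp add: case_prod_beta')
    then have [measurable]: "(\<lambda>p. left_deriv \<alpha> a (g (snd p)) (fst p)) \<in> borel_measurable (borel \<Otimes>\<^sub>M borel)"
      by (rule measurable_left_deriv) measurable
    show ?thesis unfolding case_prod_beta' by measurable
  qed
  have D: "{(t, s). t \<in> {a..b} \<and> s \<in> {t..b}} \<in> sets (borel \<Otimes>\<^sub>M borel)"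
  proof -
    have "{p \<in> space (borel \<Otimes>\<^sub>M borel). a \<le> fst p \<and> fst p \<le> b \<and> fst p \<le> snd p \<and> snd p \<le> b}
        \<in> sets (borel \<Otimes>\<^sub>M (borel :: real measure))"
      by measurable
    then show ?thesis by (simp add: space_pair_measure case_prod_beta' conj_assoc)
  qed
  have le: "\<bar>?F t s\<bar> \<le> ?u t * ?w (s - t)" if "t \<in> {a..b}" "s \<in> {t..b}" for t s
  proof -
    have "\<bar>?L s t\<bar> \<le> M * (t - a) powr (- \<alpha>)"
      unfolding M_def using that Cg Ch by (intro left_deriv_C1_bound[OF g h_cont alpha]) auto
    then show ?thesis
      using that by (simp add: abs_mult mult.commute[of "(s - t) powr _"] mult_right_mono)
  qed
  have eq: "t \<in> {a..b} \<and> s \<in> {t..b} \<longleftrightarrow> s \<in> {a..b} \<and> t \<in> {a..s}" for t s by auto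
  note swap = set_integral_swap[OF F integrable_product(2)[OF u w] D eq le]
  have "weyl_int \<alpha> a b G = (LBINT t:{a..b}. - (LBINT s:{t..b}. ?F t s))"
    unfolding weyl_int_def using outer by (intro set_lebesgue_integral_cong) auto
  also have "\<dots> = - (LBINT t:{a..b}. LBINT s:{t..b}. ?F t s)"
    by (simp add: set_lebesgue_integral_def[of lborel "{a..b}"])
  also have "\<dots> = - (LBINT s:{a..b}. LBINT t:{a..s}. ?F t s)"
    using swap(1) by simp
  also have "(LBINT s:{a..b}. LBINT t:{a..s}. ?F t s) = (LBINT s:{a..b}. ?B * g s s)"
  proof -
    have [measurable]: "(\<lambda>s. g s s) \<in> borel_measurable borel"
      using measurable_compose[OF measurable_Pair[OF measurable_ident_sets measurable_ident_sets] g_meas] by simp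
    \<comment> \<open>\<open>abel_inversion\<close> requires \<open>a < s\<close>; the excluded
      point is a null set.\<close>
    have "AE s\<in>{a..b} in lborel. (LBINT t:{a..s}. ?F t s) = ?B * g s s"
      using AE_lborel_singleton[of a]
    proof eventually_elim
      case (elim s)
      then show ?case
        using abel_inversion[OF g h_cont alpha, of a s s] by auto
    qed
    then show ?thesis
      unfolding set_lebesgue_integral_def[of lborel "{a..b}"]
      using borel_measurable_integrable[OF swap(3)[unfolded set_integrable_def]]
      by (intro integral_cong_AE) (auto split: split_indicator)
  qed
  finally show ?thesis by simp
qed

section \<open>Steklov means and independence of the order\<close>

text \<open>Averaging gains a derivative: a window integral of a continuous f is the increment of an
  antiderivative, so its derivative is an increment of f, and f itself need not be
  differentiable.\<close>

lemma sliding_integral_derivative: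
  fixes f :: "real \<Rightarrow> real"
  assumes f: "continuous_on UNIV f" and "0 \<le> e"
  shows "((\<lambda>r. integral {0..e} (\<lambda>v. f (r + v))) has_real_derivative f (r + e) - f r) (at r)"
proof -
  have "\<exists>F. \<forall>x::real. -\<infinity> < ereal x \<longrightarrow> ereal x < \<infinity> \<longrightarrow> (F has_vector_derivative f x) (at x)"
    using f by (intro einterval_antiderivative) (auto simp: continuous_on_eq_continuous_at)
  then obtain F where F: "\<And>x. (F has_real_derivative f x) (at x)"
    by (auto simp: has_real_derivative_iff_has_vector_derivative)
  have "integral {0..e} (\<lambda>v. f (r + v)) = F (r + e) - F r" for r
  proof -
    have "((\<lambda>v. f (r + v)) has_integral F (r + e) - F (r + 0)) {0..e}"
    proof (rule fundamental_theorem_of_calculus[OF \<open>0 \<le> e\<close>])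
      fix v
      have "((\<lambda>v. F (r + v)) has_real_derivative f (r + v)) (at v)"
      proof -
        have "((\<lambda>v. r + v) has_real_derivative 1) (at v)" by (auto intro!: derivative_eq_intros)
        from DERIV_chain2[OF F this] show ?thesis by simp
      qed
      then show "((\<lambda>v. F (r + v)) has_vector_derivative f (r + v)) (at v within {0..e})"
        by (simp add: has_real_derivative_iff_has_vector_derivative has_vector_derivative_at_within)
    qed
    then show ?thesis by (simp add: integral_unique)
  qed
  then have *: "(\<lambda>r. integral {0..e} (\<lambda>v. f (r + v))) = (\<lambda>r. F (r + e) - F r)" by blast
  have "((\<lambda>r. F (r + e)) has_real_derivative f (r + e)) (at r)"
    using F DERIV_shift by blast
  then show ?thesis
    unfolding * by (intro DERIV_diff F)
qed

lemma continuous_on_sliding_integral: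
  fixes f :: "'a::topological_space \<Rightarrow> real \<Rightarrow> real"
  assumes "continuous_on UNIV (\<lambda>(x, v). f x v)"
  shows "continuous_on UNIV (\<lambda>x. integral {0..e} (f x))"
  using integral_continuous_on_param[of UNIV 0 e f] continuous_on_subset[OF assms] by simp

text \<open>Kept apart from \<open>steklov\<close> so that, by linearity, an increment of the mean
  is the mean of an increment, to which bounds apply pointwise.\<close>

definition mean2 :: "real \<Rightarrow> (real \<Rightarrow> real \<Rightarrow> real) \<Rightarrow> real" where
  "mean2 e f = integral {0..e} (\<lambda>u. integral {0..e} (f u)) / e\<^sup>2"

lemma continuous_on_section:
  fixes f :: "'a::topological_space \<Rightarrow> 'b::topological_space \<Rightarrow> 'c::topological_space"
  assumes "continuous_on UNIV (\<lambda>(u, v). f u v)"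
  shows "continuous_on S (f u)"
proof -
  have "continuous_on S ((\<lambda>(u, v). f u v) \<circ> (\<lambda>v. (u, v)))"
    by (intro continuous_on_compose continuous_on_subset[OF assms] continuous_intros) auto
  then show ?thesis by (simp add: o_def)
qed

lemma mean2_integrable:
  fixes f :: "real \<Rightarrow> real \<Rightarrow> real"
  assumes "continuous_on UNIV (\<lambda>(u, v). f u v)"
  shows "f u integrable_on {0..e::real}" "(\<lambda>u. integral {0..e} (f u)) integrable_on {0..e::real}"
  using continuous_on_section[OF assms] continuous_on_subset[OF continuous_on_sliding_integral[OF assms]]
  by (auto intro: integrable_continuous_real)

lemma mean2_diff:
  fixes f g :: "real \<Rightarrow> real \<Rightarrow> real"
  assumes "continuous_on UNIV (\<lambda>(u, v). f u v)" "continuous_on UNIV (\<lambda>(u, v). g u v)"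
  shows "mean2 e (\<lambda>u v. f u v - g u v) = mean2 e f - mean2 e g"
  by (simp add: mean2_def integral_diff mean2_integrable[OF assms(1)] mean2_integrable[OF assms(2)]
      diff_divide_distrib)

lemma mean2_bound:
  fixes f :: "real \<Rightarrow> real \<Rightarrow> real"
  assumes f: "continuous_on UNIV (\<lambda>(u, v). f u v)" and "0 < e"
    and le: "\<And>u v. u \<in> {0..e} \<Longrightarrow> v \<in> {0..e} \<Longrightarrow> \<bar>f u v\<bar> \<le> C"
  shows "\<bar>mean2 e f\<bar> \<le> C"
proof -
  have "norm (integral {0..e} (f u)) \<le> C * (e - 0)" if "u \<in> {0..e}" for u
    using continuous_on_section[OF f] le that \<open>0 < e\<close> by (intro integral_bound) auto
  moreover have "continuous_on {0..e} (\<lambda>u. integral {0..e} (f u))"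
    using continuous_on_sliding_integral[OF f] continuous_on_subset by blast
  ultimately have "norm (integral {0..e} (\<lambda>u. integral {0..e} (f u))) \<le> C * e * (e - 0)"
    using \<open>0 < e\<close> by (intro integral_bound) auto
  then show ?thesis
    using \<open>0 < e\<close> by (simp add: mean2_def divide_le_eq power2_eq_square mult.assoc)
qed

lemma mean2_const: "0 < e \<Longrightarrow> mean2 e (\<lambda>u v. c) = c"
  by (simp add: mean2_def power2_eq_square)

text \<open>The window extends forward only. For \<open>e \<le> 1\<close> and arguments in
  \<open>{a..b}\<close> it stays inside \<open>{a..b + 1}\<close>, hence the larger interval in the
  bounds on G.\<close>

definition steklov :: "real \<Rightarrow> (real \<Rightarrow> real \<Rightarrow> real) \<Rightarrow> real \<Rightarrow> real \<Rightarrow> real" where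
  "steklov e G s r = mean2 e (\<lambda>u v. G (s + u) (r + v))"

lemma continuous_on_compose_pair:
  fixes G :: "real \<Rightarrow> real \<Rightarrow> real"
  assumes "continuous_on UNIV (\<lambda>(s, r). G s r)" "continuous_on S p" "continuous_on S q"
  shows "continuous_on S (\<lambda>x. G (p x) (q x))"
proof -
  have "continuous_on S ((\<lambda>(s, r). G s r) \<circ> (\<lambda>x. (p x, q x)))"
    by (intro continuous_on_compose continuous_on_subset[OF assms(1)] continuous_on_Pair assms) auto
  then show ?thesis by (simp add: o_def)
qed

lemma continuous_on_shift2:
  fixes G :: "real \<Rightarrow> real \<Rightarrow> real"
  assumes "continuous_on UNIV (\<lambda>(s, r). G s r)"
  shows "continuous_on UNIV (\<lambda>(u, v). G (s + u) (r + v))"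
  unfolding case_prod_beta' by (intro continuous_on_compose_pair[OF assms] continuous_intros)

text \<open>Each variable of averaging yields one derivative: g is a difference in s of the averages
  N over r, and h is a rectangular increment of G, both divided by \<open>e\<^sup>2\<close>. Their
  continuity is inherited from G.\<close>

lemma steklov_C2:
  fixes G :: "real \<Rightarrow> real \<Rightarrow> real"
  assumes G: "continuous_on UNIV (\<lambda>(s, r). G s r)" and "0 < e"
  obtains g h where
    "\<And>s r. ((\<lambda>s. steklov e G s r) has_real_derivative g s r) (at s)"
    "\<And>s r. (g s has_real_derivative h s r) (at r)"
    "continuous_on UNIV (\<lambda>(s, r). g s r)" "continuous_on UNIV (\<lambda>(s, r). h s r)"
    "continuous_on UNIV (\<lambda>(s, r). steklov e G s r)"
proof
  define N where "N x r = integral {0..e} (\<lambda>v. G x (r + v))" for x r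
  have N: "continuous_on UNIV (\<lambda>(x, r). N x r)"
  proof -
    have "continuous_on UNIV (\<lambda>p. integral {0..e} (\<lambda>v. G (fst p) (snd p + v)))"
      by (intro continuous_on_sliding_integral, unfold case_prod_beta')
        (intro continuous_on_compose_pair[OF G] continuous_intros)
    then show ?thesis by (simp add: N_def case_prod_beta')
  qed
  have st: "steklov e G s r = integral {0..e} (\<lambda>u. N (s + u) r) / e\<^sup>2" for s r
    by (simp add: steklov_def mean2_def N_def)
  define g where "g s r = (N (s + e) r - N s r) / e\<^sup>2" for s r
  define h where "h s r = ((G (s + e) (r + e) - G (s + e) r) - (G s (r + e) - G s r)) / e\<^sup>2" for s r
  have c: "continuous_on UNIV (\<lambda>x. N x r)" for r
    by (intro continuous_on_compose_pair[OF N] continuous_intros)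
  show "((\<lambda>s. steklov e G s r) has_real_derivative g s r) (at s)" for s r
    unfolding st g_def using \<open>0 < e\<close>
    by (intro DERIV_cdivide sliding_integral_derivative[OF c]) auto
  have Nd: "(N s has_real_derivative G s (r + e) - G s r) (at r)" for s r
    unfolding N_def[abs_def] using \<open>0 < e\<close>
    by (intro sliding_integral_derivative continuous_on_section[OF G]) auto
  show "(g s has_real_derivative h s r) (at r)" for s r
    unfolding g_def[abs_def] h_def by (intro DERIV_cdivide DERIV_diff Nd)
  show "continuous_on UNIV (\<lambda>(s, r). g s r)"
    unfolding g_def case_prod_beta' using \<open>0 < e\<close>
    by (intro continuous_intros continuous_on_compose_pair[OF N]) auto
  show "continuous_on UNIV (\<lambda>(s, r). h s r)"
    unfolding h_def case_prod_beta' using \<open>0 < e\<close>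
    by (intro continuous_intros continuous_on_compose_pair[OF G]) auto
  have "continuous_on UNIV (\<lambda>p. integral {0..e} (\<lambda>u. N (fst p + u) (snd p)))"
    by (intro continuous_on_sliding_integral, unfold case_prod_beta')
      (intro continuous_on_compose_pair[OF N] continuous_intros)
  then show "continuous_on UNIV (\<lambda>(s, r). steklov e G s r)"
    unfolding st case_prod_beta' using \<open>0 < e\<close> by (intro continuous_intros) auto
qed

section \<open>Stability of the mixed bounds under averaging\<close>

lemma mixed_holder_mono:
  assumes "mixed_holder \<tau> \<mu> a' b' A B G" "a' \<le> a" "b \<le> b'"
  shows "mixed_holder \<tau> \<mu> a b A B G"
  using assms unfolding mixed_holder_def by auto

text \<open>A common shift does not change the distances between the arguments, so every increment
  under the mean obeys the bound of G. This gives the same A and B for every e, as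
  \<open>weyl_int_tendsto\<close> demands.\<close>

lemma mixed_holder_steklov:
  assumes G: "mixed_holder \<tau> \<mu> a (b + 1) A B G" and cont: "continuous_on UNIV (\<lambda>(s, r). G s r)"
    and e: "0 < e" "e \<le> 1"
  shows "mixed_holder \<tau> \<mu> a b A B (steklov e G)"
  unfolding mixed_holder_def
proof (intro conjI ballI)
  note c = continuous_on_shift2[OF cont]
  have cd: "continuous_on UNIV (\<lambda>(u, v). G (s + u) (r + v) - G (t + u) (r + v))" for s t r
    using continuous_on_diff[OF c c] by (simp add: case_prod_beta')
  have cd2: "continuous_on UNIV (\<lambda>(u, v). (G (s + u) (r + v) - G (t + u) (r + v)) - (G (s + u) (r' + v) - G (t + u) (r' + v)))"
    for s t r r'
    using continuous_on_diff[OF cd cd] by (simp add: case_prod_beta')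
  show "0 \<le> A" "0 \<le> B" using G by (auto simp: mixed_holder_def)
  show "(\<lambda>(s, r). steklov e G s r) \<in> borel_measurable (borel \<Otimes>\<^sub>M borel)"
  proof (rule steklov_C2[OF cont e(1)])
    assume "continuous_on UNIV (\<lambda>(s, r). steklov e G s r)"
    from borel_measurable_continuous_onI[OF this] show ?thesis by (simp add: borel_prod)
  qed
  fix s t r assume s: "s \<in> {a..b}" "t \<in> {a..b}" "r \<in> {a..b}"
  have d: "steklov e G s r - steklov e G t r = mean2 e (\<lambda>u v. G (s + u) (r + v) - G (t + u) (r + v))" for r
    unfolding steklov_def by (rule mean2_diff[OF c c, symmetric])
  show "\<bar>steklov e G s r - steklov e G t r\<bar> \<le> A * \<bar>s - t\<bar> powr \<tau>"
    unfolding d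
  proof (rule mean2_bound[OF cd e(1)])
    fix u v assume u: "u \<in> {0..e}" "v \<in> {0..e}"
    have "\<bar>G (s + u) (r + v) - G (t + u) (r + v)\<bar> \<le> A * \<bar>(s + u) - (t + u)\<bar> powr \<tau>"
    proof -
      have "s + u \<in> {a..b+1}" "t + u \<in> {a..b+1}" "r + v \<in> {a..b+1}"
        using s u e by auto
      then show ?thesis using G unfolding mixed_holder_def by blast
    qed
    then show "\<bar>G (s + u) (r + v) - G (t + u) (r + v)\<bar> \<le> A * \<bar>s - t\<bar> powr \<tau>" by simp
  qed
  fix r' assume r': "r' \<in> {a..b}"
  have "steklov e G s r - steklov e G t r - steklov e G s r' + steklov e G t r' =
      (steklov e G s r - steklov e G t r) - (steklov e G s r' - steklov e G t r')" by simp
  also have "\<dots> = mean2 e (\<lambda>u v. (G (s + u) (r + v) - G (t + u) (r + v)) - (G (s + u) (r' + v) - G (t + u) (r' + v)))"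
    unfolding d by (rule mean2_diff[OF cd cd, symmetric])
  also have "\<bar>\<dots>\<bar> \<le> B * \<bar>s - t\<bar> powr \<tau> * \<bar>r - r'\<bar> powr \<mu>"
  proof (rule mean2_bound[OF cd2 e(1)])
    fix u v assume u: "u \<in> {0..e}" "v \<in> {0..e}"
    have "s + u \<in> {a..b+1}" "t + u \<in> {a..b+1}" "r + v \<in> {a..b+1}" "r' + v \<in> {a..b+1}"
      using s r' u e by auto
    then have "\<bar>G (s + u) (r + v) - G (t + u) (r + v) - G (s + u) (r' + v) + G (t + u) (r' + v)\<bar>
      \<le> B * \<bar>(s + u) - (t + u)\<bar> powr \<tau> * \<bar>(r + v) - (r' + v)\<bar> powr \<mu>"
      using G unfolding mixed_holder_def by blast
    then show "\<bar>(G (s + u) (r + v) - G (t + u) (r + v)) - (G (s + u) (r' + v) - G (t + u) (r' + v))\<bar>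
      \<le> B * \<bar>s - t\<bar> powr \<tau> * \<bar>r - r'\<bar> powr \<mu>" by (simp add: algebra_simps)
  qed
  finally show "\<bar>steklov e G s r - steklov e G t r - steklov e G s r' + steklov e G t r'\<bar>
    \<le> B * \<bar>s - t\<bar> powr \<tau> * \<bar>r - r'\<bar> powr \<mu>" .
qed

lemma steklov_tendsto:
  fixes G :: "real \<Rightarrow> real \<Rightarrow> real"
  assumes cont: "continuous_on UNIV (\<lambda>(s, r). G s r)"
    and e: "\<And>n. 0 < e n" "e \<longlonglongrightarrow> 0"
  shows "(\<lambda>n. steklov (e n) G s r) \<longlonglongrightarrow> G s r"
proof (rule LIMSEQ_I)
  fix \<epsilon> :: real assume "0 < \<epsilon>"
  have "isCont (\<lambda>(s, r). G s r) (s, r)"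
    using cont by (simp add: continuous_on_eq_continuous_at)
  then obtain \<delta> where \<delta>: "\<delta> > 0" "\<And>p. dist p (s, r) < \<delta> \<Longrightarrow> dist ((\<lambda>(s, r). G s r) p) (G s r) < \<epsilon> / 2"
    unfolding continuous_at_eps_delta using \<open>0 < \<epsilon>\<close> by (metis case_prod_conv half_gt_zero)
  have "eventually (\<lambda>n. e n < \<delta> / 2) sequentially"
    using e(2) \<delta>(1) by (intro order_tendstoD) auto
  then obtain n0 where n0: "\<And>n. n \<ge> n0 \<Longrightarrow> e n < \<delta> / 2"
    unfolding eventually_sequentially by blast
  show "\<exists>n0. \<forall>n\<ge>n0. norm (steklov (e n) G s r - G s r) < \<epsilon>"
  proof (intro exI allI impI)
    fix n assume "n0 \<le> n"
    then have n: "e n < \<delta> / 2" by (rule n0)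
    have k: "continuous_on UNIV (\<lambda>(u, v). G s r)" by (simp add: case_prod_beta')
    have "steklov (e n) G s r - G s r = mean2 (e n) (\<lambda>u v. G (s + u) (r + v)) - mean2 (e n) (\<lambda>u v. G s r)"
      using e(1) by (simp add: steklov_def mean2_const)
    also have "\<dots> = mean2 (e n) (\<lambda>u v. G (s + u) (r + v) - G s r)"
      by (rule mean2_diff[OF continuous_on_shift2[OF cont] k, symmetric])
    also have "\<bar>\<dots>\<bar> \<le> \<epsilon> / 2"
    proof (rule mean2_bound[OF _ e(1)])
      show "continuous_on UNIV (\<lambda>(u, v). G (s + u) (r + v) - G s r)"
        using continuous_on_diff[OF continuous_on_shift2[OF cont] k] by (simp add: case_prod_beta')
      fix u v assume u: "u \<in> {0..e n}" "v \<in> {0..e n}"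
      have "dist (s + u, r + v) (s, r) \<le> \<bar>u\<bar> + \<bar>v\<bar>"
        using sqrt_sum_squares_le_sum_abs[of u v] by (simp add: dist_Pair_Pair dist_real_def)
      also have "\<dots> < \<delta>" using u n by auto
      finally show "\<bar>G (s + u) (r + v) - G s r\<bar> \<le> \<epsilon> / 2"
        using \<delta>(2) by (fastforce simp: dist_real_def)
    qed
    finally show "norm (steklov (e n) G s r - G s r) < \<epsilon>" using \<open>0 < \<epsilon>\<close> by simp
  qed
qed

text \<open>For both orders the normalised value is the limit of one and the same sequence, attached
  to the averages of G.\<close>

lemma weyl_int_independent:
  assumes "weyl_exponents a b \<alpha> \<tau> \<mu>" "weyl_exponents a b \<alpha>' \<tau> \<mu>"
    and G: "mixed_holder \<tau> \<mu> a (b + 1) A B G" and cont: "continuous_on UNIV (\<lambda>(s, r). G s r)"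
  shows "weyl_int \<alpha> a b G / (Gamma \<alpha> * Gamma (1 - \<alpha>)) = weyl_int \<alpha>' a b G / (Gamma \<alpha>' * Gamma (1 - \<alpha>'))"
proof -
  define e where "e n = inverse (real (Suc n))" for n
  have e: "0 < e n" "e n \<le> 1" for n
    by (auto simp: e_def inverse_le_1_iff)
  have e0: "e \<longlonglongrightarrow> 0" unfolding e_def by (rule LIMSEQ_inverse_real_of_nat)
  \<comment> \<open>J is chosen before \<beta>: its value, minus the diagonal integral of g, depends
    only on n.\<close>
  have "\<exists>J. \<forall>n. \<forall>\<beta>. weyl_exponents a b \<beta> \<tau> \<mu> \<longrightarrow>
      weyl_int \<beta> a b (steklov (e n) G) / (Gamma \<beta> * Gamma (1 - \<beta>)) = J n"
  proof (rule choice, rule allI)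
    fix n
    obtain g h where gh:
      "\<And>s r. ((\<lambda>s. steklov (e n) G s r) has_real_derivative g s r) (at s)"
      "\<And>s r. (g s has_real_derivative h s r) (at r)"
      "continuous_on UNIV (\<lambda>(s, r). g s r)" "continuous_on UNIV (\<lambda>(s, r). h s r)"
      by (rule steklov_C2[OF cont e(1), of n]) blast
    show "\<exists>J. \<forall>\<beta>. weyl_exponents a b \<beta> \<tau> \<mu> \<longrightarrow>
      weyl_int \<beta> a b (steklov (e n) G) / (Gamma \<beta> * Gamma (1 - \<beta>)) = J"
    proof (intro exI allI impI)
      fix \<beta> assume "weyl_exponents a b \<beta> \<tau> \<mu>"
      then interpret weyl_exponents a b \<beta> \<tau> \<mu> .
      have "Gamma \<beta> > 0" "Gamma (1 - \<beta>) > 0" using alpha by (auto intro: Gamma_real_pos)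
      then show "weyl_int \<beta> a b (steklov (e n) G) / (Gamma \<beta> * Gamma (1 - \<beta>)) = - (LBINT s:{a..b}. g s s)"
        using weyl_int_C2[OF gh alpha(1,2) ab] by simp
    qed
  qed
  then obtain J where J: "\<And>n \<beta>. weyl_exponents a b \<beta> \<tau> \<mu> \<Longrightarrow>
      weyl_int \<beta> a b (steklov (e n) G) / (Gamma \<beta> * Gamma (1 - \<beta>)) = J n" by blast
  have lim: "J \<longlonglongrightarrow> weyl_int \<beta> a b G / (Gamma \<beta> * Gamma (1 - \<beta>))" if "weyl_exponents a b \<beta> \<tau> \<mu>" for \<beta>
  proof -
    interpret weyl_exponents a b \<beta> \<tau> \<mu> by fact
    have pos: "Gamma \<beta> > 0" "Gamma (1 - \<beta>) > 0" using alpha by (auto intro: Gamma_real_pos)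
    have "(\<lambda>n. weyl_int \<beta> a b (steklov (e n) G) / (Gamma \<beta> * Gamma (1 - \<beta>)))
        \<longlonglongrightarrow> weyl_int \<beta> a b G / (Gamma \<beta> * Gamma (1 - \<beta>))"
      using pos mixed_holder_steklov[OF G cont e] mixed_holder_mono[OF G]
      by (intro tendsto_divide tendsto_const weyl_int_tendsto steklov_tendsto[OF cont e(1) e0]) auto
    then show ?thesis using J[OF that] by simp
  qed
  show ?thesis using lim[OF assms(1)] lim[OF assms(2)] by (rule LIMSEQ_unique)
qed

section \<open>The four integrals of the expanded formula\<close>

context weyl_exponents
begin

text \<open>Splitting the integral of \<open>inner_deriv\<close> needs integrability of each summand
  separately. This is the common condition under which the left derivative of such a summand can be
  taken and integrated termwise.\<close>

definition outer_regular :: "(real \<Rightarrow> real \<Rightarrow> real) \<Rightarrow> real \<Rightarrow> real \<Rightarrow> bool" where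
  "outer_regular P C D \<longleftrightarrow> (\<lambda>(t, r). P t r) \<in> borel_measurable (borel \<Otimes>\<^sub>M borel) \<and> 0 \<le> C \<and>
    (\<forall>t\<in>{a..b}. \<forall>r\<in>{a..b}. \<bar>P t r\<bar> \<le> D) \<and>
    (\<forall>t\<in>{a..b}. \<forall>r\<in>{a..b}. \<forall>r'\<in>{a..b}. \<bar>P t r - P t r'\<bar> \<le> C * \<bar>r - r'\<bar> powr \<mu>)"

lemma outer_regular_integrable:
  assumes P: "outer_regular P C D"
  shows "set_integrable lborel {a..b} (\<lambda>t. P t t / (t - a) powr \<alpha>)"
    and "\<And>t. t \<in> {a..b} \<Longrightarrow> set_integrable lborel {a..t} (\<lambda>r. (P t t - P t r) / (t - r) powr (\<alpha> + 1))"
    and "set_integrable lborel {a..b} (\<lambda>t. LBINT r:{a..t}. (P t t - P t r) / (t - r) powr (\<alpha> + 1))"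
proof -
  have meas: "(\<lambda>(t, r). P t r) \<in> borel_measurable (borel \<Otimes>\<^sub>M borel)"
    using P by (simp add: outer_regular_def)
  have C: "0 \<le> C" using P by (simp add: outer_regular_def)
  have sec: "P t \<in> borel_measurable borel" for t
    using measurable_section(2)[OF meas] .
  have [measurable]: "(\<lambda>t. P t t) \<in> borel_measurable borel"
    using measurable_compose[OF measurable_Pair[OF measurable_ident_sets measurable_ident_sets] meas] by simp
  have diag_meas: "(\<lambda>t. P t t / (t - a) powr \<alpha>) \<in> borel_measurable borel" by measurable
  have diag_le: "\<bar>P t t / (t - a) powr \<alpha>\<bar> \<le> D * (t - a) powr (- \<alpha>) + 0" if "t \<in> {a..b}" for t
    using P that unfolding outer_regular_def
    by (simp add: powr_minus divide_inverse abs_mult mult_right_mono)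
  show "set_integrable lborel {a..b} (\<lambda>t. P t t / (t - a) powr \<alpha>)"
    by (rule set_integrable_dominated(1)[OF outer_bound_integrable(1) diag_meas _ diag_le]) auto
  have hol: "\<bar>P t t - P t r\<bar> \<le> C * (t - r) powr \<mu>" if "t \<in> {a..b}" "r \<in> {a..t}" for t r
  proof -
    have "r \<in> {a..b}" "\<bar>t - r\<bar> = t - r" using that by auto
    then show ?thesis using P that(1) unfolding outer_regular_def by metis
  qed
  show "set_integrable lborel {a..t} (\<lambda>r. (P t t - P t r) / (t - r) powr (\<alpha> + 1))" if "t \<in> {a..b}" for t
    using that alpha hol by (intro left_kernel_integrable(1)[OF sec, where \<mu>=\<mu> and C=C]) auto
  show "set_integrable lborel {a..b} (\<lambda>t. LBINT r:{a..t}. (P t t - P t r) / (t - r) powr (\<alpha> + 1))"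
  proof (rule set_integrable_dominated(1)[OF outer_bound_integrable(1)])
    \<comment> \<open>Measurability of the bare kernel integral is recovered from that of
      \<open>left_deriv\<close> by solving for it, as \<alpha> > 0.\<close>
    have "(\<lambda>t. LBINT r:{a..t}. (P t t - P t r) / (t - r) powr (\<alpha> + 1)) =
        (\<lambda>t. (left_deriv \<alpha> a (P t) t - P t t / (t - a) powr \<alpha>) / \<alpha>)"
      using alpha by (auto simp: left_deriv_def)
    also have "\<dots> \<in> borel_measurable borel"
      using measurable_left_deriv[OF meas, of "\<lambda>t. t"] by measurable
    finally show "(\<lambda>t. LBINT r:{a..t}. (P t t - P t r) / (t - r) powr (\<alpha> + 1)) \<in> borel_measurable borel" .
    show "\<bar>LBINT r:{a..t}. (P t t - P t r) / (t - r) powr (\<alpha> + 1)\<bar>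
        \<le> 0 * (t - a) powr (- \<alpha>) + C * ((b - a) powr (\<mu> - \<alpha>) / (\<mu> - \<alpha>))" if t: "t \<in> {a..b}" for t
    proof -
      have "\<bar>LBINT r:{a..t}. (P t t - P t r) / (t - r) powr (\<alpha> + 1)\<bar> \<le> C * ((t - a) powr (\<mu> - \<alpha>) / (\<mu> - \<alpha>))"
        using t alpha hol by (intro left_kernel_integrable(2)[OF sec]) auto
      also have "\<dots> \<le> C * ((b - a) powr (\<mu> - \<alpha>) / (\<mu> - \<alpha>))"
        using t alpha C by (intro mult_left_mono divide_right_mono powr_mono2) auto
      finally show ?thesis by simp
    qed
  qed auto
qed

lemma left_deriv_add:
  assumes "set_integrable lborel {a..t} (\<lambda>r. (f t - f r) / (t - r) powr (\<alpha> + 1))"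
    and "set_integrable lborel {a..t} (\<lambda>r. (g t - g r) / (t - r) powr (\<alpha> + 1))"
  shows "left_deriv \<alpha> a (\<lambda>r. f r + c * g r) t = left_deriv \<alpha> a f t + c * left_deriv \<alpha> a g t"
proof -
  have i: "set_integrable lborel {a..t} (\<lambda>r. c * ((g t - g r) / (t - r) powr (\<alpha> + 1)))"
    by (intro set_integrable_mult_right assms(2))
  have "(LBINT r:{a..t}. ((f t + c * g t) - (f r + c * g r)) / (t - r) powr (\<alpha> + 1)) =
      (LBINT r:{a..t}. (f t - f r) / (t - r) powr (\<alpha> + 1) + c * ((g t - g r) / (t - r) powr (\<alpha> + 1)))"
    by (intro set_lebesgue_integral_cong) (auto simp: add_divide_distrib diff_divide_distrib right_diff_distrib)
  also have "\<dots> = (LBINT r:{a..t}. (f t - f r) / (t - r) powr (\<alpha> + 1)) +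
      c * (LBINT r:{a..t}. (g t - g r) / (t - r) powr (\<alpha> + 1))"
    by (simp only: set_integral_add(2)[OF assms(1) i] set_integral_mult_right)
  finally have e: "(LBINT r:{a..t}. ((f t + c * g t) - (f r + c * g r)) / (t - r) powr (\<alpha> + 1)) = \<dots>" .
  have "(x + c * y) / p + \<alpha> * (l + c * m) = (x / p + \<alpha> * l) + c * (y / p + \<alpha> * m)" for x y p l m :: real
    by (simp add: add_divide_distrib algebra_simps)
  then show ?thesis unfolding left_deriv_def e .
qed

text \<open>The two summands of \<open>inner_deriv\<close> treated separately give the four integrals of the
  expanded formula.\<close>

definition boundary_part :: "(real \<Rightarrow> real \<Rightarrow> real) \<Rightarrow> real \<Rightarrow> real \<Rightarrow> real" where
  "boundary_part G t r = (G t r - G b r) / (b - t) powr (1 - \<alpha>)"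

definition integral_part :: "(real \<Rightarrow> real \<Rightarrow> real) \<Rightarrow> real \<Rightarrow> real \<Rightarrow> real" where
  "integral_part G t r = (LBINT s:{t..b}. (G t r - G s r) / (s - t) powr (1 - \<alpha> + 1))"

lemma inner_deriv_parts: "inner_deriv \<alpha> b G t r = boundary_part G t r + (1 - \<alpha>) * integral_part G t r"
  by (simp add: inner_deriv_def right_deriv_def boundary_part_def integral_part_def)

lemma outer_regular_boundary:
  assumes G: "mixed_holder \<tau> \<mu> a b A B G"
  shows "outer_regular (boundary_part G) (B * (b - a) powr (\<tau> - (1 - \<alpha>))) (A * (b - a) powr (\<tau> - (1 - \<alpha>)))"
proof -
  have q: "\<bar>x / (b - t) powr (1 - \<alpha>)\<bar> \<le> C * (b - a) powr (\<tau> - (1 - \<alpha>))"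
    if "\<bar>x\<bar> \<le> C * (b - t) powr \<tau>" "t \<in> {a..b}" "0 \<le> C" for x C t
  proof -
    have "\<bar>x / (b - t) powr (1 - \<alpha>)\<bar> \<le> C * (b - t) powr (\<tau> - (1 - \<alpha>))"
      \<comment> \<open>The order \<open>- \<alpha>\<close> turns the exponent of the denominator
        into 1 - \<alpha>.\<close>
      using singular_quotient_le[of "b - t" x C \<tau> "- \<alpha>"] that by (simp add: algebra_simps)
    also have "\<dots> \<le> C * (b - a) powr (\<tau> - (1 - \<alpha>))"
      using that alpha by (intro mult_left_mono powr_mono2) auto
    finally show ?thesis .
  qed
  have AB: "0 \<le> A" "0 \<le> B" using G by (auto simp: mixed_holder_def)
  note m = mixed_holder_measurable[OF G]
  have "\<bar>boundary_part G t r\<bar> \<le> A * (b - a) powr (\<tau> - (1 - \<alpha>))" if "t \<in> {a..b}" "r \<in> {a..b}" for t r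
    unfolding boundary_part_def using mixed_holder_le(1)[OF G that(1) _ that(2), of b] that AB by (intro q) auto
  moreover have "\<bar>boundary_part G t r - boundary_part G t r'\<bar> \<le> B * (b - a) powr (\<tau> - (1 - \<alpha>)) * \<bar>r - r'\<bar> powr \<mu>"
    if "t \<in> {a..b}" "r \<in> {a..b}" "r' \<in> {a..b}" for t r r'
  proof -
    have "\<bar>G t r - G b r - G t r' + G b r'\<bar> \<le> B * \<bar>r - r'\<bar> powr \<mu> * (b - t) powr \<tau>"
      using mixed_holder_le(2)[OF G that(1) _ that(2,3), of b] that by (simp add: mult_ac)
    from q[OF this that(1)] AB
    show ?thesis by (simp add: boundary_part_def mult_ac diff_divide_distrib[symmetric] algebra_simps)
  qed
  moreover have "(\<lambda>(t, r). boundary_part G t r) \<in> borel_measurable (borel \<Otimes>\<^sub>M borel)"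
  proof -
    have [measurable]: "(\<lambda>r. G b r) \<in> borel_measurable borel" using measurable_section(2)[OF m] .
    have [measurable]: "(\<lambda>p. G (fst p) (snd p)) \<in> borel_measurable (borel \<Otimes>\<^sub>M borel)"
      using m by (simp add: case_prod_beta')
    show ?thesis unfolding boundary_part_def case_prod_beta' by measurable
  qed
  ultimately show ?thesis using AB by (auto simp: outer_regular_def)
qed

text \<open>No new estimate is needed: \<open>integral_part\<close> is the difference of
  \<open>inner_deriv\<close> and \<open>boundary_part\<close>, both already bounded, divided by 1 -
  \<alpha>.\<close>

lemma outer_regular_integral_part:
  assumes G: "mixed_holder \<tau> \<mu> a b A B G"
  shows "\<exists>C D. outer_regular (integral_part G) C D"
proof -
  define E where "E = (b - a) powr (\<tau> - (1 - \<alpha>))"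
  have AB: "0 \<le> A" "0 \<le> B" using G by (auto simp: mixed_holder_def)
  have bd: "outer_regular (boundary_part G) (B * E) (A * E)"
    unfolding E_def by (rule outer_regular_boundary[OF G])
  have e: "integral_part G t r = (inner_deriv \<alpha> b G t r - boundary_part G t r) / (1 - \<alpha>)" for t r
    using alpha by (simp add: inner_deriv_parts)
  have "\<bar>integral_part G t r\<bar> \<le> (A * c1 * E + A * E) / (1 - \<alpha>)" if "t \<in> {a..b}" "r \<in> {a..b}" for t r
  proof -
    have "\<bar>inner_deriv \<alpha> b G t r\<bar> \<le> A * c1 * E" unfolding E_def by (rule inner_deriv_bound[OF G that])
    moreover have "\<bar>boundary_part G t r\<bar> \<le> A * E" using bd that by (simp add: outer_regular_def)
    ultimately have "\<bar>inner_deriv \<alpha> b G t r - boundary_part G t r\<bar> \<le> A * c1 * E + A * E" by linarith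
    then show ?thesis unfolding e using alpha by (simp add: divide_right_mono)
  qed
  moreover have "\<bar>integral_part G t r - integral_part G t r'\<bar> \<le> (B * c1 * E + B * E) / (1 - \<alpha>) * \<bar>r - r'\<bar> powr \<mu>"
    if "t \<in> {a..b}" "r \<in> {a..b}" "r' \<in> {a..b}" for t r r'
  proof -
    have "\<bar>inner_deriv \<alpha> b G t r - inner_deriv \<alpha> b G t r'\<bar> \<le> B * c1 * E * \<bar>r - r'\<bar> powr \<mu>"
      unfolding E_def by (rule inner_deriv_diff[OF G that])
    moreover have "\<bar>boundary_part G t r - boundary_part G t r'\<bar> \<le> B * E * \<bar>r - r'\<bar> powr \<mu>"
      using bd that by (simp add: outer_regular_def)
    ultimately have "\<bar>(inner_deriv \<alpha> b G t r - boundary_part G t r) - (inner_deriv \<alpha> b G t r' - boundary_part G t r')\<bar>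
        \<le> (B * c1 * E + B * E) * \<bar>r - r'\<bar> powr \<mu>" by (simp add: distrib_right)
    then show ?thesis unfolding e using alpha by (simp add: divide_right_mono flip: diff_divide_distrib)
  qed
  moreover have "(\<lambda>(t, r). integral_part G t r) \<in> borel_measurable (borel \<Otimes>\<^sub>M borel)"
  proof -
    have [measurable]: "(\<lambda>p. boundary_part G (fst p) (snd p)) \<in> borel_measurable (borel \<Otimes>\<^sub>M borel)"
      using bd by (simp add: case_prod_beta' outer_regular_def)
    have [measurable]: "(\<lambda>p. inner_deriv \<alpha> b G (fst p) (snd p)) \<in> borel_measurable (borel \<Otimes>\<^sub>M borel)"
      using measurable_inner_deriv[OF mixed_holder_measurable[OF G]] by (simp add: case_prod_beta')
    show ?thesis unfolding e case_prod_beta' by measurable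
  qed
  moreover have "0 \<le> (B * c1 * E + B * E) / (1 - \<alpha>)"
    using AB alpha c1_pos by (simp add: E_def)
  ultimately show ?thesis unfolding outer_regular_def by blast
qed

text \<open>The number c stands for the outer factor, \<open>(t - a) powr \<alpha>\<close> or
  \<open>(t - r) powr (\<alpha> + 1)\<close>, which is constant in s. It may be 0, namely at
  \<open>t = a\<close> or \<open>r = t\<close>; both sides are then 0.\<close>

lemma integral_part_double:
  assumes G: "mixed_holder \<tau> \<mu> a b A B G" and t: "t \<in> {a..b}" "r \<in> {a..b}"
  shows "set_integrable lborel {t..b} (\<lambda>s. (G t r - G s r) / ((s - t) powr (2 - \<alpha>) * c))"
    and "(LBINT s:{t..b}. (G t r - G s r) / ((s - t) powr (2 - \<alpha>) * c)) = integral_part G t r / c"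
    and "set_integrable lborel {t..b} (\<lambda>s. (G t t - G s t - G t r + G s r) / ((s - t) powr (2 - \<alpha>) * c))"
    and "(LBINT s:{t..b}. (G t t - G s t - G t r + G s r) / ((s - t) powr (2 - \<alpha>) * c)) =
      (integral_part G t t - integral_part G t r) / c"
proof -
  have p: "1 - \<alpha> + 1 = 2 - \<alpha>" by simp
  have i: "set_integrable lborel {t..b} (\<lambda>s. (G t r - G s r) / (s - t) powr (2 - \<alpha>))" if "r \<in> {a..b}" for r
    using inner_kernel_integrable[OF G t(1) that] unfolding p .
  have 1: "(\<lambda>s. (G t r - G s r) / ((s - t) powr (2 - \<alpha>) * c)) = (\<lambda>s. (1 / c) * ((G t r - G s r) / (s - t) powr (2 - \<alpha>)))"
    by (simp add: mult.commute)
  have 2: "(\<lambda>s. (G t t - G s t - G t r + G s r) / ((s - t) powr (2 - \<alpha>) * c)) =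
      (\<lambda>s. (1 / c) * ((G t t - G s t) / (s - t) powr (2 - \<alpha>) - (G t r - G s r) / (s - t) powr (2 - \<alpha>)))"
  proof -
    have "(x - y - z + w) / (p * c) = 1 / c * ((x - y) / p - (z - w) / p)" for x y z w p :: real
      by (cases "p = 0 \<or> c = 0") (auto simp: field_simps)
    then show ?thesis by blast
  qed
  note d = set_integral_diff[OF i[OF t(1)] i[OF t(2)]]
  show "set_integrable lborel {t..b} (\<lambda>s. (G t r - G s r) / ((s - t) powr (2 - \<alpha>) * c))"
    unfolding 1 by (rule set_integrable_mult_right) (rule i[OF t(2)])
  show "(LBINT s:{t..b}. (G t r - G s r) / ((s - t) powr (2 - \<alpha>) * c)) = integral_part G t r / c"
    unfolding 1 set_integral_mult_right integral_part_def p by simp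
  show "set_integrable lborel {t..b} (\<lambda>s. (G t t - G s t - G t r + G s r) / ((s - t) powr (2 - \<alpha>) * c))"
    unfolding 2 by (rule set_integrable_mult_right) (rule d(1))
  show "(LBINT s:{t..b}. (G t t - G s t - G t r + G s r) / ((s - t) powr (2 - \<alpha>) * c)) =
      (integral_part G t t - integral_part G t r) / c"
    unfolding 2 set_integral_mult_right d(2) integral_part_def p by simp
qed

text \<open>\<open>boundary_part\<close> produces \<open>f1\<close> and \<open>f2\<close>,
  \<open>integral_part\<close> produces \<open>f3\<close> and \<open>f4\<close>; within each pair
  the first is the boundary term of the left derivative and the second its kernel integral.\<close>

lemma weyl_int_expand:
  assumes G: "mixed_holder \<tau> \<mu> a b A B G"
  defines "f1 \<equiv> \<lambda>t. (G t t - G b t) / ((b - t) powr (1 - \<alpha>) * (t - a) powr \<alpha>)"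
    and "f2 \<equiv> \<lambda>t r. (G t t - G b t - (G t r - G b r)) / ((b - t) powr (1 - \<alpha>) * (t - r) powr (\<alpha> + 1))"
    and "f3 \<equiv> \<lambda>t s. (G t t - G s t) / ((s - t) powr (2 - \<alpha>) * (t - a) powr \<alpha>)"
    and "f4 \<equiv> \<lambda>t r s. (G t t - G s t - G t r + G s r) / ((s - t) powr (2 - \<alpha>) * (t - r) powr (\<alpha> + 1))"
  shows "set_integrable lborel {a..b} f1"
    and "\<And>t. t \<in> {a..b} \<Longrightarrow> set_integrable lborel {a..t} (f2 t)"
    and "set_integrable lborel {a..b} (\<lambda>t. LBINT r:{a..t}. f2 t r)"
    and "\<And>t. t \<in> {a..b} \<Longrightarrow> set_integrable lborel {t..b} (f3 t)"
    and "set_integrable lborel {a..b} (\<lambda>t. LBINT s:{t..b}. f3 t s)"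
    and "\<And>t r. t \<in> {a..b} \<Longrightarrow> r \<in> {a..b} \<Longrightarrow> set_integrable lborel {t..b} (f4 t r)"
    and "\<And>t. t \<in> {a..b} \<Longrightarrow> set_integrable lborel {a..t} (\<lambda>r. LBINT s:{t..b}. f4 t r s)"
    and "set_integrable lborel {a..b} (\<lambda>t. LBINT r:{a..t}. LBINT s:{t..b}. f4 t r s)"
    and "weyl_int \<alpha> a b G = (LBINT t:{a..b}. f1 t) + \<alpha> * (LBINT t:{a..b}. LBINT r:{a..t}. f2 t r)
      + (1 - \<alpha>) * (LBINT t:{a..b}. LBINT s:{t..b}. f3 t s)
      + \<alpha> * (1 - \<alpha>) * (LBINT t:{a..b}. LBINT r:{a..t}. LBINT s:{t..b}. f4 t r s)"
proof -
  let ?P = "boundary_part G" and ?Q = "integral_part G"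
  obtain C D where Q: "outer_regular ?Q C D" using outer_regular_integral_part[OF G] by blast
  note P_int = outer_regular_integrable[OF outer_regular_boundary[OF G]]
  note Q_int = outer_regular_integrable[OF Q]
  have f1: "f1 t = ?P t t / (t - a) powr \<alpha>" for t
    by (simp add: f1_def boundary_part_def)
  have f2: "f2 t r = (?P t t - ?P t r) / (t - r) powr (\<alpha> + 1)" for t r
    by (simp add: f2_def boundary_part_def flip: diff_divide_distrib)
  have f3: "(LBINT s:{t..b}. f3 t s) = ?Q t t / (t - a) powr \<alpha>" if "t \<in> {a..b}" for t
    unfolding f3_def by (rule integral_part_double(2)[OF G that that])
  have f4: "(LBINT s:{t..b}. f4 t r s) = (?Q t t - ?Q t r) / (t - r) powr (\<alpha> + 1)"
    if "t \<in> {a..b}" "r \<in> {a..b}" for t r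
    unfolding f4_def by (rule integral_part_double(4)[OF G that])
  have f4': "(LBINT r:{a..t}. LBINT s:{t..b}. f4 t r s) = (LBINT r:{a..t}. (?Q t t - ?Q t r) / (t - r) powr (\<alpha> + 1))"
    if "t \<in> {a..b}" for t
    using that by (intro set_lebesgue_integral_cong) (auto simp: f4)
  show 1: "set_integrable lborel {a..b} f1"
    unfolding f1[abs_def] by (rule P_int(1))
  show "set_integrable lborel {a..t} (f2 t)" if "t \<in> {a..b}" for t
    unfolding f2[abs_def] by (rule P_int(2)[OF that])
  show 2: "set_integrable lborel {a..b} (\<lambda>t. LBINT r:{a..t}. f2 t r)"
    unfolding f2[abs_def] by (rule P_int(3))
  show "set_integrable lborel {t..b} (f3 t)" if "t \<in> {a..b}" for t
    unfolding f3_def by (rule integral_part_double(1)[OF G that that])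
  show 3: "set_integrable lborel {a..b} (\<lambda>t. LBINT s:{t..b}. f3 t s)"
    using Q_int(1) by (rule set_integrable_cong[THEN iffD1, rotated -1]) (auto simp: f3)
  show "set_integrable lborel {t..b} (f4 t r)" if "t \<in> {a..b}" "r \<in> {a..b}" for t r
    unfolding f4_def by (rule integral_part_double(3)[OF G that])
  show "set_integrable lborel {a..t} (\<lambda>r. LBINT s:{t..b}. f4 t r s)" if "t \<in> {a..b}" for t
    using Q_int(2)[OF that] by (rule set_integrable_cong[THEN iffD1, rotated -1]) (use that in \<open>auto simp: f4\<close>)
  show 4: "set_integrable lborel {a..b} (\<lambda>t. LBINT r:{a..t}. LBINT s:{t..b}. f4 t r s)"
    using Q_int(3) by (rule set_integrable_cong[THEN iffD1, rotated -1]) (auto simp: f4')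
  have "left_deriv \<alpha> a (inner_deriv \<alpha> b G t) t =
      (f1 t + \<alpha> * (LBINT r:{a..t}. f2 t r)) +
      ((1 - \<alpha>) * (LBINT s:{t..b}. f3 t s) + \<alpha> * (1 - \<alpha>) * (LBINT r:{a..t}. LBINT s:{t..b}. f4 t r s))"
    if t: "t \<in> {a..b}" for t
  proof -
    have "left_deriv \<alpha> a (inner_deriv \<alpha> b G t) t = left_deriv \<alpha> a (?P t) t + (1 - \<alpha>) * left_deriv \<alpha> a (?Q t) t"
      using left_deriv_add[OF P_int(2)[OF t] Q_int(2)[OF t], of "1 - \<alpha>"] by (simp add: inner_deriv_parts[abs_def])
    also have "left_deriv \<alpha> a (?P t) t = f1 t + \<alpha> * (LBINT r:{a..t}. f2 t r)"
      by (simp only: left_deriv_def f1 f2)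
    also have "left_deriv \<alpha> a (?Q t) t = (LBINT s:{t..b}. f3 t s) + \<alpha> * (LBINT r:{a..t}. LBINT s:{t..b}. f4 t r s)"
      by (simp only: left_deriv_def f3[OF t] f4'[OF t])
    finally show ?thesis by (simp add: distrib_left mult_ac)
  qed
  then have "weyl_int \<alpha> a b G = (LBINT t:{a..b}. (f1 t + \<alpha> * (LBINT r:{a..t}. f2 t r)) +
      ((1 - \<alpha>) * (LBINT s:{t..b}. f3 t s) + \<alpha> * (1 - \<alpha>) * (LBINT r:{a..t}. LBINT s:{t..b}. f4 t r s)))"
    unfolding weyl_int_def by (intro set_lebesgue_integral_cong) auto
  also have "\<dots> = (LBINT t:{a..b}. f1 t) + \<alpha> * (LBINT t:{a..b}. LBINT r:{a..t}. f2 t r)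
      + ((1 - \<alpha>) * (LBINT t:{a..b}. LBINT s:{t..b}. f3 t s)
      + \<alpha> * (1 - \<alpha>) * (LBINT t:{a..b}. LBINT r:{a..t}. LBINT s:{t..b}. f4 t r s))"
  proof -
    have j2: "set_integrable lborel {a..b} (\<lambda>t. \<alpha> * (LBINT r:{a..t}. f2 t r))"
      by (rule set_integrable_mult_right) (rule 2)
    have j3: "set_integrable lborel {a..b} (\<lambda>t. (1 - \<alpha>) * (LBINT s:{t..b}. f3 t s))"
      by (rule set_integrable_mult_right) (rule 3)
    have j4: "set_integrable lborel {a..b} (\<lambda>t. \<alpha> * (1 - \<alpha>) * (LBINT r:{a..t}. LBINT s:{t..b}. f4 t r s))"
      by (rule set_integrable_mult_right) (rule 4)
    show ?thesis
      by (simp only: set_integral_add(2)[OF set_integral_add(1)[OF 1 j2] set_integral_add(1)[OF j3 j4]]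
        set_integral_add(2)[OF 1 j2] set_integral_add(2)[OF j3 j4] set_integral_mult_right)
  qed
  finally show "weyl_int \<alpha> a b G = (LBINT t:{a..b}. f1 t) + \<alpha> * (LBINT t:{a..b}. LBINT r:{a..t}. f2 t r)
      + (1 - \<alpha>) * (LBINT t:{a..b}. LBINT s:{t..b}. f3 t s)
      + \<alpha> * (1 - \<alpha>) * (LBINT t:{a..b}. LBINT r:{a..t}. LBINT s:{t..b}. f4 t r s)" by simp
qed

end

section \<open>Weyl derivatives and the seminorms\<close>

lemma set_integrable_complex_of_real:
  "set_integrable M S (\<lambda>x. complex_of_real (f x)) \<longleftrightarrow> set_integrable M S f"
proof -
  have "(\<lambda>x. indicat_real S x *\<^sub>R complex_of_real (f x)) = (\<lambda>x. complex_of_real (indicat_real S x *\<^sub>R f x))"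
    by (auto simp: scaleR_conv_of_real)
  then show ?thesis by (simp only: set_integrable_def complex_of_real_integrable_eq)
qed

text \<open>The factor c accommodates the complex constant that the inner Weyl derivative leaves in
  front of a real function.\<close>

lemma left_weyl_of_real:
  "left_weyl \<alpha> a (\<lambda>t'. c * of_real (P t')) t = c / of_real (Gamma (1 - \<alpha>)) * of_real (left_deriv \<alpha> a P t)"
proof -
  have "(LBINT s:{a..t}. (c * of_real (P t) - c * of_real (P s)) / of_real ((t - s) powr (\<alpha> + 1)))
      = (LBINT s:{a..t}. c * of_real ((P t - P s) / (t - s) powr (\<alpha> + 1)))"
    by (simp flip: right_diff_distrib)
  also have "\<dots> = c * of_real (LBINT s:{a..t}. (P t - P s) / (t - s) powr (\<alpha> + 1))"
    by (simp only: set_integral_mult_right set_integral_complex_of_real)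
  finally show ?thesis by (simp add: left_weyl_def left_deriv_def algebra_simps)
qed

text \<open>Applied to W, the shift by \<open>f b\<close> is the one in \<open>W_minus\<close>. It
  cancels in the kernel and remains in the boundary term, where \<open>right_deriv\<close> has it
  built in.\<close>

lemma right_weyl_of_real:
  "right_weyl \<beta> b (\<lambda>u. of_real (f u - f b)) t = cis (pi * \<beta>) / of_real (Gamma (1 - \<beta>)) * of_real (right_deriv \<beta> b f t)"
proof -
  have "(LBINT s:{t..b}. (complex_of_real (f t - f b) - of_real (f s - f b)) / of_real ((s - t) powr (\<beta> + 1)))
      = (LBINT s:{t..b}. complex_of_real ((f t - f s) / (s - t) powr (\<beta> + 1)))"
    by simp
  also have "\<dots> = of_real (LBINT s:{t..b}. (f t - f s) / (s - t) powr (\<beta> + 1))"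
    by (rule set_integral_complex_of_real)
  finally have e: "(LBINT s:{t..b}. (complex_of_real (f t - f b) - of_real (f s - f b)) / of_real ((s - t) powr (\<beta> + 1))) = \<dots>" .
  show ?thesis unfolding right_weyl_def right_deriv_def e by simp
qed

lemma right_weyl_W_eq:
  "right_weyl_W \<alpha> W \<phi> b i t t' =
    cis (pi * (1 - \<alpha>)) / of_real (Gamma \<alpha>) * of_real (inner_deriv \<alpha> b (\<lambda>s r. W s (\<phi> r) i) t t')"
  using right_weyl_of_real[of "1 - \<alpha>" b "\<lambda>u. W u (\<phi> t') i" t]
  by (simp add: right_weyl_W_def W_minus_def inner_deriv_def)

lemma left_weyl_right_weyl_W:
  "left_weyl \<alpha> a (\<lambda>t'. right_weyl_W \<alpha> W \<phi> b i t t') t =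
    cis (pi * (1 - \<alpha>)) / of_real (Gamma \<alpha>) / of_real (Gamma (1 - \<alpha>)) *
    of_real (left_deriv \<alpha> a (inner_deriv \<alpha> b (\<lambda>s r. W s (\<phi> r) i) t) t)"
  unfolding right_weyl_W_eq by (rule left_weyl_of_real)

text \<open>The phases of orders \<alpha> and 1 - \<alpha> combine to \<open>cis pi = -1\<close>.
  Hence the quantity is real, and this is the minus sign in front of the expanded formula.\<close>

lemma weyl_quantity_eq:
  "weyl_quantity \<alpha> W \<phi> a b i =
    of_real (- (1 / (Gamma \<alpha> * Gamma (1 - \<alpha>))) * weyl_int \<alpha> a b (\<lambda>s r. W s (\<phi> r) i))"
proof -
  have "cis (pi * \<alpha>) * cis (pi * (1 - \<alpha>)) = -1"
    by (simp add: cis_mult algebra_simps flip: distrib_left)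
  then show ?thesis
    unfolding weyl_quantity_def left_weyl_right_weyl_W set_integral_mult_right set_integral_complex_of_real weyl_int_def
    by (simp add: mult.assoc[symmetric])
qed

context weyl_exponents
begin

lemma weyl_quantity_finiteI:
  assumes G: "\<And>i. \<exists>A B. mixed_holder \<tau> \<mu> a b A B (\<lambda>s r. W s (\<phi> r) i)"
  shows "weyl_quantity_finite \<alpha> W \<phi> a b"
  unfolding weyl_quantity_finite_def
proof (intro allI conjI ballI)
  fix i
  obtain A B where G: "mixed_holder \<tau> \<mu> a b A B (\<lambda>s r. W s (\<phi> r) i)" using G by blast
  show "right_weyl_exists (1 - \<alpha>) b (\<lambda>u. of_real (W_minus b W u (\<phi> t') i)) t"
    if "t \<in> {a<..<b}" "t' \<in> {a..b}" for t t'
    using inner_kernel_integrable[OF G, of t t'] that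
    unfolding right_weyl_exists_def set_integrable_complex_of_real[symmetric] by (simp add: W_minus_def)
  show "left_weyl_exists \<alpha> a (\<lambda>t'. right_weyl_W \<alpha> W \<phi> b i t t') t" if "t \<in> {a<..<b}" for t
  proof -
    let ?P = "inner_deriv \<alpha> b (\<lambda>s r. W s (\<phi> r) i) t"
    have "set_integrable lborel {a..t} (\<lambda>s. (cis (pi * (1 - \<alpha>)) / of_real (Gamma \<alpha>)) *
        complex_of_real ((?P t - ?P s) / (t - s) powr (\<alpha> + 1)))"
      using outer_kernel_integrable[OF G, of t] that
      by (intro set_integrable_mult_right) (simp only: set_integrable_complex_of_real, auto)
    moreover have e: "(c * of_real x - c * of_real y) / of_real z = c * complex_of_real ((x - y) / z)" for c x y z
      by (simp add: right_diff_distrib diff_divide_distrib)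
    ultimately show ?thesis
      unfolding left_weyl_exists_def right_weyl_W_eq e by blast
  qed
  show "set_integrable lborel {a..b} (\<lambda>t. left_weyl \<alpha> a (\<lambda>t'. right_weyl_W \<alpha> W \<phi> b i t t') t)"
    unfolding left_weyl_right_weyl_W using outer_deriv_integrable[OF G]
    by (intro set_integrable_mult_right) (simp only: set_integrable_complex_of_real)
qed

lemma expansion_integrals_existI:
  assumes G: "\<And>i. \<exists>A B. mixed_holder \<tau> \<mu> a b A B (\<lambda>s r. W s (\<phi> r) i)"
  shows "expansion_integrals_exist \<alpha> W \<phi> a b"
  unfolding expansion_integrals_exist_def Let_def
proof (intro allI)
  fix i
  obtain A B where G: "mixed_holder \<tau> \<mu> a b A B (\<lambda>s r. W s (\<phi> r) i)" using G by blast
  note E = weyl_int_expand[OF G]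
  show "set_integrable lborel {a..b} (\<lambda>t. W_minus b W t (\<phi> t) i / ((b - t) powr (1 - \<alpha>) * (t - a) powr \<alpha>)) \<and>
    (\<forall>t\<in>{a<..<b}. set_integrable lborel {a..t} (\<lambda>r. (W_minus b W t (\<phi> t) i - W_minus b W t (\<phi> r) i) /
        ((b - t) powr (1 - \<alpha>) * (t - r) powr (\<alpha> + 1)))) \<and>
    set_integrable lborel {a..b} (\<lambda>t. LBINT r:{a..t}. (W_minus b W t (\<phi> t) i - W_minus b W t (\<phi> r) i) /
        ((b - t) powr (1 - \<alpha>) * (t - r) powr (\<alpha> + 1))) \<and>
    (\<forall>t\<in>{a<..<b}. set_integrable lborel {t..b} (\<lambda>s. (W t (\<phi> t) i - W s (\<phi> t) i) /
        ((s - t) powr (2 - \<alpha>) * (t - a) powr \<alpha>))) \<and>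
    set_integrable lborel {a..b} (\<lambda>t. LBINT s:{t..b}. (W t (\<phi> t) i - W s (\<phi> t) i) /
        ((s - t) powr (2 - \<alpha>) * (t - a) powr \<alpha>)) \<and>
    (\<forall>t\<in>{a<..<b}. \<forall>r\<in>{a..<t}. set_integrable lborel {t..b} (\<lambda>s. (W t (\<phi> t) i - W s (\<phi> t) i - W t (\<phi> r) i + W s (\<phi> r) i) /
        ((s - t) powr (2 - \<alpha>) * (t - r) powr (\<alpha> + 1)))) \<and>
    (\<forall>t\<in>{a<..<b}. set_integrable lborel {a..t} (\<lambda>r. LBINT s:{t..b}. (W t (\<phi> t) i - W s (\<phi> t) i - W t (\<phi> r) i + W s (\<phi> r) i) /
        ((s - t) powr (2 - \<alpha>) * (t - r) powr (\<alpha> + 1)))) \<and>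
    set_integrable lborel {a..b} (\<lambda>t. LBINT r:{a..t}. LBINT s:{t..b}. (W t (\<phi> t) i - W s (\<phi> t) i - W t (\<phi> r) i + W s (\<phi> r) i) /
        ((s - t) powr (2 - \<alpha>) * (t - r) powr (\<alpha> + 1)))"
    unfolding W_minus_def
  proof (intro conjI ballI, goal_cases)
    case 1 show ?case by (rule E(1))
  next
    case (2 t) then show ?case by (intro E(2)) auto
  next
    case 3 show ?case by (rule E(3))
  next
    case (4 t) then show ?case by (intro E(4)) auto
  next
    case 5 show ?case by (rule E(5))
  next
    case (6 t r) then show ?case by (intro E(6)) auto
  next
    case (7 t) then show ?case by (intro E(7)) auto
  next
    case 8 show ?case by (rule E(8))
  qed
qed

end

section \<open>Increment bounds extracted from the seminorms\<close>

lemma le_enn2real_SUP: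
  assumes "(SUP p\<in>P. ennreal (f p)) \<le> X" "X < \<infinity>" "p \<in> P"
  shows "f p \<le> enn2real X"
proof -
  have "ennreal (f p) \<le> X" by (rule order_trans[OF SUP_upper[OF assms(3)] assms(1)])
  \<comment> \<open>Finiteness is essential, since \<open>enn2real\<close> sends \<infinity> to
    0.\<close>
  also have "X = ennreal (enn2real X)" using assms(2) by (simp add: less_top)
  finally show ?thesis by (simp add: ennreal_le_iff)
qed

lemma vnorm_minus_commute: "vnorm d (\<lambda>i. x i - y i) = vnorm d (\<lambda>i. y i - x i)"
  by (simp add: L2_set_def power2_commute)

lemma vnorm_uminus: "vnorm d (\<lambda>i. - x i) = vnorm d x"
  by (simp add: L2_set_def)

lemma vnorm_zero: "vnorm d (\<lambda>i. 0) = 0"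
  by (simp add: L2_set_def)

text \<open>\<open>vnorm d\<close> sees only the coordinates below d; membership in
  \<open>R_space d\<close> fixes the others, so distinct points have positive distance.\<close>

lemma vnorm_diff_pos:
  assumes "x \<in> R_space d" "y \<in> R_space d" "x \<noteq> y"
  shows "vnorm d (\<lambda>i. x i - y i) > 0"
proof -
  have "vnorm d (\<lambda>i. x i - y i) \<noteq> 0"
  proof
    assume "vnorm d (\<lambda>i. x i - y i) = 0"
    then have "x i = y i" if "i < d" for i using that by (simp add: L2_set_eq_0_iff)
    moreover have "x i = y i" if "i \<ge> d" for i
      using assms that by (simp add: topspace_Euclidean_space)
    ultimately show False using assms(3) by (meson ext not_less)
  qed
  then show ?thesis using L2_set_nonneg[of "\<lambda>i. x i - y i" "{..<d}"] by linarith
qed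

text \<open>Each supremum is at most the sum of the three. The suprema run over \<open>s < t\<close>
  and \<open>x \<noteq> y\<close>; exchanging the times only changes a sign, and in the degenerate
  cases the increments vanish.\<close>

lemma W_seminorm_bounds:
  assumes fin: "W_seminorm d \<tau> lam a b W < \<infinity>"
  defines "S \<equiv> enn2real (W_seminorm d \<tau> lam a b W)"
  assumes s: "s \<in> {a..b}" "t \<in> {a..b}" and x: "x \<in> R_space d" "y \<in> R_space d"
  shows "vnorm d (\<lambda>i. W s x i - W t x i) \<le> S * \<bar>s - t\<bar> powr \<tau>"
    and "vnorm d (\<lambda>i. W s x i - W t x i - W s y i + W t y i) \<le>
      S * \<bar>s - t\<bar> powr \<tau> * vnorm d (\<lambda>i. x i - y i) powr lam"
    and "vnorm d (\<lambda>i. W t x i - W t y i) \<le> S * vnorm d (\<lambda>i. x i - y i) powr lam"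
proof -
  let ?P1 = "{(s, t, x, y). a \<le> s \<and> s < t \<and> t \<le> b \<and> x \<in> R_space d \<and> y \<in> R_space d \<and> x \<noteq> y}"
  let ?f1 = "\<lambda>(s, t, x, y). vnorm d (\<lambda>i. W s x i - W t x i - W s y i + W t y i) /
                (\<bar>t - s\<bar> powr \<tau> * vnorm d (\<lambda>i. x i - y i) powr lam)"
  let ?P2 = "{(s, t, x). a \<le> s \<and> s < t \<and> t \<le> b \<and> x \<in> R_space d}"
  let ?f2 = "\<lambda>(s, t, x). vnorm d (\<lambda>i. W s x i - W t x i) / \<bar>t - s\<bar> powr \<tau>"
  let ?P3 = "{(t, x, y). a \<le> t \<and> t \<le> b \<and> x \<in> R_space d \<and> y \<in> R_space d \<and> x \<noteq> y}"
  let ?f3 = "\<lambda>(t, x, y). vnorm d (\<lambda>i. W t y i - W t x i) / vnorm d (\<lambda>i. x i - y i) powr lam"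
  let ?S1 = "SUP p\<in>?P1. ennreal (?f1 p)" and ?S2 = "SUP p\<in>?P2. ennreal (?f2 p)" and ?S3 = "SUP p\<in>?P3. ennreal (?f3 p)"
  have W: "W_seminorm d \<tau> lam a b W = ?S1 + ?S2 + ?S3"
    unfolding W_seminorm_def
    by (intro arg_cong2[where f="(+)"] SUP_cong refl) auto
  have le: "?S1 \<le> W_seminorm d \<tau> lam a b W" "?S2 \<le> W_seminorm d \<tau> lam a b W" "?S3 \<le> W_seminorm d \<tau> lam a b W"
    unfolding W by (auto intro: add_increasing add_increasing2 simp: add.assoc)
  have S: "0 \<le> S" by (simp add: S_def)
  have 1: "vnorm d (\<lambda>i. W s x i - W t x i - W s y i + W t y i) \<le> S * \<bar>s - t\<bar> powr \<tau> * vnorm d (\<lambda>i. x i - y i) powr lam"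
    if "s < t" "a \<le> s" "t \<le> b" "x \<noteq> y" for s t
  proof -
    have "?f1 (s, t, x, y) \<le> S"
      unfolding S_def by (rule le_enn2real_SUP[OF le(1) fin]) (use that x in auto)
    moreover have "0 < \<bar>t - s\<bar> powr \<tau> * vnorm d (\<lambda>i. x i - y i) powr lam"
      using that vnorm_diff_pos[OF x] by simp
    ultimately show ?thesis by (simp add: divide_le_eq abs_minus_commute mult.assoc)
  qed
  have 2: "vnorm d (\<lambda>i. W s x i - W t x i) \<le> S * \<bar>s - t\<bar> powr \<tau>"
    if "s < t" "a \<le> s" "t \<le> b" for s t
  proof -
    have "?f2 (s, t, x) \<le> S"
      unfolding S_def by (rule le_enn2real_SUP[OF le(2) fin]) (use that x in auto)
    moreover have "0 < \<bar>t - s\<bar> powr \<tau>" using that by simp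
    ultimately show ?thesis by (simp add: divide_le_eq abs_minus_commute)
  qed
  show "vnorm d (\<lambda>i. W s x i - W t x i) \<le> S * \<bar>s - t\<bar> powr \<tau>"
  proof (cases s t rule: linorder_cases)
    case less then show ?thesis using 2[of s t] s by simp
  next
    case equal then show ?thesis using S by (simp add: vnorm_zero)
  next
    case greater
    then show ?thesis using 2[of t s] s
      by (simp add: abs_minus_commute vnorm_minus_commute[of "W s x"])
  qed
  show "vnorm d (\<lambda>i. W s x i - W t x i - W s y i + W t y i) \<le>
      S * \<bar>s - t\<bar> powr \<tau> * vnorm d (\<lambda>i. x i - y i) powr lam"
  proof (cases "x = y")
    case True then show ?thesis using S by (simp add: vnorm_zero)
  next
    case False
    show ?thesis
    proof (cases s t rule: linorder_cases)
      case less then show ?thesis using 1[of s t] s False by simp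
    next
      case equal then show ?thesis using S by (simp add: vnorm_zero)
    next
      case greater
      have "vnorm d (\<lambda>i. W s x i - W t x i - W s y i + W t y i) =
          vnorm d (\<lambda>i. - (W t x i - W s x i - W t y i + W s y i))"
        by (intro arg_cong[where f="vnorm d"]) auto
      also have "\<dots> = vnorm d (\<lambda>i. W t x i - W s x i - W t y i + W s y i)"
        by (rule vnorm_uminus)
      also have "\<dots> \<le> S * \<bar>s - t\<bar> powr \<tau> * vnorm d (\<lambda>i. x i - y i) powr lam"
        using 1[of t s] greater s False by (simp add: abs_minus_commute)
      finally show ?thesis .
    qed
  qed
  show "vnorm d (\<lambda>i. W t x i - W t y i) \<le> S * vnorm d (\<lambda>i. x i - y i) powr lam"
  proof (cases "x = y")
    case True then show ?thesis using S by (simp add: vnorm_zero)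
  next
    case False
    have "?f3 (t, x, y) \<le> S"
      unfolding S_def by (rule le_enn2real_SUP[OF le(3) fin]) (use False s x in auto)
    moreover have "0 < vnorm d (\<lambda>i. x i - y i) powr lam"
      using False vnorm_diff_pos[OF x] by simp
    ultimately show ?thesis by (simp add: divide_le_eq vnorm_minus_commute[of "W t x"])
  qed
qed

lemma holder_seminorm_bound:
  assumes fin: "holder_seminorm d \<gamma> a b \<phi> < \<infinity>" and s: "s \<in> {a..b}" "t \<in> {a..b}"
  shows "vnorm d (\<lambda>i. \<phi> s i - \<phi> t i) \<le> enn2real (holder_seminorm d \<gamma> a b \<phi>) * \<bar>s - t\<bar> powr \<gamma>"
proof -
  have *: "vnorm d (\<lambda>i. \<phi> t i - \<phi> s i) \<le> enn2real (holder_seminorm d \<gamma> a b \<phi>) * \<bar>s - t\<bar> powr \<gamma>"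
    if "s < t" "a \<le> s" "t \<le> b" for s t
  proof -
    let ?f = "\<lambda>(s, t). vnorm d (\<lambda>i. \<phi> t i - \<phi> s i) / \<bar>t - s\<bar> powr \<gamma>"
    have "(SUP p\<in>{(s, t). a \<le> s \<and> s < t \<and> t \<le> b}. ennreal (?f p)) \<le> holder_seminorm d \<gamma> a b \<phi>"
      unfolding holder_seminorm_def by (intro eq_refl SUP_cong) auto
    from le_enn2real_SUP[OF this fin, of "(s, t)"] that
    have "?f (s, t) \<le> enn2real (holder_seminorm d \<gamma> a b \<phi>)" by auto
    moreover have "0 < \<bar>t - s\<bar> powr \<gamma>" using that by simp
    ultimately show ?thesis by (simp add: divide_le_eq abs_minus_commute)
  qed
  show ?thesis
  proof (cases s t rule: linorder_cases)
    case less then show ?thesis using *[of s t] s by (simp add: vnorm_minus_commute[of "\<phi> s"])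
  next
    case equal then show ?thesis by (simp add: vnorm_zero)
  next
    case greater then show ?thesis using *[of t s] s by (simp add: abs_minus_commute)
  qed
qed

lemma abs_inner_le_vnorm: "\<bar>\<Sum>i<d. v i * x i\<bar> \<le> vnorm d v * vnorm d x"
proof -
  have "\<bar>\<Sum>i<d. v i * x i\<bar> \<le> (\<Sum>i<d. \<bar>v i\<bar> * \<bar>x i\<bar>)"
    by (intro order_trans[OF sum_abs]) (simp add: abs_mult)
  also have "\<dots> \<le> vnorm d v * vnorm d x" by (rule L2_set_mult_ineq)
  finally show ?thesis .
qed

section \<open>The scalar function attached to a direction\<close>

locale holder_data =
  fixes \<tau> lam \<gamma> :: real and d :: nat
    and W :: "real \<Rightarrow> (nat \<Rightarrow> real) \<Rightarrow> nat \<Rightarrow> real" and \<phi> :: "real \<Rightarrow> nat \<Rightarrow> real"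
  assumes exponents: "0 < \<tau>" "\<tau> \<le> 1" "0 < lam" "lam \<le> 1" "0 < \<gamma>" "\<gamma> \<le> 1"
    and W_range: "\<And>t x. x \<in> R_space d \<Longrightarrow> W t x \<in> R_space d"
    and W_finite: "\<And>a b. a < b \<Longrightarrow> W_seminorm d \<tau> lam a b W < \<infinity>"
    and phi_range: "\<And>t. \<phi> t \<in> R_space d"
    and phi_finite: "\<And>a b. a < b \<Longrightarrow> holder_seminorm d \<gamma> a b \<phi> < \<infinity>"
begin

text \<open>Unit vectors recover the coordinates of the integral; taking for v the vector of
  integrals itself leads to its norm.\<close>

definition directional :: "(nat \<Rightarrow> real) \<Rightarrow> real \<Rightarrow> real \<Rightarrow> real" where
  "directional v s r = (\<Sum>i<d. v i * W s (\<phi> r) i)"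

lemma phi_powr_le:
  assumes "a < b" "r \<in> {a..b}" "r' \<in> {a..b}"
  shows "vnorm d (\<lambda>i. \<phi> r i - \<phi> r' i) powr lam \<le>
    enn2real (holder_seminorm d \<gamma> a b \<phi>) powr lam * \<bar>r - r'\<bar> powr (lam * \<gamma>)"
proof -
  have "vnorm d (\<lambda>i. \<phi> r i - \<phi> r' i) powr lam \<le> (enn2real (holder_seminorm d \<gamma> a b \<phi>) * \<bar>r - r'\<bar> powr \<gamma>) powr lam"
    using holder_seminorm_bound[OF phi_finite[OF assms(1)] assms(2,3)] exponents
    by (intro powr_mono2) (auto simp: L2_set_nonneg)
  also have "\<dots> = enn2real (holder_seminorm d \<gamma> a b \<phi>) powr lam * \<bar>r - r'\<bar> powr (lam * \<gamma>)"
    by (simp add: powr_mult powr_powr mult.commute)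
  finally show ?thesis .
qed

lemma directional_bounds:
  assumes ab: "a < b" and s: "s \<in> {a..b}" "t \<in> {a..b}" "r \<in> {a..b}" "r' \<in> {a..b}"
  defines "S \<equiv> enn2real (W_seminorm d \<tau> lam a b W)" and "H \<equiv> enn2real (holder_seminorm d \<gamma> a b \<phi>) powr lam"
  shows "\<bar>directional v s r - directional v t r\<bar> \<le> vnorm d v * S * \<bar>s - t\<bar> powr \<tau>"
    and "\<bar>directional v s r - directional v t r - directional v s r' + directional v t r'\<bar> \<le>
      vnorm d v * S * H * \<bar>s - t\<bar> powr \<tau> * \<bar>r - r'\<bar> powr (lam * \<gamma>)"
    and "\<bar>directional v t r - directional v t r'\<bar> \<le> vnorm d v * S * H * \<bar>r - r'\<bar> powr (lam * \<gamma>)"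
proof -
  note W = W_seminorm_bounds[OF W_finite[OF ab] s(1,2) phi_range[of r] phi_range[of r']]
  have v: "0 \<le> vnorm d v" "0 \<le> S" by (simp_all add: L2_set_nonneg S_def)
  have p: "vnorm d (\<lambda>i. \<phi> r i - \<phi> r' i) powr lam \<le> H * \<bar>r - r'\<bar> powr (lam * \<gamma>)"
    unfolding H_def by (rule phi_powr_le[OF ab s(3,4)])
  have e1: "directional v s r - directional v t r = (\<Sum>i<d. v i * (W s (\<phi> r) i - W t (\<phi> r) i))"
    by (simp add: directional_def sum_subtractf right_diff_distrib)
  have "\<bar>directional v s r - directional v t r\<bar> \<le> vnorm d v * vnorm d (\<lambda>i. W s (\<phi> r) i - W t (\<phi> r) i)"
    unfolding e1 by (rule abs_inner_le_vnorm)
  also have "\<dots> \<le> vnorm d v * (S * \<bar>s - t\<bar> powr \<tau>)"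
    unfolding S_def using W(1) v by (intro mult_left_mono) auto
  finally show "\<bar>directional v s r - directional v t r\<bar> \<le> vnorm d v * S * \<bar>s - t\<bar> powr \<tau>"
    by (simp add: mult.assoc)
  have e2: "directional v s r - directional v t r - directional v s r' + directional v t r' =
      (\<Sum>i<d. v i * (W s (\<phi> r) i - W t (\<phi> r) i - W s (\<phi> r') i + W t (\<phi> r') i))"
    by (simp add: directional_def sum_subtractf sum.distrib right_diff_distrib distrib_left)
  have "\<bar>directional v s r - directional v t r - directional v s r' + directional v t r'\<bar> \<le> vnorm d v * vnorm d (\<lambda>i. W s (\<phi> r) i - W t (\<phi> r) i - W s (\<phi> r') i + W t (\<phi> r') i)"
    unfolding e2 by (rule abs_inner_le_vnorm)
  also have "\<dots> \<le> vnorm d v * (S * \<bar>s - t\<bar> powr \<tau> * (H * \<bar>r - r'\<bar> powr (lam * \<gamma>)))"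
    using order_trans[OF W(2)[folded S_def] mult_left_mono[OF p, of "S * \<bar>s - t\<bar> powr \<tau>"]] v
    by (intro mult_left_mono) auto
  finally show "\<bar>directional v s r - directional v t r - directional v s r' + directional v t r'\<bar> \<le>
      vnorm d v * S * H * \<bar>s - t\<bar> powr \<tau> * \<bar>r - r'\<bar> powr (lam * \<gamma>)"
    by (simp add: mult_ac)
  have e3: "directional v t r - directional v t r' = (\<Sum>i<d. v i * (W t (\<phi> r) i - W t (\<phi> r') i))"
    by (simp add: directional_def sum_subtractf right_diff_distrib)
  have "\<bar>directional v t r - directional v t r'\<bar> \<le> vnorm d v * vnorm d (\<lambda>i. W t (\<phi> r) i - W t (\<phi> r') i)"
    unfolding e3 by (rule abs_inner_le_vnorm)
  also have "\<dots> \<le> vnorm d v * (S * (H * \<bar>r - r'\<bar> powr (lam * \<gamma>)))"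
    using order_trans[OF W(3)[folded S_def] mult_left_mono[OF p, of S]] v
    by (intro mult_left_mono) auto
  finally show "\<bar>directional v t r - directional v t r'\<bar> \<le> vnorm d v * S * H * \<bar>r - r'\<bar> powr (lam * \<gamma>)"
    by (simp add: mult.assoc)
qed

text \<open>The averages and their limit need a continuous function. The purely spatial part of the
  seminorm gives continuity in r, the purely temporal part gives it in s.\<close>

lemma continuous_directional: "continuous_on UNIV (\<lambda>(s, r). directional v s r)"
proof -
  have "((\<lambda>(s, r). directional v s r) \<longlongrightarrow> directional v s0 r0) (at (s0, r0))" for s0 r0
  proof -
    \<comment> \<open>An interval that contains both coordinates with margin 1, so that every point
      at distance less than 1 is covered by the same constants.\<close>
    define a b where "a = min s0 r0 - 1" and "b = max s0 r0 + 1"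
    have ab: "a < b" and 0: "s0 \<in> {a..b}" "r0 \<in> {a..b}" by (auto simp: a_def b_def)
    let ?A = "vnorm d v * enn2real (W_seminorm d \<tau> lam a b W)"
    let ?B = "?A * enn2real (holder_seminorm d \<gamma> a b \<phi>) powr lam"
    let ?g = "\<lambda>p. ?A * \<bar>fst p - s0\<bar> powr \<tau> + ?B * \<bar>snd p - r0\<bar> powr (lam * \<gamma>)"
    have "((\<lambda>p. (case p of (s, r) \<Rightarrow> directional v s r) - directional v s0 r0) \<longlongrightarrow> 0) (at (s0, r0))"
    proof (rule Lim_null_comparison)
      have "eventually (\<lambda>p. dist p (s0, r0) < 1) (at (s0, r0))"
        by (auto simp: eventually_at intro: exI[of _ 1])
      then show "\<forall>\<^sub>F p in at (s0, r0). norm ((case p of (s, r) \<Rightarrow> directional v s r) - directional v s0 r0) \<le> ?g p"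
      proof eventually_elim
        case (elim p)
        obtain s r where p: "p = (s, r)" by (cases p)
        have "dist s s0 < 1" "dist r r0 < 1"
          using elim dist_fst_le[of p "(s0, r0)"] dist_snd_le[of p "(s0, r0)"] by (auto simp: p)
        then have s: "s \<in> {a..b}" "r \<in> {a..b}" by (auto simp: a_def b_def dist_real_def)
        show ?case
          using directional_bounds(1)[OF ab s(1) 0(1) s(2) s(2), of v]
            directional_bounds(3)[OF ab 0(1) 0(1) s(2) 0(2), of v] by (simp add: p)
      qed
      have "isCont (\<lambda>p::real\<times>real. fst p) (s0, r0)" "isCont (\<lambda>p::real\<times>real. snd p) (s0, r0)"
        by (intro continuous_intros)+
      then have "((\<lambda>p. fst p) \<longlongrightarrow> s0) (at (s0, r0))" "((\<lambda>p. snd p) \<longlongrightarrow> r0) (at (s0, r0))"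
        by (simp_all add: isCont_def)
      then have "(?g \<longlongrightarrow> ?A * \<bar>s0 - s0\<bar> powr \<tau> + ?B * \<bar>r0 - r0\<bar> powr (lam * \<gamma>)) (at (s0, r0))"
        using exponents by (intro tendsto_intros tendsto_powr') auto
      then show "(?g \<longlongrightarrow> 0) (at (s0, r0))" by simp
    qed
    then show ?thesis by (simp add: LIM_zero_iff)
  qed
  then show ?thesis by (auto simp: continuous_on_def)
qed

text \<open>The bound c in place of \<open>vnorm d v\<close> lets all coordinates share their
  constants, as \<open>weyl_int_sum\<close> requires.\<close>

lemma mixed_holder_directional:
  assumes "a < b" "vnorm d v \<le> c"
  shows "mixed_holder \<tau> (lam * \<gamma>) a b (c * enn2real (W_seminorm d \<tau> lam a b W))
    (c * enn2real (W_seminorm d \<tau> lam a b W) * enn2real (holder_seminorm d \<gamma> a b \<phi>) powr lam) (directional v)"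
  unfolding mixed_holder_def
proof (intro conjI ballI)
  have c: "0 \<le> c" using assms(2) L2_set_nonneg[of v "{..<d}"] by linarith
  show "(\<lambda>(s, r). directional v s r) \<in> borel_measurable (borel \<Otimes>\<^sub>M borel)"
    using borel_measurable_continuous_onI[OF continuous_directional] by (simp add: borel_prod)
  fix s t r assume s: "s \<in> {a..b}" "t \<in> {a..b}" "r \<in> {a..b}"
  show "\<bar>directional v s r - directional v t r\<bar> \<le> c * enn2real (W_seminorm d \<tau> lam a b W) * \<bar>s - t\<bar> powr \<tau>"
    using c by (intro order_trans[OF directional_bounds(1)[OF assms(1) s s(3)]] mult_right_mono assms(2)) auto
  fix r' assume r': "r' \<in> {a..b}"
  show "\<bar>directional v s r - directional v t r - directional v s r' + directional v t r'\<bar> \<le>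
    c * enn2real (W_seminorm d \<tau> lam a b W) * enn2real (holder_seminorm d \<gamma> a b \<phi>) powr lam *
      \<bar>s - t\<bar> powr \<tau> * \<bar>r - r'\<bar> powr (lam * \<gamma>)"
    using c by (intro order_trans[OF directional_bounds(2)[OF assms(1) s r']] mult_right_mono assms(2)) auto
qed (use assms(2) order_trans[OF L2_set_nonneg] in \<open>auto intro!: mult_nonneg_nonneg\<close>)

text \<open>Valid for every i: beyond the dimension the left side is 0 because W takes values in
  \<open>R_space d\<close>, and the right side because its sum misses the index.\<close>

lemma coordinate_directional: "(\<lambda>s r. W s (\<phi> r) i) = directional (\<lambda>j. if j = i then 1 else 0)"
proof (intro ext)
  fix s r
  have "W s (\<phi> r) i = 0" if "\<not> i < d"
    using W_range[OF phi_range, of s r] that by (simp add: topspace_Euclidean_space)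
  then show "W s (\<phi> r) i = directional (\<lambda>j. if j = i then 1 else 0) s r"
    by (auto simp: directional_def if_distrib[of "\<lambda>c. c * _"] sum.delta cong: if_cong)
qed

lemma vnorm_unit: "vnorm d (\<lambda>j. if j = i then 1 else 0) \<le> 1"
  by (auto simp: L2_set_def if_distrib[of "\<lambda>c. c\<^sup>2"] sum.delta cong: if_cong)

lemma mixed_holder_coordinate:
  assumes "a < b"
  shows "mixed_holder \<tau> (lam * \<gamma>) a b (1 * enn2real (W_seminorm d \<tau> lam a b W))
    (1 * enn2real (W_seminorm d \<tau> lam a b W) * enn2real (holder_seminorm d \<gamma> a b \<phi>) powr lam) (\<lambda>s r. W s (\<phi> r) i)"
  unfolding coordinate_directional by (rule mixed_holder_directional[OF assms vnorm_unit])

section \<open>Consequences for the vector-valued integral\<close>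

lemma weyl_exponentsI:
  assumes "a < b" "\<alpha> \<in> {1 - \<tau><..<lam * \<gamma>}"
  shows "weyl_exponents a b \<alpha> \<tau> (lam * \<gamma>)"
proof
  have "lam * \<gamma> \<le> 1" using exponents by (intro mult_le_one) auto
  then show "0 < \<alpha>" "\<alpha> < 1" "1 - \<tau> < \<alpha>" "\<alpha> < lam * \<gamma>" "a < b"
    using assms exponents by auto
qed

lemma weyl_quantity_independent:
  assumes "a < b" "\<alpha> \<in> {1 - \<tau><..<lam * \<gamma>}" "\<alpha>' \<in> {1 - \<tau><..<lam * \<gamma>}"
  shows "weyl_quantity \<alpha> W \<phi> a b = weyl_quantity \<alpha>' W \<phi> a b"
proof
  fix i
  \<comment> \<open>The forward averages reach beyond b, so the bounds are taken on
    \<open>{a..b + 1}\<close>; the seminorms are finite on every interval.\<close>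
  have "a < b + 1" using assms by simp
  then show "weyl_quantity \<alpha> W \<phi> a b i = weyl_quantity \<alpha>' W \<phi> a b i"
    using weyl_int_independent[OF weyl_exponentsI[OF assms(1,2)] weyl_exponentsI[OF assms(1,3)]
        mixed_holder_coordinate continuous_directional[of "\<lambda>j. if j = i then 1 else 0", folded coordinate_directional]]
    unfolding weyl_quantity_eq by simp
qed

text \<open>The given \<alpha> makes the range of orders nonempty, whence the common value is
  unique.\<close>

lemma nonlinear_integral_eq:
  assumes "a < b" "\<alpha> \<in> {1 - \<tau><..<lam * \<gamma>}"
  shows "nonlinear_integral \<tau> lam \<gamma> W \<phi> a b = weyl_quantity \<alpha> W \<phi> a b"
  unfolding nonlinear_integral_def
proof (rule the_equality)
  show "\<forall>\<alpha>'\<in>{1 - \<tau><..<lam * \<gamma>}. weyl_quantity \<alpha>' W \<phi> a b = weyl_quantity \<alpha> W \<phi> a b"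
    using weyl_quantity_independent[OF assms(1) _ assms(2)] by blast
  show "I = weyl_quantity \<alpha> W \<phi> a b" if "\<forall>\<alpha>'\<in>{1 - \<tau><..<lam * \<gamma>}. weyl_quantity \<alpha>' W \<phi> a b = I" for I
    using bspec[OF that assms(2)] by (rule sym)
qed

text \<open>Pairing the vector of integrals with itself gives the integral of a scalar function, whence
  the bound does not depend on the dimension.\<close>

lemma cvnorm_weyl_quantity_le:
  assumes ab: "a < b" and al: "\<alpha> \<in> {1 - \<tau><..<lam * \<gamma>}"
  defines "S \<equiv> enn2real (W_seminorm d \<tau> lam a b W)" and "H \<equiv> enn2real (holder_seminorm d \<gamma> a b \<phi>) powr lam"
  defines "c \<equiv> 1 + (1 - \<alpha>) / (\<tau> - (1 - \<alpha>))"
  shows "cvnorm d (weyl_quantity \<alpha> W \<phi> a b) \<le> 1 / (Gamma \<alpha> * Gamma (1 - \<alpha>)) *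
    (c / (1 - \<alpha>) * S * (b - a) powr \<tau> + c * \<alpha> / (lam * \<gamma> - \<alpha>) * (S * H) * (b - a) powr (\<tau> + lam * \<gamma>))"
proof -
  interpret weyl_exponents a b \<alpha> \<tau> "lam * \<gamma>" by (rule weyl_exponentsI[OF ab al])
  define k where "k = 1 / (Gamma \<alpha> * Gamma (1 - \<alpha>))"
  have k: "0 < k" using alpha by (simp add: k_def Gamma_real_pos)
  define x where "x i = - k * weyl_int \<alpha> a b (\<lambda>s r. W s (\<phi> r) i)" for i
  have q: "weyl_quantity \<alpha> W \<phi> a b i = of_real (x i)" for i
    by (simp add: weyl_quantity_eq x_def k_def)
  have cv: "cvnorm d (weyl_quantity \<alpha> W \<phi> a b) = vnorm d x"
    by (simp add: q L2_set_def)
  define R where "R = c / (1 - \<alpha>) * S * (b - a) powr \<tau> + c * \<alpha> / (lam * \<gamma> - \<alpha>) * (S * H) * (b - a) powr (\<tau> + lam * \<gamma>)"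
  have c: "c = c1" by (simp add: c_def c1_def)
  have "(vnorm d x)\<^sup>2 = (\<Sum>i<d. x i * x i)"
    by (simp add: L2_set_def sum_nonneg power2_eq_square)
  \<comment> \<open>Only one of the two factors \<open>x i\<close> is unfolded; the other stays as
    the weight of the pairing, so that linearity yields the direction x.\<close>
  also have "\<dots> = - k * (\<Sum>i<d. x i * weyl_int \<alpha> a b (\<lambda>s r. W s (\<phi> r) i))"
    by (subst (2) x_def) (simp add: sum_distrib_left mult_ac)
  also have "\<dots> = - k * weyl_int \<alpha> a b (directional x)"
    unfolding directional_def[abs_def] by (subst weyl_int_sum[OF mixed_holder_coordinate[OF ab]]) simp
  also have "\<dots> \<le> k * \<bar>weyl_int \<alpha> a b (directional x)\<bar>"
    using k by (simp add: abs_if)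
  also have "\<dots> \<le> k * (vnorm d x * R)"
    using weyl_int_bound[OF mixed_holder_directional[OF ab order_refl, of x]] k
    by (intro mult_left_mono) (simp_all add: R_def S_def H_def c algebra_simps)
  \<comment> \<open>The scalar bound is linear in the length of the direction, so one factor
    \<open>vnorm d x\<close> cancels; if it is 0, the claim is immediate.\<close>
  finally have "vnorm d x * vnorm d x \<le> vnorm d x * (k * R)"
    by (simp add: power2_eq_square mult_ac)
  moreover have "0 \<le> R"
    using alpha c1_pos by (simp add: R_def c S_def H_def)
  ultimately have "vnorm d x \<le> k * R"
    using k L2_set_nonneg[of x "{..<d}"] by (cases "vnorm d x = 0") auto
  then show ?thesis unfolding cv R_def k_def .
qed

end

text \<open>The direct estimate degenerates as \<open>\<alpha>\<close> approaches \<open>lam * \<gamma>\<close>. Since the integral does not depend on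
  \<open>\<alpha>\<close>, it is estimated at the midpoint of \<open>1 - \<tau>\<close> and \<open>\<alpha>\<close> instead, whose distance to
  \<open>lam * \<gamma>\<close> is bounded below independently of \<open>\<gamma>\<close>.\<close>

definition weyl_constant :: "real \<Rightarrow> real \<Rightarrow> real" where
  "weyl_constant \<tau> \<alpha> =
    (let \<beta> = (\<alpha> + 1 - \<tau>) / 2; c = 1 + (1 - \<beta>) / (\<tau> - (1 - \<beta>))
     in 1 / (Gamma \<beta> * Gamma (1 - \<beta>)) * (c / (1 - \<beta>) + c * \<beta> / (\<alpha> - \<beta>)))"

context holder_data
begin

lemma cvnorm_nonlinear_integral_le:
  assumes ab: "a < b" and al: "\<alpha> \<in> {1 - \<tau><..<lam * \<gamma>}"
  defines "S \<equiv> enn2real (W_seminorm d \<tau> lam a b W)" and "H \<equiv> enn2real (holder_seminorm d \<gamma> a b \<phi>) powr lam"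
  shows "cvnorm d (nonlinear_integral \<tau> lam \<gamma> W \<phi> a b) \<le>
    weyl_constant \<tau> \<alpha> * S * (b - a) powr \<tau> + weyl_constant \<tau> \<alpha> * S * H * (b - a) powr (\<tau> + lam * \<gamma>)"
proof -
  define \<beta> where "\<beta> = (\<alpha> + 1 - \<tau>) / 2"
  define c where "c = 1 + (1 - \<beta>) / (\<tau> - (1 - \<beta>))"
  define k where "k = 1 / (Gamma \<beta> * Gamma (1 - \<beta>))"
  have beta: "\<beta> \<in> {1 - \<tau><..<lam * \<gamma>}" "\<beta> < \<alpha>" using al by (auto simp: \<beta>_def)
  interpret weyl_exponents a b \<beta> \<tau> "lam * \<gamma>" by (rule weyl_exponentsI[OF ab beta(1)])
  have k: "0 < k" using alpha by (simp add: k_def Gamma_real_pos)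
  have c: "0 < c" using c1_pos by (simp add: c1_def c_def)
  have K: "weyl_constant \<tau> \<alpha> = k * (c / (1 - \<beta>) + c * \<beta> / (\<alpha> - \<beta>))"
    by (simp add: weyl_constant_def Let_def k_def c_def \<beta>_def)
  have nonneg: "0 \<le> S" "0 \<le> H" by (simp_all add: S_def H_def)
  have d1: "c / (1 - \<beta>) \<le> c / (1 - \<beta>) + c * \<beta> / (\<alpha> - \<beta>)"
    using c alpha beta by simp
  \<comment> \<open>Here \<gamma> leaves the constant: since
    \<open>\<alpha> < lam * \<gamma>\<close>, the smaller denominator
    \<open>\<alpha> - \<beta>\<close> can be used.\<close>
  have "c * \<beta> / (lam * \<gamma> - \<beta>) \<le> c * \<beta> / (\<alpha> - \<beta>)"
    using c alpha beta al by (intro divide_left_mono) auto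
  also have "\<dots> \<le> c / (1 - \<beta>) + c * \<beta> / (\<alpha> - \<beta>)"
    using c alpha by simp
  finally have d2: "c * \<beta> / (lam * \<gamma> - \<beta>) \<le> c / (1 - \<beta>) + c * \<beta> / (\<alpha> - \<beta>)" .
  have "cvnorm d (nonlinear_integral \<tau> lam \<gamma> W \<phi> a b) \<le>
      k * (c / (1 - \<beta>) * S * (b - a) powr \<tau> + c * \<beta> / (lam * \<gamma> - \<beta>) * (S * H) * (b - a) powr (\<tau> + lam * \<gamma>))"
    using cvnorm_weyl_quantity_le[OF ab beta(1)] unfolding nonlinear_integral_eq[OF ab beta(1)]
    by (simp add: S_def H_def k_def c_def)
  also have "\<dots> \<le> k * ((c / (1 - \<beta>) + c * \<beta> / (\<alpha> - \<beta>)) * S * (b - a) powr \<tau> +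
      (c / (1 - \<beta>) + c * \<beta> / (\<alpha> - \<beta>)) * (S * H) * (b - a) powr (\<tau> + lam * \<gamma>))"
    using k nonneg by (intro mult_left_mono add_mono mult_right_mono d1 d2) auto
  also have "\<dots> = weyl_constant \<tau> \<alpha> * S * (b - a) powr \<tau> + weyl_constant \<tau> \<alpha> * S * H * (b - a) powr (\<tau> + lam * \<gamma>)"
    unfolding K by (simp add: algebra_simps)
  finally show ?thesis .
qed

end

theorem theorem3p3:
  shows "\<exists>\<kappa> :: real \<Rightarrow> real \<Rightarrow> real \<Rightarrow> real.
    \<forall>(\<tau>::real) (lam::real) (\<gamma>::real) (d::nat)
      (W :: real \<Rightarrow> (nat \<Rightarrow> real) \<Rightarrow> nat \<Rightarrow> real) (\<phi> :: real \<Rightarrow> nat \<Rightarrow> real) (a::real) (b::real).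
      \<tau> \<in> {0<..1} \<longrightarrow> lam \<in> {0<..1} \<longrightarrow> \<gamma> \<in> {0<..1} \<longrightarrow> lam * \<gamma> + \<tau> > 1 \<longrightarrow> d \<ge> 1 \<longrightarrow>
      (\<forall>t. \<forall>x\<in>R_space d. W t x \<in> R_space d) \<longrightarrow>
      (\<forall>a' b'. a' < b' \<longrightarrow> W_seminorm d \<tau> lam a' b' W < \<infinity>) \<longrightarrow>
      (\<forall>t. \<phi> t \<in> R_space d) \<longrightarrow>
      (\<forall>a' b'. a' < b' \<longrightarrow> holder_seminorm d \<gamma> a' b' \<phi> < \<infinity>) \<longrightarrow>
      a < b \<longrightarrow>
      (\<forall>\<alpha>\<in>{1 - \<tau><..<lam * \<gamma>}. weyl_quantity_finite \<alpha> W \<phi> a b) \<and>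
      (\<forall>\<alpha>\<in>{1 - \<tau><..<lam * \<gamma>}. \<forall>\<alpha>'\<in>{1 - \<tau><..<lam * \<gamma>}.
         weyl_quantity \<alpha> W \<phi> a b = weyl_quantity \<alpha>' W \<phi> a b) \<and>
      (\<forall>\<alpha>\<in>{1 - \<tau><..<lam * \<gamma>}.
         nonlinear_integral \<tau> lam \<gamma> W \<phi> a b = weyl_quantity \<alpha> W \<phi> a b) \<and>
      (\<forall>\<alpha>\<in>{1 - \<tau><..<lam * \<gamma>}.
         expansion_integrals_exist \<alpha> W \<phi> a b \<and>
         (\<forall>i. nonlinear_integral \<tau> lam \<gamma> W \<phi> a b i = complex_of_real
           (- (1 / (Gamma \<alpha> * Gamma (1 - \<alpha>))) *
            ((LBINT t:{a..b}.
                W_minus b W t (\<phi> t) i / ((b - t) powr (1 - \<alpha>) * (t - a) powr \<alpha>))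
             + \<alpha> * (LBINT t:{a..b}. LBINT r:{a..t}.
                 (W_minus b W t (\<phi> t) i - W_minus b W t (\<phi> r) i) /
                 ((b - t) powr (1 - \<alpha>) * (t - r) powr (\<alpha> + 1)))
             + (1 - \<alpha>) * (LBINT t:{a..b}. LBINT s:{t..b}.
                 (W t (\<phi> t) i - W s (\<phi> t) i) /
                 ((s - t) powr (2 - \<alpha>) * (t - a) powr \<alpha>))
             + \<alpha> * (1 - \<alpha>) * (LBINT t:{a..b}. LBINT r:{a..t}. LBINT s:{t..b}.
                 (W t (\<phi> t) i - W s (\<phi> t) i - W t (\<phi> r) i + W s (\<phi> r) i) /
                 ((s - t) powr (2 - \<alpha>) * (t - r) powr (\<alpha> + 1))))))) \<and>
      (\<forall>\<alpha>\<in>{1 - \<tau><..<lam * \<gamma>}.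
         cvnorm d (nonlinear_integral \<tau> lam \<gamma> W \<phi> a b)
           \<le> \<kappa> \<tau> lam \<alpha> * enn2real (W_seminorm d \<tau> lam a b W) * (b - a) powr \<tau>
             + \<kappa> \<tau> lam \<alpha> * enn2real (W_seminorm d \<tau> lam a b W) *
               enn2real (holder_seminorm d \<gamma> a b \<phi>) powr lam * (b - a) powr (\<tau> + lam * \<gamma>))"
proof (intro exI[of _ "\<lambda>\<tau> lam \<alpha>. weyl_constant \<tau> \<alpha>"] allI impI, goal_cases)
  case (1 \<tau> lam \<gamma> d W \<phi> a b)
  interpret holder_data \<tau> lam \<gamma> d W \<phi>
    by unfold_locales (use 1 in auto)
  note ab = \<open>a < b\<close>
  have G: "\<exists>A B. mixed_holder \<tau> (lam * \<gamma>) a b A B (\<lambda>s r. W s (\<phi> r) i)" for i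
    using mixed_holder_coordinate[OF ab] by blast
  show ?case
  proof (intro conjI ballI allI)
    fix \<alpha> assume al: "\<alpha> \<in> {1 - \<tau><..<lam * \<gamma>}"
    interpret weyl_exponents a b \<alpha> \<tau> "lam * \<gamma>" by (rule weyl_exponentsI[OF ab al])
    show "weyl_quantity_finite \<alpha> W \<phi> a b" by (rule weyl_quantity_finiteI) (rule G)
    show "weyl_quantity \<alpha> W \<phi> a b = weyl_quantity \<alpha>' W \<phi> a b" if "\<alpha>' \<in> {1 - \<tau><..<lam * \<gamma>}" for \<alpha>'
      by (rule weyl_quantity_independent[OF ab al that])
    show "nonlinear_integral \<tau> lam \<gamma> W \<phi> a b = weyl_quantity \<alpha> W \<phi> a b"
      by (rule nonlinear_integral_eq[OF ab al])
    show "expansion_integrals_exist \<alpha> W \<phi> a b" by (rule expansion_integrals_existI) (rule G)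
    show "cvnorm d (nonlinear_integral \<tau> lam \<gamma> W \<phi> a b)
           \<le> weyl_constant \<tau> \<alpha> * enn2real (W_seminorm d \<tau> lam a b W) * (b - a) powr \<tau>
             + weyl_constant \<tau> \<alpha> * enn2real (W_seminorm d \<tau> lam a b W) *
               enn2real (holder_seminorm d \<gamma> a b \<phi>) powr lam * (b - a) powr (\<tau> + lam * \<gamma>)"
      by (rule cvnorm_nonlinear_integral_le[OF ab al])
    fix i
    show "nonlinear_integral \<tau> lam \<gamma> W \<phi> a b i = complex_of_real
           (- (1 / (Gamma \<alpha> * Gamma (1 - \<alpha>))) *
            ((LBINT t:{a..b}.
                W_minus b W t (\<phi> t) i / ((b - t) powr (1 - \<alpha>) * (t - a) powr \<alpha>))
             + \<alpha> * (LBINT t:{a..b}. LBINT r:{a..t}.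
                 (W_minus b W t (\<phi> t) i - W_minus b W t (\<phi> r) i) /
                 ((b - t) powr (1 - \<alpha>) * (t - r) powr (\<alpha> + 1)))
             + (1 - \<alpha>) * (LBINT t:{a..b}. LBINT s:{t..b}.
                 (W t (\<phi> t) i - W s (\<phi> t) i) /
                 ((s - t) powr (2 - \<alpha>) * (t - a) powr \<alpha>))
             + \<alpha> * (1 - \<alpha>) * (LBINT t:{a..b}. LBINT r:{a..t}. LBINT s:{t..b}.
                 (W t (\<phi> t) i - W s (\<phi> t) i - W t (\<phi> r) i + W s (\<phi> r) i) /
                 ((s - t) powr (2 - \<alpha>) * (t - r) powr (\<alpha> + 1)))))"
      \<comment> \<open>With \<open>W_minus\<close> written out, the four integrals of
        \<open>weyl_int_expand\<close> have literally the required form, and unfolding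
        suffices.\<close>
      unfolding nonlinear_integral_eq[OF ab al] weyl_quantity_eq weyl_int_expand(9)[OF mixed_holder_coordinate[OF ab]]
        W_minus_def ..
  qed
qed

end
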